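(* Consider the Lévy-driven polling system with $N\ge1$ queues, input subordinator $\boldsymbol W$ with Laplace exponent $\phi$, and switch-over times $S_1,\dots,S_N$ described in the context, and assume that for every $i=1,\dots,N$ the service discipline at $Q_i$ satisfies the branching property with Laplace exponent $\eta_i$. Let $t_n$ be the $n$th time point at which the server reaches $Q_1$ (with $t_0=0$), and let $\boldsymbol B^n\in\mathbb R_+^N$ be the vector of amounts of fluid in the queues $Q_1,\dots,Q_N$ at time $t_n$. Then $(\boldsymbol B^n)_{n\ge 0}$ is a multi-type Jiřina branching process with immigration, where the branching mechanism $\boldsymbol\kappa=(\kappa_1,\dots,\kappa_N)$ is given by the recursive equations $$\kappa_i(\boldsymbol u)=\eta_i\big(u_1,\ldots,u_i,\kappa_{i+1}(\boldsymbol u),\ldots,\kappa_N(\boldsymbol u)\big),\qquad i=1,\ldots,N,$$ (so $\kappa_N=\eta_N$), and the Laplace–Stieltjes transform $\tilde{\boldsymbol G}$ of the immigration is given by $$\tilde{\boldsymbol G}(\boldsymbol u)=\prod_{i=1}^N \tilde S_i\Big(\phi\big(u_1,\ldots,u_i,\kappa_{i+1}(\boldsymbol u),\ldots,\kappa_N(\boldsymbol u)\big)\Big),$$ where for $i=N$ the argument of $\tilde S_N$ is $\phi(\boldsymbol u)$.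
   Context: Notation. An $N$-dimensional Lévy subordinator is an $\mathbb R^N$-valued Lévy process started at $\boldsymbol 0$ with paths non-decreasing in each coordinate (coordinates may be dependent). The Laplace exponent of a (multidimensional) spectrally positive Lévy process $\boldsymbol L$ is the function $\phi$ with $\mathbb E e^{-\boldsymbol u\cdot\boldsymbol L(t)}=e^{-t\phi(\boldsymbol u)}$, $\boldsymbol u\ge\boldsymbol 0$. For a random variable or vector $X$, $\tilde X(u)=\mathbb E e^{-u\cdot X}$. $\boldsymbol e_i$ is the $i$th unit vector. Polling system. There are $N$ infinite-buffer fluid queues $Q_1,\dots,Q_N$ and one server visiting them cyclically ($Q_{N+1}:=Q_1$). After leaving $Q_j$ and before reaching $Q_{j+1}$ the server incurs a switch-over period whose duration is a positive random variable $S_j$, independent of anything else. The queues are fed by an $N$-dimensional Lévy subordinator $\boldsymbol W$ with Laplace exponent $\phi$; during a switch-over period the workload vector increases by the increment of $\boldsymbol W$ over that period. While the server is at $Q_i$ the workload vector evolves according to a Lévy process $\boldsymbol A_i(t)=(W_1(t),\dots,W_{i-1}(t),A_i(t),W_{i+1}(t),\dots,W_N(t))$, where $A_i$ is a spectrally positive Lévy process with $\mathbb E A_i(1)<0$. The initial vector $\boldsymbol B^0$ is given. Branching property of the discipline at $Q_i$, with Laplace exponent $\eta_i$: if the server arrives at $Q_i$ and finds workload level $x$ there, then during the visit this workload is replaced by $\boldsymbol H_i(x)$, where $\{\boldsymbol H_i(x),x\ge0\}$ is an $N$-dimensional Lévy subordinator with Laplace exponent $\eta_i$ (any Laplace exponent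 of an $N$-dimensional subordinator). That is, if the workload vector on arrival at $Q_i$ is $\boldsymbol x$, then the workload vector at the end of the visit is $\boldsymbol x-x_i\boldsymbol e_i+\boldsymbol H_i(x_i)$. Independent copies of the replacement processes, switch-over durations and input increments are used in different visits and switch-over periods, independently of the past. Multi-type Jiřina branching process (MTJBP) with branching mechanism $\boldsymbol\kappa$ and immigration $\boldsymbol G$: a sequence of $\mathbb R_+^N$-valued random vectors satisfying $$\boldsymbol X^{n+1}=\sum_{i=1}^N \boldsymbol R_i^{n+1}(X_i^n)+\boldsymbol G^{n+1},\qquad n\ge0,$$ where for each $i$ the $\{\boldsymbol R_i^n(x),x\ge0\}$, $n\ge1$, are i.i.d. $N$-dimensional Lévy subordinators with Laplace exponent $\kappa_i$, mutually independent for different $i$; the $\boldsymbol G^n$, $n\ge1$, are i.i.d. non-negative random vectors distributed as $\boldsymbol G$ and independent of the $\boldsymbol R_i^n$; and $\boldsymbol R_i^{n+1},\boldsymbol G^{n+1}$ are independent of $\mathcal F_n^{\boldsymbol X}=\sigma(\boldsymbol X^0,\dots,\boldsymbol X^n)$. Thus $\mathbb E(e^{-\boldsymbol u\cdot\boldsymbol X^{n+1}}\mid\mathcal F^{\boldsymbol X}_n)=e^{-\boldsymbol X^n\cdot\boldsymbol\kappa(\boldsymbol u)}\tilde{\boldsymbol G}(\boldsymbol u)$. *)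

theory Defs
  imports "HOL-Probability.Probability"
begin

text \<open>
  A vector in $R^N$ is of type \<^typ>\<open>real ^ 'n\<close>, where the index type is a finite linear order: its
  elements, in increasing order, are the queues $Q_1, ..., Q_N$ in the order in which they are
  visited. Thus \<^term>\<open>Min UNIV\<close> is $Q_1$ and \<^term>\<open>Max UNIV\<close> is $Q_N$. The relation \<open>\<le>\<close> on vectors is
  the componentwise order. A process is a function of time and outcome; its values at negative
  times are irrelevant. Path properties hold for every outcome.
\<close>

section \<open>Levy processes and subordinators\<close>

definition cadlag :: "(real \<Rightarrow> 'a::topological_space) \<Rightarrow> bool" where
  "cadlag f \<longleftrightarrow> (\<forall>t\<ge>0. (f \<longlongrightarrow> f t) (at_right t)) \<and> (\<forall>t>0. \<exists>l. (f \<longlongrightarrow> l) (at_left t))"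

definition levy_process :: "'w measure \<Rightarrow> (real \<Rightarrow> 'w \<Rightarrow> 'a::euclidean_space) \<Rightarrow> bool" where
  "levy_process M X \<longleftrightarrow>
     prob_space M \<and>
     (\<forall>t\<ge>0. X t \<in> borel_measurable M) \<and>
     (\<forall>\<omega>\<in>space M. X 0 \<omega> = 0 \<and> cadlag (\<lambda>t. X t \<omega>)) \<and>
     (\<forall>(t :: nat \<Rightarrow> real) m. 0 \<le> t 0 \<and> mono t \<longrightarrow>
        prob_space.indep_vars M (\<lambda>_. borel) (\<lambda>k \<omega>. X (t (Suc k)) \<omega> - X (t k) \<omega>) {..<m}) \<and>
     (\<forall>s\<ge>0. \<forall>t\<ge>0. distr M borel (\<lambda>\<omega>. X (s + t) \<omega> - X s \<omega>) = distr M borel (X t))"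

definition levy_subordinator :: "'w measure \<Rightarrow> (real \<Rightarrow> 'w \<Rightarrow> real ^ 'n) \<Rightarrow> bool" where
  "levy_subordinator M X \<longleftrightarrow>
     levy_process M X \<and> (\<forall>\<omega>\<in>space M. \<forall>s t. 0 \<le> s \<and> s \<le> t \<longrightarrow> X s \<omega> \<le> X t \<omega>)"

definition no_negative_jumps :: "(real \<Rightarrow> real) \<Rightarrow> bool" where
  "no_negative_jumps f \<longleftrightarrow> (\<forall>t>0. \<forall>l. (f \<longlongrightarrow> l) (at_left t) \<longrightarrow> l \<le> f t)"

text \<open>The Laplace--Stieltjes transform of a distribution on the line or on $R^N$.\<close>

definition lst :: "'a::euclidean_space measure \<Rightarrow> 'a \<Rightarrow> real" where
  "lst \<nu> u = (LINT x|\<nu>. exp (- (u \<bullet> x)))"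

definition has_laplace_exponent ::
    "'w measure \<Rightarrow> (real \<Rightarrow> 'w \<Rightarrow> real ^ 'n) \<Rightarrow> (real ^ 'n \<Rightarrow> real) \<Rightarrow> bool" where
  "has_laplace_exponent M X \<phi> \<longleftrightarrow>
     (\<forall>u\<ge>0. \<forall>t\<ge>0. lst (distr M borel (X t)) u = exp (- t * \<phi> u))"

section \<open>Generated sigma-algebras\<close>

definition sigma_of :: "'w measure \<Rightarrow> 't set \<Rightarrow> ('t \<Rightarrow> 'w \<Rightarrow> 'a::topological_space) \<Rightarrow> 'w set set" where
  "sigma_of M T Y = sigma_sets (space M) {Y t -` A \<inter> space M | t A. t \<in> T \<and> A \<in> sets borel}"

abbreviation sigma_of_var :: "'w measure \<Rightarrow> ('w \<Rightarrow> 'a::topological_space) \<Rightarrow> 'w set set" where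
  "sigma_of_var M Y \<equiv> sigma_of M (UNIV :: unit set) (\<lambda>_. Y)"

section \<open>Multi-type Jirina branching processes with immigration\<close>

text \<open>The events determined by the input \<open>(n, Some i)\<close>, i.e. the subordinator \<open>R n i\<close>, and by the
  input \<open>(n, None)\<close>, i.e. the immigration \<open>G n\<close>.\<close>

definition mtjbp_events ::
    "'w measure \<Rightarrow> (nat \<Rightarrow> 'n \<Rightarrow> real \<Rightarrow> 'w \<Rightarrow> real ^ 'n) \<Rightarrow> (nat \<Rightarrow> 'w \<Rightarrow> real ^ 'n)
      \<Rightarrow> nat \<times> 'n option \<Rightarrow> 'w set set" where
  "mtjbp_events M R G = (\<lambda>(n, k). case k of
       Some i \<Rightarrow> sigma_of M {0..} (R n i)
     | None \<Rightarrow> sigma_of_var M (G n))"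

text \<open>\<open>X\<close> is an MTJBP with branching mechanism \<open>\<kappa>\<close> and immigration of distribution \<open>\<nu>\<close>. The copies
  \<open>R n i\<close>, \<open>n \<ge> 1\<close>, are identically distributed because they share the Laplace exponent \<open>\<kappa> i\<close>.\<close>

definition mtjbp ::
    "'w measure \<Rightarrow> (nat \<Rightarrow> 'w \<Rightarrow> real ^ 'n) \<Rightarrow> ('n \<Rightarrow> real ^ 'n \<Rightarrow> real) \<Rightarrow> (real ^ 'n) measure \<Rightarrow> bool" where
  "mtjbp M X \<kappa> \<nu> \<longleftrightarrow>
     prob_space M \<and>
     (\<forall>n. X n \<in> borel_measurable M \<and> (\<forall>\<omega>\<in>space M. 0 \<le> X n \<omega>)) \<and>
     (\<exists>(R :: nat \<Rightarrow> 'n \<Rightarrow> real \<Rightarrow> 'w \<Rightarrow> real ^ 'n) (G :: nat \<Rightarrow> 'w \<Rightarrow> real ^ 'n).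
        (\<forall>n\<ge>1. \<forall>i. levy_subordinator M (R n i) \<and> has_laplace_exponent M (R n i) (\<kappa> i)) \<and>
        (\<forall>n\<ge>1. G n \<in> borel_measurable M \<and> (\<forall>\<omega>\<in>space M. 0 \<le> G n \<omega>) \<and> distr M borel (G n) = \<nu>) \<and>
        prob_space.indep_sets M (mtjbp_events M R G) ({1..} \<times> UNIV) \<and>
        (\<forall>n. prob_space.indep_set M
               (sigma_of M {..n} X)
               (sigma_sets (space M) (\<Union>k. mtjbp_events M R G (Suc n, k)))) \<and>
        (\<forall>n. \<forall>\<omega>\<in>space M.
           X (Suc n) \<omega> = (\<Sum>i\<in>UNIV. R (Suc n) i (X n \<omega> $ i) \<omega>) + G (Suc n) \<omega>))"

section \<open>The branching mechanism\<close>

text \<open>From here on the index type is linearly ordered; \<^typ>\<open>real ^ 'n\<close> is spelled out as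
  \<open>(real, 'n) vec\<close> because the infix notation imposes the sort \<open>finite\<close> on \<open>'n\<close>.\<close>

lemma vec_lambda_fundef_cong [fundef_cong]:
  "(\<And>j. f j = g j) \<Longrightarrow> vec_lambda f = vec_lambda g"
  by presburger

function branching_mechanism ::
    "('n::{finite,linorder} \<Rightarrow> (real, 'n) vec \<Rightarrow> real) \<Rightarrow> 'n \<Rightarrow> (real, 'n) vec \<Rightarrow> real" where
  "branching_mechanism \<eta> i u =
     \<eta> i (\<chi> j. if j \<le> i then u $ j else branching_mechanism \<eta> j u)"
  by pat_completeness auto
termination
  by (relation "Wellfounded.measure (\<lambda>(\<eta>, i, u). card {i<..})") (auto intro!: psubset_card_mono)

declare branching_mechanism.simps [simp del]

section \<open>The polling system\<close>

text \<open>The epoch at which the switch-over period following the \<open>n\<close>-th visit to queue \<open>i\<close> ends, where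
  \<open>\<tau> n i\<close> is the epoch at which the \<open>n\<close>-th visit (\<open>n = 0, 1, ...\<close>) to queue \<open>i\<close> begins.\<close>

definition next_arrival :: "(nat \<Rightarrow> 'n::{finite,linorder} \<Rightarrow> 'w \<Rightarrow> real) \<Rightarrow> nat \<Rightarrow> 'n \<Rightarrow> 'w \<Rightarrow> real" where
  "next_arrival \<tau> n i = (if i = Max UNIV then \<tau> (Suc n) (Min UNIV) else \<tau> n (Min {i<..}))"

text \<open>The independent sources of randomness: the initial workload, the evolution and replacement
  during a visit, the duration of a switch-over period, and the input during it.\<close>

datatype 'n source = Initial | Visit nat 'n | Duration nat 'n | Input nat 'n

text \<open>
  The parameters are the workload vector \<open>V\<close> at each time; the arrival epochs \<open>\<tau> n i\<close> and departure
  epochs \<open>\<sigma> n i\<close> of the server; the durations \<open>S n i\<close> of the switch-over periods, with law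
  \<open>switch_law i\<close>; and the copies \<open>W n i\<close>, \<open>A n i\<close>, \<open>H n i\<close> of the input subordinator $W$, of the
  process $A_i$ and of the replacement process $H_i$. No independence is required between \<open>A n i\<close>
  and \<open>H n i\<close>, since both describe the same visit, nor any particular law of its length.
\<close>

locale levy_polling_system = prob_space M
  for M :: "'w measure" +
  fixes \<phi> :: "(real, 'n::{finite,linorder}) vec \<Rightarrow> real"
    and \<eta> :: "'n \<Rightarrow> (real, 'n) vec \<Rightarrow> real"
    and switch_law :: "'n \<Rightarrow> real measure"
    and W A H :: "nat \<Rightarrow> 'n \<Rightarrow> real \<Rightarrow> 'w \<Rightarrow> (real, 'n) vec"
    and S \<tau> \<sigma> :: "nat \<Rightarrow> 'n \<Rightarrow> 'w \<Rightarrow> real"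
    and V :: "real \<Rightarrow> 'w \<Rightarrow> (real, 'n) vec"
  assumes input_subordinator: "levy_subordinator M (W n i)"
    and input_exponent: "has_laplace_exponent M (W n i) \<phi>"
    and switch_measurable: "S n i \<in> borel_measurable M"
    and switch_positive: "\<omega> \<in> space M \<Longrightarrow> 0 < S n i \<omega>"
    and switch_distr: "distr M borel (S n i) = switch_law i"
    \<comment> \<open>\<open>A n i\<close> is a copy of $A_i$, and its coordinates other than \<open>i\<close> are those of $W$\<close>
    and visit_levy: "levy_process M (A n i)"
    and visit_copy: "0 \<le> t \<Longrightarrow> distr M borel (A n i t) = distr M borel (A 0 i t)"
    and visit_other_mono:
      "\<lbrakk>\<omega> \<in> space M; j \<noteq> i; 0 \<le> s; s \<le> t\<rbrakk> \<Longrightarrow> A n i s \<omega> $ j \<le> A n i t \<omega> $ j"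
    and visit_other_distr: "0 \<le> t \<Longrightarrow>
      distr M borel (\<lambda>\<omega>. (\<chi> j. if j = i then 0 else A n i t \<omega> $ j) :: (real, 'n) vec) =
      distr M borel (\<lambda>\<omega>. \<chi> j. if j = i then 0 else W n i t \<omega> $ j)"
    and visit_spectrally_positive:
      "\<omega> \<in> space M \<Longrightarrow> no_negative_jumps (\<lambda>t. A n i t \<omega> $ i)"
    and visit_integrable: "integrable M (\<lambda>\<omega>. A n i 1 \<omega> $ i)"
    and visit_drift: "expectation (\<lambda>\<omega>. A n i 1 \<omega> $ i) < 0"
    and replacement_subordinator: "levy_subordinator M (H n i)"
    and replacement_exponent: "has_laplace_exponent M (H n i) (\<eta> i)"
    and initial_measurable: "V 0 \<in> borel_measurable M"
    and independence: "indep_sets (\<lambda>x. case x of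
          Initial \<Rightarrow> sigma_of_var M (V 0)
        | Visit n i \<Rightarrow> sigma_of M {0..} (\<lambda>t \<omega>. (A n i t \<omega>, H n i t \<omega>))
        | Duration n i \<Rightarrow> sigma_of_var M (S n i)
        | Input n i \<Rightarrow> sigma_of M {0..} (W n i)) UNIV"
    and epochs_measurable: "\<tau> n i \<in> borel_measurable M" "\<sigma> n i \<in> borel_measurable M"
    and start: "\<omega> \<in> space M \<Longrightarrow> \<tau> 0 (Min UNIV) \<omega> = 0"
    and visit_length: "\<omega> \<in> space M \<Longrightarrow> \<tau> n i \<omega> \<le> \<sigma> n i \<omega>"
    and switch_length: "\<omega> \<in> space M \<Longrightarrow> next_arrival \<tau> n i \<omega> = \<sigma> n i \<omega> + S n i \<omega>"
    and workload_nonneg: "\<omega> \<in> space M \<Longrightarrow> 0 \<le> t \<Longrightarrow> 0 \<le> V t \<omega>"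
    and workload_visit: "\<lbrakk>\<omega> \<in> space M; 0 \<le> s; s \<le> \<sigma> n i \<omega> - \<tau> n i \<omega>\<rbrakk> \<Longrightarrow>
      V (\<tau> n i \<omega> + s) \<omega> = V (\<tau> n i \<omega>) \<omega> + A n i s \<omega>"
    and workload_switch: "\<lbrakk>\<omega> \<in> space M; 0 \<le> s; s \<le> S n i \<omega>\<rbrakk> \<Longrightarrow>
      V (\<sigma> n i \<omega> + s) \<omega> = V (\<sigma> n i \<omega>) \<omega> + W n i s \<omega>"
    and branching_property: "\<omega> \<in> space M \<Longrightarrow>
      V (\<sigma> n i \<omega>) \<omega> = V (\<tau> n i \<omega>) \<omega> - (V (\<tau> n i \<omega>) \<omega> $ i) *\<^sub>R axis i 1
                        + H n i (V (\<tau> n i \<omega>) \<omega> $ i) \<omega>"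

end

theory Submission
  imports Defs
begin

text \<open>
  During one visit and the following switch-over period the workload makes a step
  \<open>Y = (\<Sum>k. R k (X $ k)) + G\<close>, with \<open>R k\<close> independent subordinators and \<open>G\<close> an independent
  immigration: \<open>R i\<close> is the replacement process of the visited queue and \<open>R k s = s e\<^sub>k\<close> for the other
  ones. A cycle is a composition of such steps, so it suffices that the composition of two steps is a
  step, with \<open>\<kappa> i u = \<kappa>1 i (\<kappa>2 u)\<close> and \<open>g u = g1 (\<kappa>2 u) * g2 u\<close>.

  The difficulty is to exhibit the composed subordinators on the given probability space. The second
  step evaluates its \<open>R k\<close> at a sum of contributions \<open>b\<^sub>0 + b\<^sub>1 + ...\<close> of the types and of the immigration
  of the first step. Lane \<open>i\<close> of \<open>R k\<close> runs through the increments of \<open>R k\<close> over the \<open>i\<close>-th of these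
  blocks, and then through every \<open>m\<close>-th unit block after their sum, where \<open>m\<close> is the number of
  lanes. For block lengths that are independent of \<open>R k\<close> the lanes are independent copies of \<open>R k\<close>,
  and their values at \<open>b\<^sub>i\<close> sum to \<open>R k (b\<^sub>0 + b\<^sub>1 + ...)\<close>.

  Laws and independence are established through Laplace transforms of increments over ordered
  intervals, which determine them.
\<close>

section \<open>Uniqueness of Laplace transforms\<close>

text \<open>An MTJBP needs its subordinators and immigration vectors on \<open>M\<close> itself,
  with the recursion holding at every outcome. Neither a larger space nor mere equality in law will
  do: the composed processes must be cut out of existing paths. The cuts depend on the first step,
  hence on the past. Independence of the past survives because, with the cuts frozen, the transform
  of the second step depends on them only through the lane times that are read off, not through the
  block lengths. It is the exponential of a linear functional of increments of the first step, which
  the transform of the first step evaluates in turn. So the invariant is one identity for all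
  systems of ordered intervals, on an arbitrary past event. The unit blocks are there because a
  subordinator must be defined at all times, whereas the prescribed blocks may be short or empty;
  every lane needs a supply of time that never runs out. A cycle is assembled backwards from its
  last queue, the direction in which the recursion for \<kappa> runs.\<close>

lemma borel_measurable_vec_lambda [measurable (raw)]:
  fixes f :: "'n::finite \<Rightarrow> 'a \<Rightarrow> real"
  assumes "\<And>k. f k \<in> borel_measurable M"
  shows "(\<lambda>x. \<chi> k. f k x) \<in> borel_measurable M"
  by (subst borel_measurable_euclidean_space)
     (use assms in \<open>auto simp: Basis_vec_def inner_axis\<close>)

lemma borel_measurable_vec_nth [measurable (raw)]:
  fixes f :: "'a \<Rightarrow> real ^ 'n"
  assumes "f \<in> borel_measurable M"
  shows "(\<lambda>x. f x $ k) \<in> borel_measurable M"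
  using borel_measurable_inner[OF assms, of "\<lambda>_. axis k 1"] by (simp add: inner_axis)

context prob_space begin

text \<open>Dynkin's argument for signed weights: sets with equal integrals are closed under
  complements and countable disjoint unions. Complements use \<open>tot\<close>, since
  \<open>G\<close> need not contain \<open>space M\<close>.\<close>

lemma integral_mult_indicator_sigma_sets_eq:
  fixes w1 w2 :: "'a \<Rightarrow> real"
  assumes w: "integrable M w1" "integrable M w2"
    and G: "G \<subseteq> sets M" "Int_stable G"
    and eq: "\<And>E. E \<in> G \<Longrightarrow> (\<integral>\<omega>. w1 \<omega> * indicator E \<omega> \<partial>M) = (\<integral>\<omega>. w2 \<omega> * indicator E \<omega> \<partial>M)"
    and tot: "(\<integral>\<omega>. w1 \<omega> \<partial>M) = (\<integral>\<omega>. w2 \<omega> \<partial>M)"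
    and E: "E \<in> sigma_sets (space M) G"
  shows "(\<integral>\<omega>. w1 \<omega> * indicator E \<omega> \<partial>M) = (\<integral>\<omega>. w2 \<omega> * indicator E \<omega> \<partial>M)"
proof -
  have GP: "G \<subseteq> Pow (space M)"
    using G(1) sets.sets_into_space by auto
  have sub: "sigma_sets (space M) G \<subseteq> sets M"
    using G(1) by (rule sets.sigma_sets_subset)
  show ?thesis
    using G(2) GP E
  proof (induction rule: sigma_sets_induct_disjoint)
    case (basic A)
    then show ?case by (rule eq)
  next
    case empty
    show ?case by simp
  next
    case (compl A)
    then have A: "A \<in> sets M"
      using sub by auto
    have *: "(\<integral>\<omega>. w \<omega> * indicator (space M - A) \<omega> \<partial>M)
        = (\<integral>\<omega>. w \<omega> \<partial>M) - (\<integral>\<omega>. w \<omega> * indicator A \<omega> \<partial>M)"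
      if "integrable M w" for w :: "'a \<Rightarrow> real"
    proof -
      have "(\<integral>\<omega>. w \<omega> * indicator (space M - A) \<omega> \<partial>M) = (\<integral>\<omega>. w \<omega> - w \<omega> * indicator A \<omega> \<partial>M)"
        by (rule Bochner_Integration.integral_cong) (auto simp: indicator_def)
      also have "\<dots> = (\<integral>\<omega>. w \<omega> \<partial>M) - (\<integral>\<omega>. w \<omega> * indicator A \<omega> \<partial>M)"
        using that A by (intro Bochner_Integration.integral_diff integrable_real_mult_indicator)
      finally show ?thesis .
    qed
    show ?case
      using compl w tot by (simp add: *)
  next
    case (union A)
    then have A: "A i \<in> sets M" for i
      using sub by auto
    have *: "(\<integral>\<omega>. w \<omega> * indicator (\<Union>i. A i) \<omega> \<partial>M) = (\<Sum>i. \<integral>\<omega>. w \<omega> * indicator (A i) \<omega> \<partial>M)"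
      if "integrable M w" for w :: "'a \<Rightarrow> real"
    proof -
      have "set_integrable M (\<Union>i. A i) w"
        unfolding set_integrable_def using A
        by (intro integrable_mult_indicator that) auto
      then show ?thesis
        using lebesgue_integral_countable_add[of A M w] A union(1)
        by (auto simp: set_lebesgue_integral_def disjoint_family_on_def mult.commute)
    qed
    show ?case
      using union w by (simp add: *)
  qed
qed

text \<open>The map \<open>x \<mapsto> (exp (- x\<^sub>k))\<^sub>k\<close> turns exponentials into monomials on the unit cube, where
  polynomials are dense.\<close>

lemma integral_eq_of_laplace_eq:
  fixes Y :: "'a \<Rightarrow> real ^ 'n" and w1 w2 :: "'a \<Rightarrow> real"
  assumes Y [measurable]: "Y \<in> borel_measurable M" and Y0: "\<And>\<omega>. \<omega> \<in> space M \<Longrightarrow> 0 \<le> Y \<omega>"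
    and w: "integrable M w1" "integrable M w2"
    and eq: "\<And>u. 0 \<le> u \<Longrightarrow>
      (\<integral>\<omega>. w1 \<omega> * exp (- (u \<bullet> Y \<omega>)) \<partial>M) = (\<integral>\<omega>. w2 \<omega> * exp (- (u \<bullet> Y \<omega>)) \<partial>M)"
    and A: "A \<in> sets borel"
  shows "(\<integral>\<omega>. w1 \<omega> * indicator A (Y \<omega>) \<partial>M) = (\<integral>\<omega>. w2 \<omega> * indicator A (Y \<omega>) \<partial>M)"
proof -
  define Z where "Z \<omega> = (\<chi> k. exp (- (Y \<omega> $ k)))" for \<omega>
  define C :: "(real ^ 'n) set" where "C = cbox 0 1"
  have [measurable]: "Z \<in> borel_measurable M"
    unfolding Z_def by measurable
  have ZC: "Z \<omega> \<in> C" if "\<omega> \<in> space M" for \<omega>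
    using Y0[OF that] by (auto simp: Z_def C_def mem_box_cart less_eq_vec_def)
  have [measurable]: "w1 \<in> borel_measurable M" "w2 \<in> borel_measurable M"
    using w by auto
  have bnd: "\<exists>B. \<forall>x\<in>C. \<bar>h x\<bar> \<le> B" if "continuous_on C h" for h :: "real ^ 'n \<Rightarrow> real"
  proof -
    have "bounded (h ` C)"
      using that by (intro compact_imp_bounded compact_continuous_image) (auto simp: C_def)
    then show ?thesis
      by (auto simp: bounded_iff)
  qed
  have int: "integrable M (\<lambda>\<omega>. w \<omega> * h (Z \<omega>))"
    if "integrable M w" and "continuous_on UNIV h" for w and h :: "real ^ 'n \<Rightarrow> real"
  proof -
    have [measurable]: "h \<in> borel_measurable borel" "w \<in> borel_measurable M"
      using that by (auto intro: borel_measurable_continuous_onI)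
    have "continuous_on C h"
      using that(2) by (rule continuous_on_subset) simp
    then obtain B where B: "\<And>x. x \<in> C \<Longrightarrow> \<bar>h x\<bar> \<le> B"
      using bnd by metis
    show ?thesis
    proof (rule Bochner_Integration.integrable_bound)
      show "integrable M (\<lambda>\<omega>. B * \<bar>w \<omega>\<bar>)"
        using that(1) by simp
      have "\<bar>w \<omega>\<bar> * \<bar>h (Z \<omega>)\<bar> \<le> \<bar>B * \<bar>w \<omega>\<bar>\<bar>" if "\<omega> \<in> space M" for \<omega>
      proof -
        have "\<bar>h (Z \<omega>)\<bar> \<le> \<bar>B\<bar>"
          using B[OF ZC[OF that]] by linarith
        then have "\<bar>w \<omega>\<bar> * \<bar>h (Z \<omega>)\<bar> \<le> \<bar>w \<omega>\<bar> * \<bar>B\<bar>"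
          by (rule mult_left_mono) simp
        then show ?thesis
          by (simp add: abs_mult mult.commute)
      qed
      then show "AE \<omega> in M. norm (w \<omega> * h (Z \<omega>)) \<le> norm (B * \<bar>w \<omega>\<bar>)"
        by (simp add: abs_mult)
    qed measurable
  qed
  have expint: "integrable M (\<lambda>\<omega>. w \<omega> * exp (- (u \<bullet> Y \<omega>)))"
    if "integrable M w" "0 \<le> u" for w u
  proof -
    have [measurable]: "w \<in> borel_measurable M"
      using that by auto
    have "0 \<le> u \<bullet> Y \<omega>" if "\<omega> \<in> space M" for \<omega>
      using Y0[OF that] \<open>0 \<le> u\<close> by (auto simp: inner_vec_def less_eq_vec_def intro!: sum_nonneg)
    then show ?thesis
      by (intro Bochner_Integration.integrable_bound[OF that(1)]) (auto simp: abs_mult intro!: mult_left_le)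
  qed
  \<comment> \<open>Keeping the factor \<open>exp (- (u \<bullet> Y \<omega>))\<close> for every
    \<open>u\<close> makes the class closed under multiplication by a coordinate: a factor
    \<open>Z \<omega> $ k\<close> only shifts \<open>u\<close> by \<open>axis k 1\<close>.\<close>
  define good where "good h \<longleftrightarrow> continuous_on UNIV h \<and>
      (\<forall>u\<ge>0. (\<integral>\<omega>. w1 \<omega> * exp (- (u \<bullet> Y \<omega>)) * h (Z \<omega>) \<partial>M)
           = (\<integral>\<omega>. w2 \<omega> * exp (- (u \<bullet> Y \<omega>)) * h (Z \<omega>) \<partial>M))" for h :: "real ^ 'n \<Rightarrow> real"
  have good_add: "good (\<lambda>z. f z + g z)" if "good f" "good g" for f g
    using that int[OF expint[OF w(1)]] int[OF expint[OF w(2)]] unfolding good_def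
    by (auto simp: distrib_left intro!: continuous_intros)
  have good_scale: "good (\<lambda>z. c * f z)" if "good f" for f c
  proof -
    have *: "w * exp s * (c * x) = c * (w * exp s * x)" for w s x :: real
      by simp
    show ?thesis
      using that unfolding good_def * by (auto intro!: continuous_intros)
  qed
  have good_sum: "good (\<lambda>z. \<Sum>k\<in>K. f k z)" if "finite K" "\<And>k. k \<in> K \<Longrightarrow> good (f k)"
    for K :: "'n set" and f
    using that
  proof (induction K)
    case empty
    then show ?case by (simp add: good_def)
  qed (auto intro: good_add)
  have good_coord: "good (\<lambda>z. z $ k * f z)" if "good f" for f k
    unfolding good_def
  proof (intro conjI allI impI)
    show "continuous_on UNIV (\<lambda>z. z $ k * f z)"
      using that by (auto simp: good_def intro!: continuous_intros)
    fix u :: "real ^ 'n" assume u: "0 \<le> u"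
    have *: "exp (- (u \<bullet> Y \<omega>)) * (Z \<omega> $ k * f (Z \<omega>)) = exp (- ((u + axis k 1) \<bullet> Y \<omega>)) * f (Z \<omega>)" for \<omega>
      by (simp add: Z_def inner_add_left inner_axis' exp_diff exp_minus field_simps exp_add)
    have "0 \<le> u + axis k 1"
      using u by (auto simp: less_eq_vec_def axis_def)
    then show "(\<integral>\<omega>. w1 \<omega> * exp (- (u \<bullet> Y \<omega>)) * (Z \<omega> $ k * f (Z \<omega>)) \<partial>M)
           = (\<integral>\<omega>. w2 \<omega> * exp (- (u \<bullet> Y \<omega>)) * (Z \<omega> $ k * f (Z \<omega>)) \<partial>M)"
      using that unfolding good_def by (simp add: mult.assoc *)
  qed
  \<comment> \<open>Polynomials are treated as multipliers of good functions, because goodness of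
    two factors alone says nothing about their product, whereas multipliers compose.\<close>
  have poly: "\<forall>h. good h \<longrightarrow> good (\<lambda>z. p z * h z)" if "real_polynomial_function p" for p
    using that
  proof induction
    case (linear f)
    have f: "f z = (\<Sum>k\<in>UNIV. z $ k * f (axis k 1))" for z
    proof -
      interpret bounded_linear f by fact
      have "f z = f (\<Sum>k\<in>UNIV. z $ k *\<^sub>R axis k 1)"
        by (subst basis_expansion[symmetric]) (simp add: scalar_mult_eq_scaleR)
      then show ?thesis
        by (simp add: sum scaleR)
    qed
    show ?case
    proof (intro allI impI)
      fix h assume h: "good h"
      have "good (\<lambda>z. \<Sum>k\<in>UNIV. f (axis k 1) * (z $ k * h z))"
        by (intro good_sum good_scale good_coord h) simp
      moreover have "f z * h z = (\<Sum>k\<in>UNIV. f (axis k 1) * (z $ k * h z))" for z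
        by (subst f) (simp add: sum_distrib_left mult_ac)
      ultimately show "good (\<lambda>z. f z * h z)"
        by simp
    qed
  next
    case (add f g)
    show ?case
      unfolding distrib_right using add.IH by (intro allI impI good_add) simp_all
  next
    case (mult f g)
    show ?case
      unfolding mult.assoc using mult.IH by (intro allI impI) simp
  next
    case (const c)
    show ?case
      by (intro allI impI good_scale)
  qed
  have good1: "good (\<lambda>_. 1)"
    using eq by (simp add: good_def)
  have peq: "(\<integral>\<omega>. w1 \<omega> * p (Z \<omega>) \<partial>M) = (\<integral>\<omega>. w2 \<omega> * p (Z \<omega>) \<partial>M)"
    if "real_polynomial_function p" for p
  proof -
    have "good (\<lambda>z. p z * 1)"
      using poly[OF that] good1 by blast
    then show ?thesis
      by (auto simp: good_def dest!: spec[of _ 0])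
  qed
  have ceq: "(\<integral>\<omega>. w1 \<omega> * f (Z \<omega>) \<partial>M) = (\<integral>\<omega>. w2 \<omega> * f (Z \<omega>) \<partial>M)"
    if f: "continuous_on UNIV f" for f :: "real ^ 'n \<Rightarrow> real"
  proof -
    define B where "B = (\<integral>\<omega>. \<bar>w1 \<omega>\<bar> \<partial>M) + (\<integral>\<omega>. \<bar>w2 \<omega>\<bar> \<partial>M)"
    let ?d = "\<bar>(\<integral>\<omega>. w1 \<omega> * f (Z \<omega>) \<partial>M) - (\<integral>\<omega>. w2 \<omega> * f (Z \<omega>) \<partial>M)\<bar>"
    have B0: "0 \<le> B"
      by (simp add: B_def)
    have le: "?d \<le> e * B" if "0 < e" for e
    proof -
      have "compact C" "continuous_on C f"
        using f continuous_on_subset by (auto simp: C_def)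
      then obtain p where p: "real_polynomial_function p" "\<And>x. x \<in> C \<Longrightarrow> \<bar>f x - p x\<bar> < e"
        using Stone_Weierstrass_real_polynomial_function \<open>0 < e\<close> by blast
      have pc: "continuous_on UNIV p"
        using p(1) by (simp add: continuous_on_polymonial_function real_polynomial_function_eq)
      have app: "\<bar>(\<integral>\<omega>. w \<omega> * f (Z \<omega>) \<partial>M) - (\<integral>\<omega>. w \<omega> * p (Z \<omega>) \<partial>M)\<bar> \<le> e * (\<integral>\<omega>. \<bar>w \<omega>\<bar> \<partial>M)"
        if w: "integrable M w" for w
      proof -
        have "(\<integral>\<omega>. w \<omega> * f (Z \<omega>) \<partial>M) - (\<integral>\<omega>. w \<omega> * p (Z \<omega>) \<partial>M)
            = (\<integral>\<omega>. w \<omega> * f (Z \<omega>) - w \<omega> * p (Z \<omega>) \<partial>M)"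
          using w f pc by (simp add: int)
        also have "\<bar>\<dots>\<bar> \<le> (\<integral>\<omega>. \<bar>w \<omega> * f (Z \<omega>) - w \<omega> * p (Z \<omega>)\<bar> \<partial>M)"
          by (rule integral_abs_bound)
        also have "\<dots> \<le> (\<integral>\<omega>. e * \<bar>w \<omega>\<bar> \<partial>M)"
        proof (rule integral_mono)
          show "\<bar>w \<omega> * f (Z \<omega>) - w \<omega> * p (Z \<omega>)\<bar> \<le> e * \<bar>w \<omega>\<bar>" if "\<omega> \<in> space M" for \<omega>
            using mult_left_mono[OF less_imp_le[OF p(2)[OF ZC[OF that]]], of "\<bar>w \<omega>\<bar>"]
            by (simp add: abs_mult mult.commute[of e] flip: right_diff_distrib)
        qed (use w f pc in \<open>auto simp: int intro!: integrable_abs\<close>)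
        finally show ?thesis by simp
      qed
      show ?thesis
        using app[OF w(1)] app[OF w(2)] peq[OF p(1)] unfolding B_def by (simp add: distrib_left)
    qed
    have "?d \<le> 0"
    proof (rule field_le_epsilon)
      fix e :: real assume "0 < e"
      \<comment> \<open>The summand \<open>1\<close> keeps the denominator positive when both
        weights vanish almost everywhere.\<close>
      then have "?d \<le> e / (B + 1) * B"
        using B0 by (intro le) auto
      also have "\<dots> \<le> e"
        using \<open>0 < e\<close> B0 by (simp add: field_simps)
      finally show "?d \<le> 0 + e" by simp
    qed
    then show ?thesis by simp
  qed
  have closed_eq: "(\<integral>\<omega>. w1 \<omega> * indicator (Z -` D \<inter> space M) \<omega> \<partial>M)
      = (\<integral>\<omega>. w2 \<omega> * indicator (Z -` D \<inter> space M) \<omega> \<partial>M)" if D: "closed D" for D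
  \<comment> \<open>The empty set is separated because \<open>infdist\<close> to it is
    \<open>0\<close>: the continuous functions that approximate the indicator from above would then
    be constantly \<open>1\<close>.\<close>
  proof (cases "D = {}")
    case False
    define f where "f n z = max 0 (1 - real n * infdist z D)" for n and z :: "real ^ 'n"
    have fc: "continuous_on UNIV (f n)" for n
      unfolding f_def by (intro continuous_intros)
    have [measurable]: "f n \<in> borel_measurable borel" for n
      using fc by (rule borel_measurable_continuous_onI)
    have [measurable]: "D \<in> sets borel"
      using D by auto
    have lim: "(\<lambda>n. f n z) \<longlonglongrightarrow> indicator D z" for z
    proof (cases "z \<in> D")
      case False
      then have "0 < infdist z D"
        using D \<open>D \<noteq> {}\<close> in_closed_iff_infdist_zero[of D z] infdist_nonneg[of z D] by auto
      then obtain N where N: "1 < real N * infdist z D"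
        using reals_Archimedean3 by blast
      have "f n z = 0" if "N \<le> n" for n
      proof -
        have "real N * infdist z D \<le> real n * infdist z D"
          using that by (intro mult_right_mono) (auto simp: infdist_nonneg)
        then show ?thesis
          using N by (simp add: f_def)
      qed
      then have "eventually (\<lambda>n. f n z = 0) sequentially"
        by (auto simp: eventually_sequentially)
      then show ?thesis
        using False by (simp add: tendsto_eventually)
    qed (simp add: f_def)
    have "(\<lambda>n. \<integral>\<omega>. w \<omega> * f n (Z \<omega>) \<partial>M) \<longlonglongrightarrow> (\<integral>\<omega>. w \<omega> * indicator D (Z \<omega>) \<partial>M)"
      if "integrable M w" for w
    proof (rule integral_dominated_convergence)
      have [measurable]: "w \<in> borel_measurable M"
        using that by auto
      show "integrable M (\<lambda>\<omega>. \<bar>w \<omega>\<bar>)"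
        using that by auto
      show "(\<lambda>\<omega>. w \<omega> * indicator D (Z \<omega>)) \<in> borel_measurable M"
        "(\<lambda>\<omega>. w \<omega> * f n (Z \<omega>)) \<in> borel_measurable M" for n
        by measurable
      show "AE \<omega> in M. (\<lambda>n. w \<omega> * f n (Z \<omega>)) \<longlonglongrightarrow> w \<omega> * indicator D (Z \<omega>)"
        using lim by (intro AE_I2 tendsto_intros)
      show "AE \<omega> in M. norm (w \<omega> * f n (Z \<omega>)) \<le> \<bar>w \<omega>\<bar>" for n
        by (auto simp: abs_mult f_def infdist_nonneg intro!: AE_I2 mult_left_le)
    qed
    from this[OF w(1)] this[OF w(2)]
    have "(\<integral>\<omega>. w1 \<omega> * indicator D (Z \<omega>) \<partial>M) = (\<integral>\<omega>. w2 \<omega> * indicator D (Z \<omega>) \<partial>M)"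
      by (simp add: ceq[OF fc] LIMSEQ_unique)
    moreover have "(\<integral>\<omega>. w \<omega> * indicator (Z -` D \<inter> space M) \<omega> \<partial>M) = (\<integral>\<omega>. w \<omega> * indicator D (Z \<omega>) \<partial>M)"
      for w :: "'a \<Rightarrow> real"
      by (rule Bochner_Integration.integral_cong) (auto simp: indicator_def)
    ultimately show ?thesis by simp
  qed simp
  define G where "G = {Z -` D \<inter> space M | D. D \<in> Collect closed}"
  \<comment> \<open>The coordinatewise map \<open>- ln\<close> inverts the passage from
    \<open>Y\<close> to \<open>Z\<close>, so \<open>Z \<omega> \<in> D\<close> exactly when
    \<open>Y \<omega> \<in> A\<close>.\<close>
  define D where "D = (\<lambda>z :: real ^ 'n. \<chi> k. - ln (z $ k)) -` A"
  have "(\<lambda>z :: real ^ 'n. \<chi> k. - ln (z $ k)) \<in> borel_measurable borel"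
    by measurable
  then have "D \<in> sets borel"
    unfolding D_def using A measurable_sets_borel by blast
  then have "D \<in> sigma_sets UNIV (Collect closed)"
    by (simp add: borel_eq_closed)
  then have "Z -` D \<inter> space M \<in> sigma_sets (space M) G"
    unfolding G_def by (subst sigma_sets_vimage_commute[symmetric, where \<Omega>'=UNIV]) auto
  moreover have "G \<subseteq> sets M"
    unfolding G_def by auto
  moreover have "Int_stable G"
    unfolding Int_stable_def G_def
    by safe (rule_tac x="D \<inter> Da" in exI, auto)
  moreover have "(\<integral>\<omega>. w1 \<omega> \<partial>M) = (\<integral>\<omega>. w2 \<omega> \<partial>M)"
    using ceq[of "\<lambda>_. 1"] by simp
  ultimately have "(\<integral>\<omega>. w1 \<omega> * indicator (Z -` D \<inter> space M) \<omega> \<partial>M)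
      = (\<integral>\<omega>. w2 \<omega> * indicator (Z -` D \<inter> space M) \<omega> \<partial>M)"
    using closed_eq w by - (rule integral_mult_indicator_sigma_sets_eq[of _ _ G], auto simp: G_def)
  moreover have "(\<integral>\<omega>. w \<omega> * indicator (Z -` D \<inter> space M) \<omega> \<partial>M) = (\<integral>\<omega>. w \<omega> * indicator A (Y \<omega>) \<partial>M)"
    for w :: "'a \<Rightarrow> real"
    by (rule Bochner_Integration.integral_cong) (auto simp: indicator_def D_def Z_def)
  ultimately show ?thesis by simp
qed

end

section \<open>Joint Laplace transforms of processes and the sigma-algebras they generate\<close>

definition laplace_test :: "('t \<Rightarrow> 'w \<Rightarrow> real ^ 'n) \<Rightarrow> 't set \<Rightarrow> ('t \<Rightarrow> real ^ 'n) \<Rightarrow> 'w \<Rightarrow> real" where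
  "laplace_test Y I u \<omega> = exp (- (\<Sum>t\<in>I. u t \<bullet> Y t \<omega>))"

lemma inner_nonneg_vec: "0 \<le> u \<Longrightarrow> 0 \<le> x \<Longrightarrow> 0 \<le> u \<bullet> (x :: real ^ 'n)"
  by (auto simp: inner_vec_def less_eq_vec_def intro!: sum_nonneg)

lemma laplace_test_empty [simp]: "laplace_test Y {} u \<omega> = 1"
  by (simp add: laplace_test_def)

lemma laplace_test_pos: "0 < laplace_test Y I u \<omega>"
  by (simp add: laplace_test_def)

lemma laplace_test_le_1:
  assumes "\<And>t. t \<in> I \<Longrightarrow> 0 \<le> u t" "\<And>t. t \<in> I \<Longrightarrow> 0 \<le> Y t \<omega>"
  shows "laplace_test Y I u \<omega> \<le> 1"
  using assms by (auto simp: laplace_test_def intro!: sum_nonneg inner_nonneg_vec)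

lemma laplace_test_insert:
  assumes "finite I" "t \<notin> I"
  shows "laplace_test Y (insert t I) u \<omega> = exp (- (u t \<bullet> Y t \<omega>)) * laplace_test Y I u \<omega>"
  using assms by (simp add: laplace_test_def exp_add exp_diff exp_minus field_simps)

lemma laplace_test_measurable [measurable (raw)]:
  assumes "\<And>t. t \<in> I \<Longrightarrow> Y t \<in> borel_measurable M"
  shows "laplace_test Y I u \<in> borel_measurable M"
proof -
  have "(\<lambda>\<omega>. \<Sum>t\<in>I. u t \<bullet> Y t \<omega>) \<in> borel_measurable M"
    using assms by (intro borel_measurable_sum borel_measurable_inner) auto
  then show ?thesis
    unfolding laplace_test_def by measurable
qed

lemma sigma_of_subset:
  assumes "\<And>t. t \<in> T \<Longrightarrow> Y t \<in> borel_measurable M"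
  shows "sigma_of M T Y \<subseteq> sets M"
  unfolding sigma_of_def using assms by (intro sets.sigma_sets_subset) auto

context prob_space begin

lemma integrable_mult_bounded:
  fixes f g :: "'a \<Rightarrow> real"
  assumes "integrable M f" "g \<in> borel_measurable M" "\<And>\<omega>. \<omega> \<in> space M \<Longrightarrow> \<bar>g \<omega>\<bar> \<le> 1"
  shows "integrable M (\<lambda>\<omega>. f \<omega> * g \<omega>)"
  by (rule Bochner_Integration.integrable_bound[OF assms(1)])
     (use assms in \<open>auto simp: abs_mult intro!: mult_left_le\<close>)

text \<open>Cylinder sets form an intersection-stable generator of \<open>sigma_of M T Y\<close>.
  They are reached by turning exponentials into indicators one index at a time; what remains is
  absorbed into the weight, so that only the uniqueness theorem for a single vector is used.\<close>

lemma integral_indicator_sigma_of_eq: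
  fixes Y :: "'t \<Rightarrow> 'a \<Rightarrow> real ^ 'n" and w1 w2 :: "'a \<Rightarrow> real"
  assumes Y: "\<And>t. t \<in> T \<Longrightarrow> Y t \<in> borel_measurable M"
    and Y0: "\<And>t \<omega>. t \<in> T \<Longrightarrow> \<omega> \<in> space M \<Longrightarrow> 0 \<le> Y t \<omega>"
    and w: "integrable M w1" "integrable M w2"
    and eq: "\<And>I u. finite I \<Longrightarrow> I \<subseteq> T \<Longrightarrow> (\<And>t. 0 \<le> u t) \<Longrightarrow>
      (\<integral>\<omega>. w1 \<omega> * laplace_test Y I u \<omega> \<partial>M) = (\<integral>\<omega>. w2 \<omega> * laplace_test Y I u \<omega> \<partial>M)"
    and E: "E \<in> sigma_of M T Y"
  shows "(\<integral>\<omega>. w1 \<omega> * indicator E \<omega> \<partial>M) = (\<integral>\<omega>. w2 \<omega> * indicator E \<omega> \<partial>M)"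
proof -
  define cyl where "cyl J A = {\<omega> \<in> space M. \<forall>t\<in>J. Y t \<omega> \<in> A t}" for J and A :: "'t \<Rightarrow> (real ^ 'n) set"
  have cyl_sets: "cyl J A \<in> sets M" if "finite J" "J \<subseteq> T" "\<And>t. A t \<in> sets borel" for J A
    unfolding cyl_def
  proof (intro sets.sets_Collect_finite_All that)
    fix t assume "t \<in> J"
    then have [measurable]: "Y t \<in> borel_measurable M" "A t \<in> sets borel"
      using Y that by auto
    show "{\<omega> \<in> space M. Y t \<omega> \<in> A t} \<in> sets M"
      by measurable
  qed
  have laplace_test_abs: "\<bar>laplace_test Y I u \<omega>\<bar> \<le> 1" if "I \<subseteq> T" "\<And>t. 0 \<le> u t" "\<omega> \<in> space M" for I u \<omega>
    using that Y0 laplace_test_le_1[of I u Y \<omega>] laplace_test_pos[of Y I u \<omega>] by fastforce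
  \<comment> \<open>The mixed statement, with indicators on \<open>J\<close> and exponentials on a
    disjoint \<open>I\<close>, is what the induction needs: moving \<open>t\<close> from the tests
    to the indicators uses the hypothesis with \<open>t\<close> still among the tests.\<close>
  have cyl_eq: "(\<integral>\<omega>. w1 \<omega> * (indicator (cyl J A) \<omega> * laplace_test Y I u \<omega>) \<partial>M)
      = (\<integral>\<omega>. w2 \<omega> * (indicator (cyl J A) \<omega> * laplace_test Y I u \<omega>) \<partial>M)"
    if "finite J" "finite I" "J \<inter> I = {}" "J \<subseteq> T" "I \<subseteq> T" "\<And>t. A t \<in> sets borel" "\<And>t. 0 \<le> u t"
    for J I A u
    using that
  proof (induction J arbitrary: I u)
    case empty
    have "(\<integral>\<omega>. w \<omega> * (indicator (cyl {} A) \<omega> * laplace_test Y I u \<omega>) \<partial>M) = (\<integral>\<omega>. w \<omega> * laplace_test Y I u \<omega> \<partial>M)"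
      for w :: "'a \<Rightarrow> real"
      by (rule Bochner_Integration.integral_cong) (auto simp: cyl_def)
    then show ?case
      using eq[of I u] empty by simp
  next
    case (insert t J)
    define v where "v w \<omega> = w \<omega> * (indicator (cyl J A) \<omega> * laplace_test Y I u \<omega>)" for w :: "'a \<Rightarrow> real" and \<omega>
    have vint: "integrable M (v w)" if "integrable M w" for w
      unfolding v_def
    proof (rule integrable_mult_bounded[OF that])
      have [measurable]: "laplace_test Y I u \<in> borel_measurable M" "cyl J A \<in> sets M"
        using insert.prems Y insert.hyps by (auto intro!: laplace_test_measurable cyl_sets)
      show "(\<lambda>\<omega>. indicator (cyl J A) \<omega> * laplace_test Y I u \<omega>) \<in> borel_measurable M"
        by measurable
      show "\<bar>indicator (cyl J A) \<omega> * laplace_test Y I u \<omega>\<bar> \<le> 1" if "\<omega> \<in> space M" for \<omega>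
        using laplace_test_abs[of I u \<omega>] insert.prems that by (auto simp: indicator_def)
    qed
    have "(\<integral>\<omega>. v w1 \<omega> * indicator (A t) (Y t \<omega>) \<partial>M) = (\<integral>\<omega>. v w2 \<omega> * indicator (A t) (Y t \<omega>) \<partial>M)"
    proof (rule integral_eq_of_laplace_eq)
      fix a :: "real ^ 'n" assume a: "0 \<le> a"
      have "(\<integral>\<omega>. w1 \<omega> * (indicator (cyl J A) \<omega> * laplace_test Y (insert t I) (u(t := a)) \<omega>) \<partial>M)
          = (\<integral>\<omega>. w2 \<omega> * (indicator (cyl J A) \<omega> * laplace_test Y (insert t I) (u(t := a)) \<omega>) \<partial>M)"
        using insert.prems insert.hyps a by (intro insert.IH) auto
      moreover have "laplace_test Y (insert t I) (u(t := a)) \<omega> = exp (- (a \<bullet> Y t \<omega>)) * laplace_test Y I u \<omega>" for \<omega>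
      proof -
        have t: "t \<notin> I"
          using insert.prems by auto
        then have "laplace_test Y I (u(t := a)) \<omega> = laplace_test Y I u \<omega>"
          unfolding laplace_test_def by (intro arg_cong[where f="\<lambda>x. exp (- x)"] sum.cong) auto
        then show ?thesis
          using t insert.prems by (simp add: laplace_test_insert)
      qed
      ultimately show "(\<integral>\<omega>. v w1 \<omega> * exp (- (a \<bullet> Y t \<omega>)) \<partial>M) = (\<integral>\<omega>. v w2 \<omega> * exp (- (a \<bullet> Y t \<omega>)) \<partial>M)"
        by (simp add: v_def mult_ac)
    qed (use insert.prems Y Y0 vint w in auto)
    moreover have "v w \<omega> * indicator (A t) (Y t \<omega>) = w \<omega> * (indicator (cyl (insert t J) A) \<omega> * laplace_test Y I u \<omega>)"
      for w \<omega>
      by (auto simp: v_def cyl_def indicator_def)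
    ultimately show ?case
      by simp
  qed
  define G where "G = {cyl J A | J A. finite J \<and> J \<subseteq> T \<and> (\<forall>t. A t \<in> sets borel)}"
  have GM: "G \<subseteq> sets M"
    by (auto simp: G_def cyl_sets)
  have stable: "Int_stable G"
  proof (rule Int_stableI)
    fix a b assume "a \<in> G" "b \<in> G"
    then obtain J A K B where ab: "a = cyl J A" "finite J" "J \<subseteq> T" "\<forall>t. A t \<in> sets borel"
      "b = cyl K B" "finite K" "K \<subseteq> T" "\<forall>t. B t \<in> sets borel"
      by (auto simp: G_def)
    define C where "C t = (if t \<in> J then A t else UNIV) \<inter> (if t \<in> K then B t else UNIV)" for t
    have "a \<inter> b = cyl (J \<union> K) C"
      unfolding ab cyl_def C_def by auto
    then show "a \<inter> b \<in> G"
      unfolding G_def using ab by (auto intro!: exI[of _ "J \<union> K"] exI[of _ C] simp: C_def)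
  qed
  have "sigma_of M T Y \<subseteq> sigma_sets (space M) G"
    unfolding sigma_of_def
  proof (intro sigma_sets_mono subsetI)
    fix a assume "a \<in> {Y t -` A \<inter> space M |t A. t \<in> T \<and> A \<in> sets borel}"
    then obtain t A where "a = Y t -` A \<inter> space M" "t \<in> T" "A \<in> sets borel"
      by auto
    then have "a = cyl {t} (\<lambda>_. A)"
      by (auto simp: cyl_def)
    moreover have "cyl {t} (\<lambda>_. A) \<in> G"
      unfolding G_def using \<open>t \<in> T\<close> \<open>A \<in> sets borel\<close>
      by (intro CollectI exI[of _ "{t}"] exI[of _ "\<lambda>_. A"]) auto
    ultimately show "a \<in> sigma_sets (space M) G"
      by auto
  qed
  moreover have "(\<integral>\<omega>. w1 \<omega> * indicator E \<omega> \<partial>M) = (\<integral>\<omega>. w2 \<omega> * indicator E \<omega> \<partial>M)" if "E \<in> G" for E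
    using that cyl_eq[of _ "{}"] by (auto simp: G_def)
  moreover have "(\<integral>\<omega>. w1 \<omega> \<partial>M) = (\<integral>\<omega>. w2 \<omega> \<partial>M)"
    using eq[of "{}" "\<lambda>_. 0"] by simp
  ultimately show ?thesis
    using E GM stable w by - (rule integral_mult_indicator_sigma_sets_eq[of _ _ G], auto)
qed

text \<open>A criterion for independence of whole processes: factorization of transforms implies
  factorization of probabilities. The weight \<open>w\<close> will be the indicator of a past event,
  which gives independence of the past at the same time.\<close>

lemma integral_indicators_eq_prod:
  fixes Y :: "'o \<Rightarrow> 't \<Rightarrow> 'a \<Rightarrow> real ^ 'n" and w :: "'a \<Rightarrow> real"
  assumes "finite O'"
    and Y: "\<And>o' t. o' \<in> O' \<Longrightarrow> t \<in> T o' \<Longrightarrow> Y o' t \<in> borel_measurable M"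
    and Y0: "\<And>o' t \<omega>. o' \<in> O' \<Longrightarrow> t \<in> T o' \<Longrightarrow> \<omega> \<in> space M \<Longrightarrow> 0 \<le> Y o' t \<omega>"
    and w: "integrable M w"
    and eq: "\<And>I u. (\<And>o'. o' \<in> O' \<Longrightarrow> finite (I o') \<and> I o' \<subseteq> T o') \<Longrightarrow> (\<And>o' t. 0 \<le> u o' t) \<Longrightarrow>
      (\<integral>\<omega>. w \<omega> * (\<Prod>o'\<in>O'. laplace_test (Y o') (I o') (u o') \<omega>) \<partial>M)
        = (\<integral>\<omega>. w \<omega> \<partial>M) * (\<Prod>o'\<in>O'. \<integral>\<omega>. laplace_test (Y o') (I o') (u o') \<omega> \<partial>M)"
    and E: "\<And>o'. o' \<in> O' \<Longrightarrow> E o' \<in> sigma_of M (T o') (Y o')"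
  shows "(\<integral>\<omega>. w \<omega> * (\<Prod>o'\<in>O'. indicator (E o') \<omega>) \<partial>M)
      = (\<integral>\<omega>. w \<omega> \<partial>M) * (\<Prod>o'\<in>O'. prob (E o'))"
proof -
  have [measurable]: "E o' \<in> sets M" if "o' \<in> O'" for o'
    using E[OF that] sigma_of_subset[of "T o'" "Y o'" M] Y[OF that] by auto
  have "(\<integral>\<omega>. w \<omega> * ((\<Prod>o'\<in>J. indicator (E o') \<omega>) * (\<Prod>o'\<in>O'-J. laplace_test (Y o') (I o') (u o') \<omega>)) \<partial>M)
      = (\<integral>\<omega>. w \<omega> \<partial>M) * ((\<Prod>o'\<in>J. prob (E o')) * (\<Prod>o'\<in>O'-J. \<integral>\<omega>. laplace_test (Y o') (I o') (u o') \<omega> \<partial>M))"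
    if "J \<subseteq> O'" "\<And>o'. o' \<in> O' \<Longrightarrow> finite (I o') \<and> I o' \<subseteq> T o'" "\<And>o' t. 0 \<le> u o' t" for J I u
    using finite_subset[OF that(1) \<open>finite O'\<close>] that
  proof (induction J arbitrary: I u)
    case empty
    then show ?case
      using eq[of I u] by simp
  next
    case (insert k J)
    let ?rest = "\<lambda>\<omega>. (\<Prod>o'\<in>J. indicator (E o') \<omega>) * (\<Prod>o'\<in>O'-insert k J. laplace_test (Y o') (I o') (u o') \<omega>)"
    let ?c = "(\<integral>\<omega>. w \<omega> \<partial>M) * ((\<Prod>o'\<in>J. prob (E o')) * (\<Prod>o'\<in>O'-insert k J. \<integral>\<omega>. laplace_test (Y o') (I o') (u o') \<omega> \<partial>M))"
    have k: "k \<in> O'" "k \<notin> J" and J: "J \<subseteq> O'"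
      using insert by auto
    have OJ: "O' - J = insert k (O' - insert k J)"
      using k by auto
    have bnd: "\<bar>laplace_test (Y o') (I o') (u o') \<omega>\<bar> \<le> 1" if "o' \<in> O'" "\<omega> \<in> space M" for o' \<omega>
      using laplace_test_le_1[of "I o'" "u o'" "Y o'" \<omega>] laplace_test_pos[of "Y o'" "I o'" "u o'" \<omega>] insert.prems Y0 that
      by (simp add: subset_iff)
    \<comment> \<open>The two weights compared are the true remaining product and the constant
      \<open>?c\<close>; equality for all tests on process \<open>k\<close> yields equality on the
      event \<open>E k\<close>.\<close>
    have "(\<integral>\<omega>. w \<omega> * ?rest \<omega> * indicator (E k) \<omega> \<partial>M) = (\<integral>\<omega>. ?c * indicator (E k) \<omega> \<partial>M)"
    proof (rule integral_indicator_sigma_of_eq[of "T k" "Y k"])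
      show "integrable M (\<lambda>\<omega>. w \<omega> * ?rest \<omega>)"
      proof (rule integrable_mult_bounded[OF w])
        have "(\<lambda>\<omega>. indicator (E o') \<omega> :: real) \<in> borel_measurable M" if "o' \<in> J" for o'
          using J that by (intro borel_measurable_indicator) auto
        moreover have "laplace_test (Y o') (I o') (u o') \<in> borel_measurable M" if "o' \<in> O'" for o'
          using that insert.prems(2)[OF that] Y[OF that] by (intro laplace_test_measurable) blast
        ultimately show "?rest \<in> borel_measurable M"
          by (intro borel_measurable_times borel_measurable_prod) auto
        show "\<bar>?rest \<omega>\<bar> \<le> 1" if "\<omega> \<in> space M" for \<omega>
          unfolding abs_mult abs_prod
          using bnd that by (intro mult_le_one prod_le_1 prod_nonneg) (auto simp: indicator_def)
      qed
      fix I' and u' :: "'t \<Rightarrow> real ^ 'n" assume I': "finite I'" "I' \<subseteq> T k" "\<And>t. 0 \<le> u' t"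
      have *: "(\<Prod>o'\<in>O'-J. f o' ((I(k := I')) o') ((u(k := u')) o'))
          = f k I' u' * (\<Prod>o'\<in>O'-insert k J. f o' (I o') (u o'))" for f :: "'o \<Rightarrow> 't set \<Rightarrow> ('t \<Rightarrow> real ^ 'n) \<Rightarrow> real"
      proof -
        have "(\<Prod>o'\<in>O'-insert k J. f o' ((I(k := I')) o') ((u(k := u')) o'))
            = (\<Prod>o'\<in>O'-insert k J. f o' (I o') (u o'))"
          by (intro prod.cong) auto
        then show ?thesis
          unfolding OJ using \<open>finite O'\<close> by (subst prod.insert) auto
      qed
      have "(\<integral>\<omega>. w \<omega> * ((\<Prod>o'\<in>J. indicator (E o') \<omega>) *
          (\<Prod>o'\<in>O'-J. laplace_test (Y o') ((I(k := I')) o') ((u(k := u')) o') \<omega>)) \<partial>M)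
        = (\<integral>\<omega>. w \<omega> \<partial>M) * ((\<Prod>o'\<in>J. prob (E o')) *
          (\<Prod>o'\<in>O'-J. \<integral>\<omega>. laplace_test (Y o') ((I(k := I')) o') ((u(k := u')) o') \<omega> \<partial>M))"
        using insert.prems I' J by (intro insert.IH) auto
      then show "(\<integral>\<omega>. w \<omega> * ?rest \<omega> * laplace_test (Y k) I' u' \<omega> \<partial>M) = (\<integral>\<omega>. ?c * laplace_test (Y k) I' u' \<omega> \<partial>M)"
        unfolding *[of "\<lambda>o' I u. laplace_test (Y o') I u _"] *[of "\<lambda>o' I u. \<integral>\<omega>. laplace_test (Y o') I u \<omega> \<partial>M"]
        by (simp add: mult_ac)
    qed (use k E Y Y0 in auto)
    moreover have "E k \<inter> space M = E k"
      using k by (simp add: sets.Int_space_eq2)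
    ultimately show ?case
      using insert.hyps by (simp add: mult_ac)
  qed
  from this[of O' "\<lambda>_. {}" "\<lambda>_ _. 0"] show ?thesis
    by simp
qed

end

section \<open>Independent sub-sigma-algebras\<close>

lemma measurable_subalgebra:
  "subalgebra M F \<Longrightarrow> f \<in> borel_measurable F \<Longrightarrow> f \<in> borel_measurable M"
  by (rule measurable_from_subalg)

lemma subalgebra_trans: "subalgebra M G \<Longrightarrow> subalgebra G F \<Longrightarrow> subalgebra M F"
  by (auto simp: subalgebra_def)

text \<open>Fubini for two independent sigma-algebras on one space. The identity is a random element
  of \<open>F\<close> and of \<open>Q\<close>, and by independence the law of the diagonal map on
  \<open>F \<Otimes>\<^sub>M Q\<close> is a product measure; hence everything that depends on
  \<open>F\<close> can be frozen while integrating over \<open>Q\<close>.\<close>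

lemma (in prob_space) integral_decouple:
  fixes f :: "'a \<times> 'a \<Rightarrow> real"
  assumes F: "subalgebra M F" and Q: "subalgebra M Q" and ind: "indep_set (sets F) (sets Q)"
    and f [measurable]: "f \<in> borel_measurable (F \<Otimes>\<^sub>M Q)"
    and bnd: "\<And>x y. x \<in> space M \<Longrightarrow> y \<in> space M \<Longrightarrow> \<bar>f (x, y)\<bar> \<le> B"
  shows "(\<integral>\<omega>. f (\<omega>, \<omega>) \<partial>M) = (\<integral>x. (\<integral>y. f (x, y) \<partial>M) \<partial>M)"
proof -
  have FQ: "(\<lambda>x. x) \<in> measurable M F" "(\<lambda>x. x) \<in> measurable M Q"
    using F Q by (auto simp: subalgebra_def measurable_def)
  have "indep_var F (\<lambda>x. x) Q (\<lambda>x. x)"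
    unfolding indep_var_eq
  proof (intro conjI FQ)
    have *: "sigma_sets (space M) {(\<lambda>x. x) -` A \<inter> space M | A. A \<in> sets N} \<subseteq> sets N" if "subalgebra M N" for N
    proof -
      have "space M = space N"
        using that by (simp add: subalgebra_def)
      then show ?thesis
        using sets.sets_into_space[of _ N]
        by (simp only:, intro sets.sigma_sets_subset) (auto simp: Int_absorb2)
    qed
    show "indep_set (sigma_sets (space M) {(\<lambda>x. x) -` A \<inter> space M | A. A \<in> sets F})
       (sigma_sets (space M) {(\<lambda>x. x) -` A \<inter> space M | A. A \<in> sets Q})"
      using ind *[OF F] *[OF Q] unfolding indep_sets2_eq by blast
  qed
  then have eq: "distr M F (\<lambda>x. x) \<Otimes>\<^sub>M distr M Q (\<lambda>x. x) = distr M (F \<Otimes>\<^sub>M Q) (\<lambda>x. (x, x))"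
    by (simp add: indep_var_distribution_eq)
  interpret F: prob_space "distr M F (\<lambda>x. x)" by (rule prob_space_distr[OF FQ(1)])
  interpret Q: prob_space "distr M Q (\<lambda>x. x)" by (rule prob_space_distr[OF FQ(2)])
  interpret P: pair_prob_space "distr M F (\<lambda>x. x)" "distr M Q (\<lambda>x. x)" ..
  have sp: "space F = space M" "space Q = space M"
    using F Q by (auto simp: subalgebra_def)
  have [measurable]: "(\<lambda>x. (x, x)) \<in> measurable M (F \<Otimes>\<^sub>M Q)"
    using FQ by (intro measurable_Pair)
  have "(\<integral>\<omega>. f (\<omega>, \<omega>) \<partial>M) = (\<integral>z. f z \<partial>distr M (F \<Otimes>\<^sub>M Q) (\<lambda>x. (x, x)))"
    by (subst integral_distr) auto
  also have "\<dots> = (\<integral>z. f z \<partial>(distr M F (\<lambda>x. x) \<Otimes>\<^sub>M distr M Q (\<lambda>x. x)))"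
    by (simp add: eq)
  also have "\<dots> = (\<integral>x. (\<integral>y. f (x, y) \<partial>distr M Q (\<lambda>x. x)) \<partial>distr M F (\<lambda>x. x))"
  proof (rule P.integral_fst'[symmetric])
    show "integrable (distr M F (\<lambda>x. x) \<Otimes>\<^sub>M distr M Q (\<lambda>x. x)) f"
      by (rule P.P.integrable_const_bound[of _ B])
         (use bnd in \<open>auto simp: space_pair_measure sp\<close>)
  qed
  also have "\<dots> = (\<integral>x. (\<integral>y. f (x, y) \<partial>distr M Q (\<lambda>x. x)) \<partial>M)"
  proof (rule integral_distr[OF FQ(1)])
    have "(\<lambda>x. \<integral>y. f (x, y) \<partial>distr M Q (\<lambda>x. x)) \<in> borel_measurable F"
      by (rule Q.borel_measurable_lebesgue_integral) (simp add: measurable_cong_sets[OF sets_pair_measure_cong[OF refl sets_distr] refl])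
    then show "(\<lambda>x. \<integral>y. f (x, y) \<partial>distr M Q (\<lambda>x. x)) \<in> borel_measurable F" .
  qed
  also have "\<dots> = (\<integral>x. (\<integral>y. f (x, y) \<partial>M) \<partial>M)"
  proof (rule Bochner_Integration.integral_cong[OF refl])
    fix x assume "x \<in> space M"
    then have "(\<lambda>y. f (x, y)) \<in> borel_measurable Q"
      using sp by measurable
    then show "(\<integral>y. f (x, y) \<partial>distr M Q (\<lambda>x. x)) = (\<integral>y. f (x, y) \<partial>M)"
      by (rule integral_distr[OF FQ(2)])
  qed
  finally show ?thesis .
qed

section \<open>Right-continuous paths\<close>

text \<open>Continuity within \<open>{t..}\<close>, with \<open>t\<close> included, instead of a
  limit along \<open>at_right t\<close>: this form is stable under composition with a clock that
  stands still.\<close>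

definition right_cont :: "(real \<Rightarrow> 'b::topological_space) \<Rightarrow> bool" where
  "right_cont r \<longleftrightarrow> (\<forall>t\<ge>0. continuous (at t within {t..}) r)"

definition increasing_path :: "(real \<Rightarrow> real ^ 'n) \<Rightarrow> bool" where
  "increasing_path r \<longleftrightarrow> r 0 = 0 \<and> (\<forall>s t. 0 \<le> s \<and> s \<le> t \<longrightarrow> r s \<le> r t) \<and> right_cont r"

lemma increasing_path_nonneg: "increasing_path r \<Longrightarrow> 0 \<le> s \<Longrightarrow> 0 \<le> r s"
  unfolding increasing_path_def by (elim conjE allE[of _ 0] allE[of _ s]) simp

lemma increasing_path_mono: "increasing_path r \<Longrightarrow> 0 \<le> s \<Longrightarrow> s \<le> t \<Longrightarrow> r s \<le> r t"
  unfolding increasing_path_def by blast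

lemma increasing_path_right_cont: "increasing_path r \<Longrightarrow> right_cont r"
  unfolding increasing_path_def by blast

lemma right_cont_tendsto:
  assumes "right_cont r" "0 \<le> t" "X \<longlonglongrightarrow> t" "\<And>n. t \<le> X n"
  shows "(\<lambda>n. r (X n)) \<longlonglongrightarrow> r t"
  using assms continuous_within_sequentially[of t "{t..}" r]
  by (auto simp: right_cont_def comp_def)

text \<open>A right-continuous process is evaluated at a random time as the limit along
  the grid times \<open>(\<lfloor>(n + 1) t\<rfloor> + 1) / (n + 1)\<close>, which decrease to \<open>t\<close>.\<close>

lemma measurable_at_random_time:
  fixes X :: "real \<Rightarrow> 'a \<Rightarrow> 'b::{metric_space, second_countable_topology}"
  assumes X: "\<And>s. 0 \<le> s \<Longrightarrow> X s \<in> borel_measurable N"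
    and rc: "\<And>a. a \<in> space N \<Longrightarrow> right_cont (\<lambda>s. X s a)"
    and T [measurable]: "T \<in> borel_measurable N" and T0: "\<And>a. a \<in> space N \<Longrightarrow> 0 \<le> T a"
  shows "(\<lambda>a. X (T a) a) \<in> borel_measurable N"
proof -
  define g where "g n a = nat \<lfloor>real (Suc n) * T a\<rfloor> + 1" for n a
  define D where "D n a = real (g n a) / real (Suc n)" for n a
  have meas: "(\<lambda>a. X (D n a) a) \<in> borel_measurable N" for n
    unfolding D_def
  proof (rule measurable_compose_countable[where f="\<lambda>i x. X (real i / real (Suc n)) x" and g="g n"])
    show "(\<lambda>x. X (real i / real (Suc n)) x) \<in> borel_measurable N" for i
      by (rule X) simp
    show "g n \<in> measurable N (count_space UNIV)"
      unfolding g_def by measurable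
  qed
  have "(\<lambda>n. X (D n a) a) \<longlonglongrightarrow> X (T a) a" if a: "a \<in> space N" for a
  proof -
    have ge: "T a \<le> D n a" and le: "D n a \<le> T a + 1 / real (Suc n)" for n
    proof -
      have "0 \<le> real (Suc n) * T a"
        using T0[OF a] by simp
      then have "real (Suc n) * T a \<le> real (g n a)" "real (g n a) \<le> real (Suc n) * T a + 1"
        unfolding g_def by linarith+
      then show "T a \<le> D n a" "D n a \<le> T a + 1 / real (Suc n)"
        unfolding D_def by (simp_all add: pos_le_divide_eq pos_divide_le_eq mult.commute distrib_left)
    qed
    have "(\<lambda>n. T a + 1 / real (Suc n)) \<longlonglongrightarrow> T a + 0"
      using LIMSEQ_inverse_real_of_nat by (intro tendsto_add tendsto_const) (simp add: inverse_eq_divide)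
    then have "(\<lambda>n. D n a) \<longlonglongrightarrow> T a"
      using ge le
      by - (rule tendsto_sandwich[of "\<lambda>_. T a" _ _ "\<lambda>n. T a + 1 / real (Suc n)"], auto)
    then show ?thesis
      using rc[OF a] T0[OF a] ge by (intro right_cont_tendsto[of "\<lambda>s. X s a"])
  qed
  then show ?thesis
    using meas by - (rule borel_measurable_LIMSEQ_metric[where f="\<lambda>n a. X (D n a) a"])
qed

text \<open>An increasing clock maps \<open>{t..}\<close> into \<open>{f t..}\<close>, so
  right-continuity of the outer path is enough.\<close>

lemma right_cont_compose:
  assumes r: "right_cont r" and f: "right_cont f"
    and "\<And>s. 0 \<le> s \<Longrightarrow> 0 \<le> f s" "\<And>s t. 0 \<le> s \<Longrightarrow> s \<le> t \<Longrightarrow> f s \<le> f t"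
  shows "right_cont (\<lambda>s. r (f s))"
  unfolding right_cont_def
proof (intro allI impI)
  fix t :: real assume t: "0 \<le> t"
  have "continuous (at (f t) within f ` {t..}) r"
    using r assms(3,4) t unfolding right_cont_def
    by - (rule continuous_within_subset[of "f t" "{f t..}" r], auto)
  then show "continuous (at t within {t..}) (\<lambda>s. r (f s))"
    using f t unfolding right_cont_def by - (rule continuous_within_compose2[of t "{t..}" f r], auto)
qed

lemma right_cont_sum:
  fixes r :: "'k \<Rightarrow> real \<Rightarrow> 'b::real_normed_vector"
  assumes "\<And>k. k \<in> K \<Longrightarrow> right_cont (r k)"
  shows "right_cont (\<lambda>s. \<Sum>k\<in>K. r k s)"
  using assms unfolding right_cont_def by (blast intro: continuous_sum)

lemma right_cont_nth: "right_cont r \<Longrightarrow> right_cont (\<lambda>s. r s $ k)"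
  unfolding right_cont_def by (auto intro!: continuous_component)

lemma increasing_path_sum:
  assumes "\<And>k. k \<in> K \<Longrightarrow> increasing_path (r k)"
  shows "increasing_path (\<lambda>s. \<Sum>k\<in>K. r k s)"
  using assms unfolding increasing_path_def by (auto intro!: right_cont_sum sum_mono)

lemma increasing_path_compose_nth:
  assumes "increasing_path r" "increasing_path f"
  shows "increasing_path (\<lambda>s. r (f s $ k))"
proof -
  have *: "0 \<le> f s $ k" "f s $ k \<le> f t $ k" if "0 \<le> s" "s \<le> t" for s t
    using that increasing_path_nonneg[OF assms(2), of s] increasing_path_mono[OF assms(2), of s t]
    by (auto simp: less_eq_vec_def)
  then show ?thesis
    using assms right_cont_compose[of r "\<lambda>s. f s $ k"]
    unfolding increasing_path_def by (auto intro!: right_cont_nth)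
qed

lemma cadlag_increasing_path:
  fixes r :: "real \<Rightarrow> real ^ 'n"
  assumes r: "increasing_path r"
  shows "cadlag r"
  unfolding cadlag_def
proof (intro conjI allI impI)
  fix t :: real assume "0 \<le> t"
  then have "(r \<longlongrightarrow> r t) (at t within {t..})"
    using increasing_path_right_cont[OF r] by (simp add: right_cont_def continuous_within)
  then show "(r \<longlongrightarrow> r t) (at_right t)"
    by (rule tendsto_within_subset) auto
next
  fix t :: real assume t: "0 < t"
  \<comment> \<open>A monotone coordinate has its supremum as left limit. The supremum starts at
    \<open>0\<close> because nothing is known about the path at negative times.\<close>
  have "((\<lambda>s. r s $ k) \<longlongrightarrow> (SUP s\<in>{0..<t}. r s $ k)) (at_left t)" for k
  proof (rule order_tendstoI)
    have mono: "r s $ k \<le> r s' $ k" if "0 \<le> s" "s \<le> s'" for s s'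
      using increasing_path_mono[OF r that] by (simp add: less_eq_vec_def)
    then have bdd: "bdd_above ((\<lambda>s. r s $ k) ` {0..<t})"
      by (intro bdd_aboveI2[of _ _ "r t $ k"]) auto
    show "\<forall>\<^sub>F s in at_left t. a < r s $ k" if a: "a < (SUP s\<in>{0..<t}. r s $ k)" for a
    proof -
      obtain s where s: "0 \<le> s" "s < t" "a < r s $ k"
        using less_cSUP_iff[of "{0..<t}" "\<lambda>s. r s $ k" a] bdd a t by fastforce
      then show ?thesis
        unfolding eventually_at_left[OF s(2)]
        using mono[of s] by (intro exI[of _ s]) (auto intro: less_le_trans)
    qed
    show "\<forall>\<^sub>F s in at_left t. r s $ k < a" if a: "(SUP s\<in>{0..<t}. r s $ k) < a" for a
    proof -
      have "r s $ k < a" if "0 \<le> s" "s < t" for s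
        using cSUP_upper[of s "{0..<t}" "\<lambda>s. r s $ k"] bdd a that by fastforce
      then show ?thesis
        unfolding eventually_at_left[OF t] using t by (intro exI[of _ 0]) auto
    qed
  qed
  then show "\<exists>l. (r \<longlongrightarrow> l) (at_left t)"
    by (intro exI[of _ "\<chi> k. SUP s\<in>{0..<t}. r s $ k"] vec_tendstoI) simp
qed

lemma right_cont_cadlag: "cadlag r \<Longrightarrow> right_cont r"
  unfolding cadlag_def right_cont_def continuous_within
proof (intro allI impI)
  fix t :: real
  assume "(\<forall>t\<ge>0. (r \<longlongrightarrow> r t) (at_right t)) \<and> (\<forall>t>0. \<exists>l. (r \<longlongrightarrow> l) (at_left t))" "0 \<le> t"
  then have "(r \<longlongrightarrow> r t) (at t within {t<..})"
    by blast
  moreover have "at t within {t..} = at t within {t<..}"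
    unfolding at_within_def by (intro arg_cong2[where f=inf] arg_cong[where f=principal] refl) auto
  ultimately show "(r \<longlongrightarrow> r t) (at t within {t..})"
    by simp
qed

section \<open>Splitting a path into lanes\<close>

definition clamp_at :: "real \<Rightarrow> real \<Rightarrow> real" where
  "clamp_at l x = max 0 (min x l)"

text \<open>The blocks below \<open>m\<close> have the prescribed lengths, possibly
  \<open>0\<close>; the unit length of all later ones makes every lane last forever.\<close>

definition block_len :: "(nat \<Rightarrow> real) \<Rightarrow> nat \<Rightarrow> nat \<Rightarrow> real" where
  "block_len b m j = (if j < m then b j else 1)"

definition block_start :: "(nat \<Rightarrow> real) \<Rightarrow> nat \<Rightarrow> nat \<Rightarrow> real" where
  "block_start b m j = (\<Sum>i<j. block_len b m i)"

text \<open>Block \<open>m * h + i\<close> is number \<open>h\<close> of lane \<open>i\<close>; the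
  offset is the lane time at which the lane enters it.\<close>

definition lane_offset :: "(nat \<Rightarrow> real) \<Rightarrow> nat \<Rightarrow> nat \<Rightarrow> nat \<Rightarrow> real" where
  "lane_offset b m i h = (\<Sum>h'<h. block_len b m (m * h' + i))"

definition lane_clock :: "(nat \<Rightarrow> real) \<Rightarrow> nat \<Rightarrow> nat \<Rightarrow> nat \<Rightarrow> real \<Rightarrow> real" where
  "lane_clock b m i h s = clamp_at (block_len b m (m * h + i)) (s - lane_offset b m i h)"

text \<open>The lane collects the increments of \<open>r\<close> over the traversed parts of its
  blocks. The range is long enough because the offset of block \<open>h\<close> is at least
  \<open>h - 1\<close>, so later blocks have not been entered by lane time \<open>s\<close>.\<close>

definition lane :: "(nat \<Rightarrow> real) \<Rightarrow> nat \<Rightarrow> nat \<Rightarrow> (real \<Rightarrow> 'b::real_normed_vector) \<Rightarrow> real \<Rightarrow> 'b" where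
  "lane b m i r s = (\<Sum>h<nat \<lceil>s\<rceil> + 1.
     r (block_start b m (m * h + i) + lane_clock b m i h s) - r (block_start b m (m * h + i)))"

definition ordered_intervals :: "(nat \<Rightarrow> real) \<Rightarrow> (nat \<Rightarrow> real) \<Rightarrow> bool" where
  "ordered_intervals p q \<longleftrightarrow> 0 \<le> p 0 \<and> (\<forall>l. p l \<le> q l \<and> q l \<le> p (Suc l))"

lemma ordered_intervals_nonneg:
  assumes "ordered_intervals p q"
  shows "0 \<le> p l" "0 \<le> q l"
proof -
  show p: "0 \<le> p l" for l
    by (induction l) (use assms in \<open>auto simp: ordered_intervals_def intro: order_trans\<close>)
  show "0 \<le> q l"
    using p[of l] assms unfolding ordered_intervals_def by (meson order_trans)
qed

lemma clamp_at_mono: "x \<le> y \<Longrightarrow> clamp_at l x \<le> clamp_at l y"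
  by (auto simp: clamp_at_def)

lemma clamp_at_nonneg: "0 \<le> clamp_at l x"
  by (simp add: clamp_at_def)

lemma clamp_at_le: "0 \<le> l \<Longrightarrow> clamp_at l x \<le> l"
  by (auto simp: clamp_at_def)

lemma clamp_at_nonpos: "x \<le> 0 \<Longrightarrow> clamp_at l x = 0"
  by (auto simp: clamp_at_def)

lemma lane_clock_nonneg: "0 \<le> lane_clock b m i h s"
  by (simp add: lane_clock_def clamp_at_nonneg)

lemma lane_clock_mono: "s \<le> t \<Longrightarrow> lane_clock b m i h s \<le> lane_clock b m i h t"
  by (simp add: lane_clock_def clamp_at_mono)

lemma continuous_lane_clock: "continuous_on UNIV (lane_clock b m i h)"
  unfolding lane_clock_def clamp_at_def by (intro continuous_intros)

lemma sum_div_mod: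
  fixes f :: "nat \<Rightarrow> nat \<Rightarrow> 'b::comm_monoid_add"
  assumes "0 < K"
  shows "(\<Sum>j<A * K. f (j div K) (j mod K)) = (\<Sum>a<A. \<Sum>l<K. f a l)"
proof (induction A)
  case (Suc A)
  have "(\<Sum>j<Suc A * K. f (j div K) (j mod K))
      = (\<Sum>j<A * K. f (j div K) (j mod K)) + (\<Sum>j\<in>{A * K..<A * K + K}. f (j div K) (j mod K))"
    by (subst sum.union_disjoint[symmetric]) (auto intro!: sum.cong)
  also have "(\<Sum>j\<in>{A * K..<A * K + K}. f (j div K) (j mod K)) = (\<Sum>l<K. f A l)"
    by (rule sum.reindex_bij_witness[where j="\<lambda>j. j - A * K" and i="\<lambda>l. A * K + l"])
       (use assms in \<open>auto simp: div_eq_dividend_iff dest!: le_Suc_ex\<close>)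
  finally show ?case
    using Suc by simp
qed simp

context
  fixes b :: "nat \<Rightarrow> real" and m :: nat
  assumes b: "\<And>i. 0 \<le> b i"
begin

lemma block_len_nonneg: "0 \<le> block_len b m j"
  using b by (simp add: block_len_def)

lemma block_start_nonneg: "0 \<le> block_start b m j"
  unfolding block_start_def by (intro sum_nonneg block_len_nonneg)

lemma block_start_Suc: "block_start b m (Suc j) = block_start b m j + block_len b m j"
  by (simp add: block_start_def)

lemma lane_clock_le: "lane_clock b m i h s \<le> block_len b m (m * h + i)"
  by (simp add: lane_clock_def clamp_at_le block_len_nonneg)

lemma lane_offset_Suc: "lane_offset b m i (Suc h) = lane_offset b m i h + block_len b m (m * h + i)"
  by (simp add: lane_offset_def)

lemma lane_offset_nonneg: "0 \<le> lane_offset b m i h"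
  unfolding lane_offset_def by (intro sum_nonneg block_len_nonneg)

text \<open>Every block of a lane except its first has length \<open>1\<close>; the first may be
  empty, whence the \<open>- 1\<close>.\<close>

lemma lane_offset_ge: "real h - 1 \<le> lane_offset b m i h"
proof (induction h)
  case (Suc h)
  show ?case
  proof (cases h)
    case 0
    then show ?thesis
      using lane_offset_nonneg by simp
  next
    case (Suc h')
    then have "block_len b m (m * h + i) = 1"
      by (simp add: block_len_def)
    then show ?thesis
      using Suc.IH by (simp add: lane_offset_Suc)
  qed
qed (simp add: lane_offset_def)

lemma lane_eq_sum:
  assumes "nat \<lceil>s\<rceil> + 1 \<le> N"
  shows "lane b m i r s = (\<Sum>h<N.
     r (block_start b m (m * h + i) + lane_clock b m i h s) - r (block_start b m (m * h + i)))"
  unfolding lane_def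
proof (rule sum.mono_neutral_left)
  show "\<forall>h\<in>{..<N} - {..<nat \<lceil>s\<rceil> + 1}.
       r (block_start b m (m * h + i) + lane_clock b m i h s) - r (block_start b m (m * h + i)) = 0"
  proof
    fix h assume "h \<in> {..<N} - {..<nat \<lceil>s\<rceil> + 1}"
    then have "s \<le> real h - 1"
      by simp linarith
    then have "lane_clock b m i h s = 0"
      using lane_offset_ge[of h i] by (simp add: lane_clock_def clamp_at_nonpos)
    then show "r (block_start b m (m * h + i) + lane_clock b m i h s) - r (block_start b m (m * h + i)) = 0"
      by simp
  qed
qed (use assms in auto)

text \<open>The clocks of the first \<open>N\<close> blocks add up to
  \<open>min s (lane_offset b m i N)\<close>, and \<open>N\<close> is large enough for the minimum
  to be \<open>s\<close>. So no lane time is lost or counted twice, which makes the exponents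
  match.\<close>

lemma sum_lane_clock:
  assumes "0 \<le> s" "nat \<lceil>s\<rceil> + 1 \<le> N"
  shows "(\<Sum>h<N. lane_clock b m i h s) = s"
proof -
  have "(\<Sum>h<N. lane_clock b m i h s) = min s (lane_offset b m i N)" for N
  proof (induction N)
    case (Suc N)
    then show ?case
      using assms(1) block_len_nonneg[of "m * N + i"]
      by (auto simp: lane_offset_Suc lane_clock_def clamp_at_def)
  qed (use assms in \<open>simp add: lane_offset_def\<close>)
  moreover have "s \<le> lane_offset b m i N"
    using lane_offset_ge[of N i] assms(2) by linarith
  ultimately show ?thesis
    by simp
qed

lemma increasing_path_lane:
  fixes r :: "real \<Rightarrow> real ^ 'n"
  assumes r: "increasing_path r"
  shows "increasing_path (lane b m i r)"
  unfolding increasing_path_def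
proof (intro conjI allI impI)
  let ?t = "\<lambda>h s. r (block_start b m (m * h + i) + lane_clock b m i h s) - r (block_start b m (m * h + i))"
  show "lane b m i r 0 = 0"
    using lane_offset_nonneg by (simp add: lane_def lane_clock_def clamp_at_nonpos)
  show "lane b m i r s \<le> lane b m i r t" if st: "0 \<le> s \<and> s \<le> t" for s t
  proof -
    have "nat \<lceil>s\<rceil> + 1 \<le> nat \<lceil>t\<rceil> + 1"
      using st by (intro add_right_mono nat_mono ceiling_mono) simp
    then have "lane b m i r s = (\<Sum>h<nat \<lceil>t\<rceil> + 1. ?t h s)"
      by (rule lane_eq_sum)
    also have "\<dots> \<le> (\<Sum>h<nat \<lceil>t\<rceil> + 1. ?t h t)"
      using st by (intro sum_mono diff_right_mono increasing_path_mono[OF r] add_nonneg_nonneg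
          block_start_nonneg lane_clock_nonneg add_left_mono lane_clock_mono) auto
    finally show ?thesis
      by (simp add: lane_def)
  qed
  have rc_term: "right_cont (\<lambda>s. ?t h s)" for h
  proof -
    have "right_cont (\<lambda>s. block_start b m (m * h + i) + lane_clock b m i h s)"
      unfolding right_cont_def
      by (intro allI impI continuous_intros continuous_on_imp_continuous_within[OF continuous_lane_clock]) auto
    then have "right_cont (\<lambda>s. r (block_start b m (m * h + i) + lane_clock b m i h s))"
      by (rule right_cont_compose[OF increasing_path_right_cont[OF r]])
         (auto intro!: add_nonneg_nonneg block_start_nonneg lane_clock_nonneg lane_clock_mono)
    then show ?thesis
      unfolding right_cont_def by (auto intro!: continuous_diff)
  qed
  show "right_cont (lane b m i r)"
    unfolding right_cont_def
  proof (intro allI impI)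
    fix t :: real assume t: "0 \<le> t"
    show "continuous (at t within {t..}) (lane b m i r)"
    \<comment> \<open>The number of summands of a lane jumps with \<open>s\<close>. Within distance
      \<open>1\<close> of \<open>t\<close> it is at most \<open>nat \<lceil>t\<rceil> + 2\<close>,
      so a sum over a fixed range can replace it.\<close>
    proof (rule continuous_transform_within[where \<delta>=1])
      have "right_cont (\<lambda>s. \<Sum>h<nat \<lceil>t\<rceil> + 2. ?t h s)"
        by (rule right_cont_sum) (rule rc_term)
      then show "continuous (at t within {t..}) (\<lambda>s. \<Sum>h<nat \<lceil>t\<rceil> + 2. ?t h s)"
        using t unfolding right_cont_def by blast
      fix s assume s: "s \<in> {t..}" "dist s t < 1"
      then have "nat \<lceil>s\<rceil> + 1 \<le> nat \<lceil>t\<rceil> + 2"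
        using t by (simp add: dist_real_def) linarith
      then show "(\<Sum>h<nat \<lceil>t\<rceil> + 2. ?t h s) = lane b m i r s"
        by (rule lane_eq_sum[symmetric])
    qed auto
  qed
qed

text \<open>At lane time \<open>b i\<close> the lane has used up its first block, which is block
  \<open>i\<close> of the path, and has spent no time in the next one.\<close>

lemma lane_initial:
  assumes "i < m"
  shows "lane b m i r (b i) = r (block_start b m (Suc i)) - r (block_start b m i)"
proof -
  have len: "block_len b m i = b i"
    using assms by (simp add: block_len_def)
  have "lane b m i r (b i) = (\<Sum>h<Suc (nat \<lceil>b i\<rceil>). if h = 0 then r (block_start b m (Suc i)) - r (block_start b m i) else 0)"
    unfolding lane_def Suc_eq_plus1[symmetric]
  proof (rule sum.cong[OF refl])
    fix h
    show "r (block_start b m (m * h + i) + lane_clock b m i h (b i)) - r (block_start b m (m * h + i))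
       = (if h = 0 then r (block_start b m (Suc i)) - r (block_start b m i) else 0)"
    proof (cases h)
      case 0
      then show ?thesis
        using b[of i] by (simp add: lane_clock_def len lane_offset_def clamp_at_def block_start_Suc)
    next
      case (Suc h')
      have "b i \<le> lane_offset b m i (Suc h')"
        unfolding lane_offset_def sum.lessThan_Suc_shift
        using sum_nonneg[of "{..<h'}" "\<lambda>h'. block_len b m (m * Suc h' + i)"] block_len_nonneg len by simp
      then show ?thesis
        using Suc by (simp add: lane_clock_def clamp_at_nonpos)
    qed
  qed
  then show ?thesis
    by simp
qed

text \<open>The first blocks of the \<open>m\<close> lanes lie side by side from time
  \<open>0\<close>, so the increments telescope. This identity expresses the second step at a sum of
  contributions as a sum over the contributions.\<close>

lemma sum_lane_initial:
  "(\<Sum>i<m. lane b m i r (b i)) = r (\<Sum>i<m. b i) - r 0"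
proof -
  have "(\<Sum>i<m. lane b m i r (b i)) = (\<Sum>i<m. r (block_start b m (Suc i)) - r (block_start b m i))"
    by (intro sum.cong) (auto simp: lane_initial)
  also have "\<dots> = r (block_start b m m) - r (block_start b m 0)"
    by (rule sum_lessThan_telescope)
  also have "block_start b m m = (\<Sum>i<m. b i)"
    unfolding block_start_def by (intro sum.cong) (auto simp: block_len_def)
  finally show ?thesis
    by (simp add: block_start_def)
qed

text \<open>The lanes partition the time axis of the path into intervals, so increments of different lanes
  are sums of increments of the path over ordered disjoint intervals.\<close>

lemma lanes_increments:
  fixes u :: "nat \<Rightarrow> nat \<Rightarrow> real ^ 'n"
  assumes m: "0 < m" and K: "0 < K"
    and pq: "\<And>i. i < m \<Longrightarrow> ordered_intervals (p i) (q i)"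
    and u: "\<And>i l. 0 \<le> u i l"
  shows "\<exists>L P Q w. ordered_intervals P Q \<and> (\<forall>j. 0 \<le> w j) \<and>
    (\<forall>r. (\<Sum>i<m. \<Sum>l<K. u i l \<bullet> (lane b m i r (q i l) - lane b m i r (p i l)))
       = (\<Sum>j<L. w j \<bullet> (r (Q j) - r (P j)))) \<and>
    (\<forall>\<kappa>. (\<Sum>i<m. \<Sum>l<K. (q i l - p i l) * \<kappa> (u i l)) = (\<Sum>j<L. (Q j - P j) * \<kappa> (w j)))"
proof -
  \<comment> \<open>One number of blocks per lane that suffices for all the interval endpoints
    involved.\<close>
  define N where "N = Suc (\<Sum>i<m. \<Sum>l<K. nat \<lceil>q i l\<rceil>)"
  have N: "nat \<lceil>s\<rceil> + 1 \<le> N" if "s \<le> q i l" "i < m" "l < K" for s i l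
  proof -
    have "nat \<lceil>s\<rceil> \<le> nat \<lceil>q i l\<rceil>"
      using that by (intro nat_mono ceiling_mono) simp
    also have "\<dots> \<le> (\<Sum>l<K. nat \<lceil>q i l\<rceil>)"
      using that by (intro member_le_sum) auto
    also have "\<dots> \<le> (\<Sum>i<m. \<Sum>l<K. nat \<lceil>q i l\<rceil>)"
      using that by (intro member_le_sum[of i _ "\<lambda>i. \<Sum>l<K. nat \<lceil>q i l\<rceil>"]) auto
    finally show ?thesis
      by (simp add: N_def)
  qed
  \<comment> \<open>The place on the time axis of the path that block \<open>B\<close> has reached
    when its lane, \<open>B mod m\<close>, shows lane time \<open>f (B mod m) l\<close>.\<close>
  define tm where "tm f B l = block_start b m B + lane_clock b m (B mod m) (B div m) (f (B mod m) l)"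
    for f :: "nat \<Rightarrow> nat \<Rightarrow> real" and B l
  \<comment> \<open>Pieces are listed lexicographically, block first and then interval within the
    block: \<open>j\<close> stands for block \<open>j div K\<close> and interval
    \<open>j mod K\<close>. This is their order on the time axis. Neither these pieces nor the
    weights depend on \<open>r\<close> or on \<open>\<kappa>\<close>.\<close>
  define P where "P j = tm p (j div K) (j mod K)" for j
  define Q where "Q j = tm q (j div K) (j mod K)" for j
  define w where "w j = u ((j div K) mod m) (j mod K)" for j
  have im: "B mod m < m" for B
    using m by simp
  have blk: "lane_clock b m (B mod m) (B div m) s \<le> block_len b m B" for B s
    using lane_clock_le[of "B mod m" "B div m" s] by simp
  have "ordered_intervals P Q"
    unfolding ordered_intervals_def
  proof (intro conjI allI)
    show "0 \<le> P 0"
      by (simp add: P_def tm_def block_start_nonneg lane_clock_nonneg)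
    fix j
    show "P j \<le> Q j"
      using pq[OF im] by (auto simp: P_def Q_def tm_def ordered_intervals_def intro!: lane_clock_mono)
    show "Q j \<le> P (Suc j)"
    \<comment> \<open>After the last interval of a block, the end of the block separates the two
      pieces; otherwise the order of the intervals of one lane does.\<close>
    proof (cases "Suc (j mod K) = K")
      case True
      then have "Suc j div K = Suc (j div K)"
        by (simp add: div_Suc mod_Suc)
      then have "block_start b m (Suc (j div K)) \<le> P (Suc j)"
        by (simp add: P_def tm_def lane_clock_nonneg)
      moreover have "Q j \<le> block_start b m (Suc (j div K))"
        using blk by (simp add: Q_def tm_def block_start_Suc)
      ultimately show ?thesis
        by simp
    next
      case False
      then have "Suc j div K = j div K" "Suc j mod K = Suc (j mod K)"
        by (simp_all add: div_Suc mod_Suc)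
      then show ?thesis
        using pq[OF im] by (auto simp: P_def Q_def tm_def ordered_intervals_def intro!: lane_clock_mono)
    qed
  qed
  moreover have flat: "(\<Sum>j<m * N * K. f (j div K) (j mod K))
      = (\<Sum>i<m. \<Sum>l<K. \<Sum>h<N. f (m * h + i) l)" for f :: "nat \<Rightarrow> nat \<Rightarrow> real"
  proof -
    have "(\<Sum>j<m * N * K. f (j div K) (j mod K)) = (\<Sum>B<N * m. \<Sum>l<K. f B l)"
      unfolding mult.commute[of m N] by (rule sum_div_mod[OF K])
    also have "\<dots> = (\<Sum>B<N * m. (\<lambda>h i. \<Sum>l<K. f (m * h + i) l) (B div m) (B mod m))"
      by simp
    also have "\<dots> = (\<Sum>h<N. \<Sum>i<m. \<Sum>l<K. f (m * h + i) l)"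
      by (rule sum_div_mod[OF m])
    also have "\<dots> = (\<Sum>i<m. \<Sum>h<N. \<Sum>l<K. f (m * h + i) l)"
      by (rule sum.swap)
    also have "\<dots> = (\<Sum>i<m. \<Sum>l<K. \<Sum>h<N. f (m * h + i) l)"
      by (intro sum.cong sum.swap refl)
    finally show ?thesis .
  qed
  moreover have "(\<Sum>i<m. \<Sum>l<K. u i l \<bullet> (lane b m i r (q i l) - lane b m i r (p i l)))
       = (\<Sum>j<m * N * K. w j \<bullet> (r (Q j) - r (P j)))" for r :: "real \<Rightarrow> real ^ 'n"
  proof -
    have "(\<Sum>j<m * N * K. w j \<bullet> (r (Q j) - r (P j)))
        = (\<Sum>i<m. \<Sum>l<K. \<Sum>h<N. u ((m * h + i) mod m) l \<bullet> (r (tm q (m * h + i) l) - r (tm p (m * h + i) l)))"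
      unfolding P_def Q_def w_def by (rule flat[of "\<lambda>B l. u (B mod m) l \<bullet> (r (tm q B l) - r (tm p B l))"])
    also have "\<dots> = (\<Sum>i<m. \<Sum>l<K. u i l \<bullet> (lane b m i r (q i l) - lane b m i r (p i l)))"
    proof (intro sum.cong refl)
      fix i l assume il: "i \<in> {..<m}" "l \<in> {..<K}"
      have pl: "p i l \<le> q i l"
        using pq il by (auto simp: ordered_intervals_def)
      have "lane b m i r (q i l) - lane b m i r (p i l) = (\<Sum>h<N. r (tm q (m * h + i) l) - r (tm p (m * h + i) l))"
        using il pl lane_eq_sum[OF N[of "q i l" i l], of i r] lane_eq_sum[OF N[of "p i l" i l], of i r]
        by (simp add: tm_def sum_subtractf)
      then show "(\<Sum>h<N. u ((m * h + i) mod m) l \<bullet> (r (tm q (m * h + i) l) - r (tm p (m * h + i) l)))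
        = u i l \<bullet> (lane b m i r (q i l) - lane b m i r (p i l))"
        using il by (simp add: inner_sum_right)
    qed
    finally show ?thesis by simp
  qed
  moreover have "(\<Sum>i<m. \<Sum>l<K. (q i l - p i l) * \<kappa> (u i l)) = (\<Sum>j<m * N * K. (Q j - P j) * \<kappa> (w j))" for \<kappa>
  proof -
    have "(\<Sum>j<m * N * K. (Q j - P j) * \<kappa> (w j))
        = (\<Sum>i<m. \<Sum>l<K. \<Sum>h<N. (tm q (m * h + i) l - tm p (m * h + i) l) * \<kappa> (u ((m * h + i) mod m) l))"
      unfolding P_def Q_def w_def by (rule flat[of "\<lambda>B l. (tm q B l - tm p B l) * \<kappa> (u (B mod m) l)"])
    also have "\<dots> = (\<Sum>i<m. \<Sum>l<K. (q i l - p i l) * \<kappa> (u i l))"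
    proof (intro sum.cong refl)
      fix i l assume il: "i \<in> {..<m}" "l \<in> {..<K}"
      have pl: "p i l \<le> q i l" "0 \<le> p i l" "0 \<le> q i l"
        using pq[of i] il ordered_intervals_nonneg[OF pq[of i]] by (auto simp: ordered_intervals_def)
      have "q i l - p i l = (\<Sum>h<N. tm q (m * h + i) l - tm p (m * h + i) l)"
        using il pl sum_lane_clock[OF _ N[of "q i l" i l], of i] sum_lane_clock[OF _ N[of "p i l" i l], of i]
        by (simp add: tm_def sum_subtractf)
      then show "(\<Sum>h<N. (tm q (m * h + i) l - tm p (m * h + i) l) * \<kappa> (u ((m * h + i) mod m) l))
        = (q i l - p i l) * \<kappa> (u i l)"
        using il by (simp add: sum_distrib_right)
    qed
    finally show ?thesis by simp
  qed
  moreover have "\<forall>j. 0 \<le> w j"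
    by (simp add: w_def u)
  ultimately show ?thesis
    by (intro exI[of _ "m * N * K"] exI[of _ P] exI[of _ Q] exI[of _ w]) simp
qed

end

text \<open>Summation by parts: each increment carries the total weight of the values at or after
  its right end. Thus tests on values, which generate the sigma-algebra of a process, become tests
  on increments, whose law is known.\<close>

lemma increments_of_values:
  fixes u :: "real \<Rightarrow> real ^ 'n"
  assumes "finite I" "I \<subseteq> {0..}" "\<And>t. 0 \<le> u t"
  shows "\<exists>K \<theta> w. mono \<theta> \<and> \<theta> 0 = 0 \<and> (\<forall>l. 0 \<le> w l) \<and>
    (\<forall>r. r 0 = 0 \<longrightarrow> (\<Sum>t\<in>I. u t \<bullet> r t) = (\<Sum>l<K. w l \<bullet> (r (\<theta> (Suc l)) - r (\<theta> l))))"
proof -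
  \<comment> \<open>The extra clause bounds the whole grid by any bound on \<open>I\<close>; it is
    what allows a new largest time to be appended to the grid.\<close>
  have "\<exists>K \<theta> w. mono \<theta> \<and> \<theta> 0 = 0 \<and> (\<forall>l. 0 \<le> w l) \<and> (\<forall>c\<ge>0. (\<forall>t\<in>I. t \<le> c) \<longrightarrow> (\<forall>l. \<theta> l \<le> c)) \<and>
    (\<forall>r. r 0 = 0 \<longrightarrow> (\<Sum>t\<in>I. u t \<bullet> r t) = (\<Sum>l<K. w l \<bullet> (r (\<theta> (Suc l)) - r (\<theta> l))))"
    using assms(1,2)
  proof (induction rule: finite_linorder_max_induct)
    case empty
    show ?case
      by (rule exI[of _ 0], rule exI[of _ "\<lambda>_. 0"], rule exI[of _ "\<lambda>_. 0"]) (auto simp: mono_def)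
  next
    case (insert b I)
    have "I \<subseteq> {0..}"
      using insert.prems by simp
    from insert.IH[OF this]
    obtain K :: nat and \<theta> w where IH: "mono \<theta> \<and> \<theta> 0 = 0 \<and> (\<forall>l. 0 \<le> w l) \<and>
      (\<forall>c\<ge>0. (\<forall>t\<in>I. t \<le> c) \<longrightarrow> (\<forall>l. \<theta> l \<le> c)) \<and>
      (\<forall>r. r 0 = 0 \<longrightarrow> (\<Sum>t\<in>I. u t \<bullet> r t) = (\<Sum>l<K. w l \<bullet> (r (\<theta> (Suc l)) - r (\<theta> l))))"
      by (elim exE)
    then have *: "mono \<theta>" "\<theta> 0 = 0" "\<And>l. 0 \<le> w l"
      "\<And>c l. 0 \<le> c \<Longrightarrow> (\<forall>t\<in>I. t \<le> c) \<Longrightarrow> \<theta> l \<le> c"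
      "\<And>r. r 0 = 0 \<Longrightarrow> (\<Sum>t\<in>I. u t \<bullet> r t) = (\<Sum>l<K. w l \<bullet> (r (\<theta> (Suc l)) - r (\<theta> l)))"
      by simp_all
    define \<theta>' where "\<theta>' l = (if l \<le> K then \<theta> l else b)" for l
    \<comment> \<open>The value at the new last time \<open>b\<close> is the sum of all increments
      up to \<open>b\<close>, so \<open>u b\<close> is added to every earlier weight and is the only
      weight of the new increment.\<close>
    define w' where "w' l = (if l < K then w l + u b else u b)" for l
    have b: "\<theta> l \<le> b" for l
      using insert *(4)[of b l] by (auto intro: less_imp_le)
    have "mono \<theta>'"
      using b *(1) by (auto simp: \<theta>'_def mono_def)
    moreover have "\<theta>' 0 = 0"
      using *(2) by (simp add: \<theta>'_def)
    moreover have "\<forall>l. 0 \<le> w' l"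
      using *(3) assms(3) by (simp add: w'_def)
    moreover have "\<forall>c\<ge>0. (\<forall>t\<in>insert b I. t \<le> c) \<longrightarrow> (\<forall>l. \<theta>' l \<le> c)"
      using *(4) by (auto simp: \<theta>'_def)
    moreover have "(\<Sum>t\<in>insert b I. u t \<bullet> r t) = (\<Sum>l<Suc K. w' l \<bullet> (r (\<theta>' (Suc l)) - r (\<theta>' l)))"
      if r: "r 0 = 0" for r :: "real \<Rightarrow> real ^ 'n"
    proof -
      have "b \<notin> I"
        using insert by auto
      have "(\<Sum>l<Suc K. w' l \<bullet> (r (\<theta>' (Suc l)) - r (\<theta>' l)))
          = (\<Sum>l<K. (w l + u b) \<bullet> (r (\<theta> (Suc l)) - r (\<theta> l))) + u b \<bullet> (r b - r (\<theta> K))"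
        by (auto simp: w'_def \<theta>'_def intro!: sum.cong)
      also have "(\<Sum>l<K. (w l + u b) \<bullet> (r (\<theta> (Suc l)) - r (\<theta> l)))
          = (\<Sum>t\<in>I. u t \<bullet> r t) + u b \<bullet> (\<Sum>l<K. r (\<theta> (Suc l)) - r (\<theta> l))"
        by (simp add: *(5)[of r, OF r] inner_add_left sum.distrib inner_sum_right)
      also have "(\<Sum>l<K. r (\<theta> (Suc l)) - r (\<theta> l)) = r (\<theta> K)"
        using sum_lessThan_telescope[of "\<lambda>l. r (\<theta> l)" K] *(2) r by simp
      finally show ?thesis
        using \<open>b \<notin> I\<close> insert.hyps(1) by (simp add: inner_diff_right)
    qed
    ultimately show ?case
      by (intro exI[of _ "Suc K"] exI[of _ \<theta>'] exI[of _ w']) blast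
  qed
  then show ?thesis
    by blast
qed

lemma ordered_intervals_mono:
  "mono \<theta> \<Longrightarrow> 0 \<le> \<theta> 0 \<Longrightarrow> ordered_intervals \<theta> (\<lambda>l. \<theta> (Suc l))"
  by (auto simp: ordered_intervals_def mono_def)

lemma ordered_intervals_0 [simp]: "ordered_intervals (\<lambda>_. 0) (\<lambda>_. 0)"
  by (simp add: ordered_intervals_def)

text \<open>The uniqueness theorem compares two weights for one vector, not two vectors. A fair coin
  chooses between \<open>Y1\<close> and \<open>Y2\<close>; the weights are twice the indicators of
  its sides, the factor \<open>2\<close> cancelling the probability \<open>1/2\<close>.\<close>

lemma (in prob_space) distr_eq_of_laplace_eq:
  fixes Y1 Y2 :: "'a \<Rightarrow> real ^ 'n"
  assumes Y [measurable]: "Y1 \<in> borel_measurable M" "Y2 \<in> borel_measurable M"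
    and Y0: "\<And>\<omega>. \<omega> \<in> space M \<Longrightarrow> 0 \<le> Y1 \<omega>" "\<And>\<omega>. \<omega> \<in> space M \<Longrightarrow> 0 \<le> Y2 \<omega>"
    and eq: "\<And>u. 0 \<le> u \<Longrightarrow> (\<integral>\<omega>. exp (- (u \<bullet> Y1 \<omega>)) \<partial>M) = (\<integral>\<omega>. exp (- (u \<bullet> Y2 \<omega>)) \<partial>M)"
  shows "distr M borel Y1 = distr M borel Y2"
proof -
  let ?C = "measure_pmf (bernoulli_pmf (1/2))"
  interpret C: prob_space ?C by (rule measure_pmf.prob_space_axioms)
  interpret P: pair_prob_space ?C M ..
  define Y where "Y z = (if fst z then Y1 (snd z) else Y2 (snd z))" for z
  have [measurable]: "Measurable.pred (?C \<Otimes>\<^sub>M M) fst"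
    by measurable
  have Ym: "Y \<in> borel_measurable (?C \<Otimes>\<^sub>M M)"
    unfolding Y_def by measurable
  have int: "(\<integral>z. (if fst z then 2 else 0) * f (Y z) \<partial>(?C \<Otimes>\<^sub>M M)) = (\<integral>\<omega>. f (Y1 \<omega>) \<partial>M)"
    "(\<integral>z. (if fst z then 0 else 2) * f (Y z) \<partial>(?C \<Otimes>\<^sub>M M)) = (\<integral>\<omega>. f (Y2 \<omega>) \<partial>M)"
    if [measurable]: "f \<in> borel_measurable borel"
      and f: "\<And>\<omega>. \<omega> \<in> space M \<Longrightarrow> \<bar>f (Y1 \<omega>)\<bar> \<le> 1" "\<And>\<omega>. \<omega> \<in> space M \<Longrightarrow> \<bar>f (Y2 \<omega>)\<bar> \<le> 1"
    for f :: "real ^ 'n \<Rightarrow> real"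
  proof -
    have *: "integrable (?C \<Otimes>\<^sub>M M) (\<lambda>z. c (fst z) * f (Y z))" if "\<And>b. \<bar>c b\<bar> \<le> 2" for c :: "bool \<Rightarrow> real"
    proof (rule P.P.integrable_const_bound[of _ "2"])
      show "AE z in ?C \<Otimes>\<^sub>M M. norm (c (fst z) * f (Y z)) \<le> 2"
      proof (rule AE_I2)
        fix z assume "z \<in> space (?C \<Otimes>\<^sub>M M)"
        then have "\<bar>f (Y z)\<bar> \<le> 1"
          using f by (auto simp: Y_def space_pair_measure)
        then show "norm (c (fst z) * f (Y z)) \<le> 2"
          using mult_mono[OF that[of "fst z"], of "\<bar>f (Y z)\<bar>" 1] by (simp add: abs_mult)
      qed
      show "(\<lambda>z. c (fst z) * f (Y z)) \<in> borel_measurable (?C \<Otimes>\<^sub>M M)"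
        using Ym by measurable
    qed
    show "(\<integral>z. (if fst z then 2 else 0) * f (Y z) \<partial>(?C \<Otimes>\<^sub>M M)) = (\<integral>\<omega>. f (Y1 \<omega>) \<partial>M)"
      using P.integral_fst'[OF *[of "\<lambda>b. if b then 2 else 0"]] by (simp add: Y_def)
    show "(\<integral>z. (if fst z then 0 else 2) * f (Y z) \<partial>(?C \<Otimes>\<^sub>M M)) = (\<integral>\<omega>. f (Y2 \<omega>) \<partial>M)"
      using P.integral_fst'[OF *[of "\<lambda>b. if b then 0 else 2"]] by (simp add: Y_def)
  qed
  show ?thesis
  proof (rule measure_eqI)
    fix A :: "(real ^ 'n) set" assume "A \<in> sets (distr M borel Y1)"
    then have [measurable]: "A \<in> sets borel"
      by simp
    have "(\<integral>z. (if fst z then 2 else 0) * indicator A (Y z) \<partial>(?C \<Otimes>\<^sub>M M))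
        = (\<integral>z. (if fst z then 0 else 2) * indicator A (Y z) \<partial>(?C \<Otimes>\<^sub>M M) :: real)"
    proof (rule P.P.integral_eq_of_laplace_eq[OF Ym])
      show "0 \<le> Y z" if "z \<in> space (?C \<Otimes>\<^sub>M M)" for z
        using that Y0 by (auto simp: Y_def space_pair_measure)
      show "integrable (?C \<Otimes>\<^sub>M M) (\<lambda>z. if fst z then 2 else 0 :: real)"
        "integrable (?C \<Otimes>\<^sub>M M) (\<lambda>z. if fst z then 0 else 2 :: real)"
        by (rule P.P.integrable_const_bound[of _ 2]; simp)+
      show "(\<integral>z. (if fst z then 2 else 0) * exp (- (u \<bullet> Y z)) \<partial>(?C \<Otimes>\<^sub>M M))
        = (\<integral>z. (if fst z then 0 else 2) * exp (- (u \<bullet> Y z)) \<partial>(?C \<Otimes>\<^sub>M M))" if "0 \<le> u" for u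
        using int[of "\<lambda>y. exp (- (u \<bullet> y))"] eq[OF that] that Y0 by (simp add: inner_nonneg_vec)
    qed auto
    then have "(\<integral>\<omega>. indicator A (Y1 \<omega>) \<partial>M) = (\<integral>\<omega>. indicator A (Y2 \<omega>) \<partial>M :: real)"
      using int[of "indicator A"] by (simp add: indicator_def)
    moreover have "(\<integral>\<omega>. indicator A (Y' \<omega>) \<partial>M) = prob (Y' -` A \<inter> space M)"
      if [measurable]: "Y' \<in> borel_measurable M" for Y'
    proof -
      have "(\<integral>\<omega>. indicator A (Y' \<omega>) \<partial>M) = (\<integral>\<omega>. indicator (Y' -` A \<inter> space M) \<omega> \<partial>M :: real)"
        by (rule Bochner_Integration.integral_cong) (auto simp: indicator_def)
      then show ?thesis
        by simp
    qed
    ultimately show "emeasure (distr M borel Y1) A = emeasure (distr M borel Y2) A"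
      by (simp add: emeasure_distr emeasure_eq_measure)
  qed simp
qed

section \<open>Branching steps\<close>

text \<open>\<open>F\<close> is the past, and \<open>Q\<close> contains the past together with all
  that the step uses, so it can serve as the past of the next step. The single identity
  \<open>laplace\<close> encodes the exponents, independent increments, independence among the
  \<open>R k\<close> and \<open>G\<close>, and their independence of \<open>F\<close>; in this form
  all of it passes through a composition at once.\<close>

locale branching_step = prob_space M
  for M :: "'w measure" +
  fixes F Q :: "'w measure"
    and \<kappa> :: "'n::finite \<Rightarrow> real ^ 'n \<Rightarrow> real" and g :: "real ^ 'n \<Rightarrow> real"
    and X Y :: "'w \<Rightarrow> real ^ 'n"
    and R :: "'n \<Rightarrow> real \<Rightarrow> 'w \<Rightarrow> real ^ 'n" and G :: "'w \<Rightarrow> real ^ 'n"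
  assumes subalg: "subalgebra M Q" "subalgebra Q F"
    and X_measurable: "X \<in> borel_measurable F"
    and X_nonneg: "\<omega> \<in> space M \<Longrightarrow> 0 \<le> X \<omega>"
    and R_measurable: "0 \<le> s \<Longrightarrow> R k s \<in> borel_measurable Q"
    and R_path: "\<omega> \<in> space M \<Longrightarrow> increasing_path (\<lambda>s. R k s \<omega>)"
    and G_measurable: "G \<in> borel_measurable Q"
    and G_nonneg: "\<omega> \<in> space M \<Longrightarrow> 0 \<le> G \<omega>"
    and Y_eq: "\<omega> \<in> space M \<Longrightarrow> Y \<omega> = (\<Sum>k\<in>UNIV. R k (X \<omega> $ k) \<omega>) + G \<omega>"
    and laplace: "\<lbrakk>A \<in> sets F; \<And>k. ordered_intervals (p k) (q k); \<And>k l. 0 \<le> u k l; 0 \<le> v\<rbrakk> \<Longrightarrow>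
      (\<integral>\<omega>. indicator A \<omega> * exp (- ((\<Sum>k\<in>UNIV. \<Sum>l<K. u k l \<bullet> (R k (q k l) \<omega> - R k (p k l) \<omega>)) + v \<bullet> G \<omega>)) \<partial>M)
      = prob A * (exp (- (\<Sum>k\<in>UNIV. \<Sum>l<K. (q k l - p k l) * \<kappa> k (u k l))) * g v)"
begin

lemma subalg_past: "subalgebra M F"
  using subalg by (rule subalgebra_trans)

lemma R_measurable_M: "0 \<le> s \<Longrightarrow> R k s \<in> borel_measurable M"
  using R_measurable subalg(1) by (rule measurable_subalgebra[rotated])

lemma G_measurable_M: "G \<in> borel_measurable M"
  using G_measurable subalg(1) by (rule measurable_subalgebra[rotated])

lemma R_nonneg: "\<omega> \<in> space M \<Longrightarrow> 0 \<le> s \<Longrightarrow> 0 \<le> R k s \<omega>"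
  using R_path by (rule increasing_path_nonneg)

lemma X_nth_nonneg: "\<omega> \<in> space M \<Longrightarrow> 0 \<le> X \<omega> $ k"
  using X_nonneg by (simp add: less_eq_vec_def)

lemma Y_nonneg: "\<omega> \<in> space M \<Longrightarrow> 0 \<le> Y \<omega>"
  using Y_eq by (simp add: G_nonneg R_nonneg X_nth_nonneg sum_nonneg)

lemma space_F: "space F = space M" and space_Q: "space Q = space M"
  using subalg subalg_past by (auto simp: subalgebra_def)

lemma space_in_F: "space M \<in> sets F"
  using sets.top[of F] by (simp add: space_F)

lemma Y_measurable: "Y \<in> borel_measurable Q"
proof -
  have X: "X \<in> borel_measurable Q"
    using X_measurable subalg(2) by (rule measurable_subalgebra[rotated])
  have "(\<lambda>\<omega>. R k (X \<omega> $ k) \<omega>) \<in> borel_measurable Q" for k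
    by (rule measurable_at_random_time[where X="R k" and T="\<lambda>\<omega>. X \<omega> $ k"])
       (use X R_measurable R_path X_nth_nonneg in \<open>auto simp: space_Q intro: increasing_path_right_cont\<close>)
  then have "(\<lambda>\<omega>. (\<Sum>k\<in>UNIV. R k (X \<omega> $ k) \<omega>) + G \<omega>) \<in> borel_measurable Q"
    using G_measurable by (intro borel_measurable_add borel_measurable_sum)
  then show ?thesis
    by (rule measurable_cong[THEN iffD1, rotated]) (simp add: Y_eq space_Q)
qed

lemma laplace_zero: "g 0 = 1"
  using laplace[OF space_in_F, of "\<lambda>_ _. 0" "\<lambda>_ _. 0" "\<lambda>_ _. 0" 0 0] by (simp add: prob_space)

lemma laplace_one:
  assumes "0 \<le> u"
  shows "(\<integral>\<omega>. exp (- (u \<bullet> R k 1 \<omega>)) \<partial>M) = exp (- \<kappa> k u)"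
proof -
  define q :: "'n \<Rightarrow> nat \<Rightarrow> real" where "q k' l = (if k' = k then Suc l else 0)" for k' l
  define p :: "'n \<Rightarrow> nat \<Rightarrow> real" where "p k' l = (if k' = k then l else 0)" for k' l
  have "(\<integral>\<omega>. indicator (space M) \<omega> * exp (- ((\<Sum>k\<in>UNIV. \<Sum>l<1. u \<bullet> (R k (q k l) \<omega> - R k (p k l) \<omega>)) + 0 \<bullet> G \<omega>)) \<partial>M)
      = prob (space M) * (exp (- (\<Sum>k\<in>UNIV. \<Sum>l<1. (q k l - p k l) * \<kappa> k u)) * g 0)"
    using assms by (intro laplace space_in_F) (auto simp: ordered_intervals_def p_def q_def)
  moreover have "(\<Sum>k'\<in>UNIV. u \<bullet> (R k' (q k' 0) \<omega> - R k' (p k' 0) \<omega>)) = u \<bullet> R k 1 \<omega>"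
    if "\<omega> \<in> space M" for \<omega>
  proof -
    have "R k 0 \<omega> = 0"
      using R_path[OF that] by (simp add: increasing_path_def)
    then have "u \<bullet> (R k' (q k' 0) \<omega> - R k' (p k' 0) \<omega>) = (if k' = k then u \<bullet> R k 1 \<omega> else 0)" for k'
      by (simp add: p_def q_def)
    then show ?thesis
      by simp
  qed
  moreover have "(\<Sum>k'\<in>UNIV. (q k' 0 - p k' 0) * \<kappa> k' u) = \<kappa> k u"
  proof -
    have "(q k' 0 - p k' 0) * \<kappa> k' u = (if k' = k then \<kappa> k u else 0)" for k'
      by (simp add: p_def q_def)
    then show ?thesis
      by simp
  qed
  ultimately show ?thesis
    by (simp add: prob_space laplace_zero cong: Bochner_Integration.integral_cong)
qed

lemma exponent_zero: "\<kappa> k 0 = 0"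
  using laplace_one[of 0 k] by (simp add: prob_space)

text \<open>In a composition the exponents of the second step become arguments of those of the
  first, which are controlled only at non-negative arguments.\<close>

lemma exponent_nonneg:
  assumes "0 \<le> u"
  shows "0 \<le> \<kappa> k u"
proof -
  have "(\<integral>\<omega>. exp (- (u \<bullet> R k 1 \<omega>)) \<partial>M) \<le> (\<integral>\<omega>. 1 \<partial>M)"
  proof (rule integral_mono)
    show "exp (- (u \<bullet> R k 1 \<omega>)) \<le> 1" if "\<omega> \<in> space M" for \<omega>
      using R_nonneg[OF that, of 1] assms by (simp add: inner_nonneg_vec)
    then show "integrable M (\<lambda>\<omega>. exp (- (u \<bullet> R k 1 \<omega>)))"
      using R_measurable_M[of 1 k] by (intro integrable_const_bound[of _ 1]) auto
  qed simp
  then show ?thesis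
    by (simp add: laplace_one[OF assms] prob_space)
qed

text \<open>Families of different sizes are padded with zero weights to a common size; this changes
  neither side because exponents vanish at \<open>0\<close>.\<close>

lemma laplace_var:
  assumes "A \<in> sets F" "\<And>k. ordered_intervals (p k) (q k)" "\<And>k l. 0 \<le> u k l" "0 \<le> v"
  shows "(\<integral>\<omega>. indicator A \<omega> * exp (- ((\<Sum>k\<in>UNIV. \<Sum>l<K k. u k l \<bullet> (R k (q k l) \<omega> - R k (p k l) \<omega>)) + v \<bullet> G \<omega>)) \<partial>M)
      = prob A * (exp (- (\<Sum>k\<in>UNIV. \<Sum>l<K k. (q k l - p k l) * \<kappa> k (u k l))) * g v)"
proof -
  define N where "N = (\<Sum>k\<in>UNIV. K k)"
  define u' where "u' k l = (if l < K k then u k l else 0)" for k l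
  have N: "K k \<le> N" for k
    unfolding N_def by (intro member_le_sum) auto
  have "(\<Sum>l<K k. u k l \<bullet> (R k (q k l) \<omega> - R k (p k l) \<omega>)) = (\<Sum>l<N. u' k l \<bullet> (R k (q k l) \<omega> - R k (p k l) \<omega>))" for k \<omega>
    using N[of k] by (intro sum.mono_neutral_cong_left) (auto simp: u'_def)
  moreover have "(\<Sum>l<K k. (q k l - p k l) * \<kappa> k (u k l)) = (\<Sum>l<N. (q k l - p k l) * \<kappa> k (u' k l))" for k
    using N[of k] by (intro sum.mono_neutral_cong_left) (auto simp: u'_def exponent_zero)
  ultimately show ?thesis
    using laplace[of A p q u' v N] assms by (simp add: u'_def)
qed

lemma laplace_single:
  assumes "ordered_intervals p q" "\<And>l. 0 \<le> u l"
  shows "(\<integral>\<omega>. exp (- (\<Sum>l<K. u l \<bullet> (R k (q l) \<omega> - R k (p l) \<omega>))) \<partial>M)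
      = exp (- (\<Sum>l<K. (q l - p l) * \<kappa> k (u l)))"
proof -
  define K' where "K' k' = (if k' = k then K else 0)" for k'
  have *: "(\<Sum>k'\<in>UNIV. \<Sum>l<K' k'. f k' l) = (\<Sum>l<K. f k l)" for f :: "'n \<Rightarrow> nat \<Rightarrow> real"
  proof -
    have "(\<Sum>l<K' k'. f k' l) = (if k' = k then \<Sum>l<K. f k l else 0)" for k'
      by (simp add: K'_def)
    then show ?thesis by simp
  qed
  show ?thesis
    using laplace_var[OF space_in_F, of "\<lambda>_. p" "\<lambda>_. q" "\<lambda>_. u" 0 K'] assms
    by (simp add: * prob_space laplace_zero cong: Bochner_Integration.integral_cong)
qed

lemma laplace_immigration:
  assumes "0 \<le> v"
  shows "(\<integral>\<omega>. exp (- (v \<bullet> G \<omega>)) \<partial>M) = g v"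
  using laplace[OF space_in_F, of "\<lambda>_ _. 0" "\<lambda>_ _. 0" "\<lambda>_ _. 0" v 0] assms
  by (simp add: prob_space cong: Bochner_Integration.integral_cong)

section \<open>Independence of the ingredients of a step from each other and from the past\<close>

definition step_events :: "'n option \<Rightarrow> 'w set set" where
  "step_events x = (case x of Some k \<Rightarrow> sigma_of M {0..} (R k) | None \<Rightarrow> sigma_of_var M G)"

lemma step_events_subset: "step_events x \<subseteq> sets M"
  unfolding step_events_def using R_measurable_M G_measurable_M
  by (auto split: option.split intro!: sigma_of_subset)

lemma step_prob:
  assumes A: "A \<in> sets F" and E: "\<And>x. E x \<in> step_events x"
  shows "prob (A \<inter> (\<Inter>x. E x)) = prob A * (\<Prod>x\<in>UNIV. prob (E x))"
proof -
  \<comment> \<open>The immigration is treated as a process with the single time \<open>0\<close>,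
    so that subordinators and immigration fall under one criterion.\<close>
  define T :: "'n option \<Rightarrow> real set" where "T x = (case x of Some k \<Rightarrow> {0..} | None \<Rightarrow> {0})" for x
  define Z where "Z x = (case x of Some k \<Rightarrow> R k | None \<Rightarrow> (\<lambda>_. G))" for x
  have T: "sigma_of M (T x) (Z x) = step_events x" for x
    by (auto simp: T_def Z_def step_events_def sigma_of_def split: option.split)
  have A_M [measurable]: "A \<in> sets M"
    using A subalg_past by (auto simp: subalgebra_def)
  have prod_option: "(\<Prod>x\<in>UNIV. f x) = (\<Prod>k\<in>UNIV. f (Some k)) * f None" for f :: "'n option \<Rightarrow> real"
    unfolding UNIV_option_conv by (subst prod.insert) (auto simp: prod.reindex mult.commute)
  have "(\<integral>\<omega>. indicator A \<omega> * (\<Prod>x\<in>UNIV. indicator (E x) \<omega>) \<partial>M)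
      = (\<integral>\<omega>. indicator A \<omega> \<partial>M) * (\<Prod>x\<in>UNIV. prob (E x))"
  proof (rule integral_indicators_eq_prod)
    show "Z x t \<in> borel_measurable M" if "t \<in> T x" for x t
      using that R_measurable_M G_measurable_M by (auto simp: T_def Z_def split: option.splits)
    show "0 \<le> Z x t \<omega>" if "t \<in> T x" "\<omega> \<in> space M" for x t \<omega>
      using that R_nonneg G_nonneg by (auto simp: T_def Z_def split: option.splits)
    show "E x \<in> sigma_of M (T x) (Z x)" for x
      by (simp add: T E)
    fix I :: "'n option \<Rightarrow> real set" and u :: "'n option \<Rightarrow> real \<Rightarrow> real ^ 'n"
    assume "\<And>x. x \<in> UNIV \<Longrightarrow> finite (I x) \<and> I x \<subseteq> T x" and u: "\<And>x t. 0 \<le> u x t"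
    then have I: "finite (I x)" "I x \<subseteq> T x" for x
      by auto
    \<comment> \<open>Tests on values of \<open>R k\<close> are rewritten through increments over a
      grid, the form in which the identity of the locale applies.\<close>
    define rep where "rep k K \<theta> w \<longleftrightarrow> mono \<theta> \<and> \<theta> 0 = 0 \<and> (\<forall>l. 0 \<le> w l) \<and>
      (\<forall>r. r 0 = 0 \<longrightarrow> (\<Sum>t\<in>I (Some k). u (Some k) t \<bullet> r t) = (\<Sum>l<K. w l \<bullet> (r (\<theta> (Suc l)) - r (\<theta> l))))"
      for k and K :: nat and \<theta> and w :: "nat \<Rightarrow> real ^ 'n"
    have "\<exists>K \<theta> w. rep k K \<theta> w" for k
      unfolding rep_def using I[of "Some k"] u by (intro increments_of_values) (auto simp: T_def)
    then obtain K \<theta> w where "\<And>k. rep k (K k) (\<theta> k) (w k)"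
      by metis
    then have \<theta>: "\<And>k. mono (\<theta> k)" "\<And>k. \<theta> k 0 = 0" "\<And>k l. 0 \<le> w k l"
      and eq: "\<And>k r. r 0 = 0 \<Longrightarrow> (\<Sum>t\<in>I (Some k). u (Some k) t \<bullet> r t)
        = (\<Sum>l<K k. w k l \<bullet> (r (\<theta> k (Suc l)) - r (\<theta> k l)))"
      unfolding rep_def by simp_all
    have ord: "ordered_intervals (\<theta> k) (\<lambda>l. \<theta> k (Suc l))" for k
      using \<theta> by (simp add: ordered_intervals_mono)
    define v where "v = (\<Sum>t\<in>I None. u None t)"
    have v: "0 \<le> v"
      using u by (simp add: v_def sum_nonneg)
    let ?inc = "\<lambda>k \<omega>. \<Sum>l<K k. w k l \<bullet> (R k (\<theta> k (Suc l)) \<omega> - R k (\<theta> k l) \<omega>)"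
    have Some: "laplace_test (Z (Some k)) (I (Some k)) (u (Some k)) \<omega> = exp (- ?inc k \<omega>)" if "\<omega> \<in> space M" for k \<omega>
      using eq[of "\<lambda>t. R k t \<omega>" k] R_path[OF that, of k] by (simp add: laplace_test_def Z_def increasing_path_def)
    have None: "laplace_test (Z None) (I None) (u None) \<omega> = exp (- (v \<bullet> G \<omega>))" for \<omega>
      by (simp add: laplace_test_def Z_def v_def inner_sum_left)
    have "(\<Prod>x\<in>UNIV. laplace_test (Z x) (I x) (u x) \<omega>) = exp (- ((\<Sum>k\<in>UNIV. ?inc k \<omega>) + v \<bullet> G \<omega>))"
      if "\<omega> \<in> space M" for \<omega>
      unfolding prod_option using that by (simp add: Some None exp_diff exp_minus exp_add exp_sum field_simps prod_inversef flip: sum_negf)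
    then have "(\<integral>\<omega>. indicator A \<omega> * (\<Prod>x\<in>UNIV. laplace_test (Z x) (I x) (u x) \<omega>) \<partial>M)
      = (\<integral>\<omega>. indicator A \<omega> * exp (- ((\<Sum>k\<in>UNIV. ?inc k \<omega>) + v \<bullet> G \<omega>)) \<partial>M)"
      by (intro Bochner_Integration.integral_cong) auto
    also have "\<dots> = prob A * (exp (- (\<Sum>k\<in>UNIV. \<Sum>l<K k. (\<theta> k (Suc l) - \<theta> k l) * \<kappa> k (w k l))) * g v)"
      using A ord \<theta> v by (intro laplace_var)
    also have "exp (- (\<Sum>k\<in>UNIV. \<Sum>l<K k. (\<theta> k (Suc l) - \<theta> k l) * \<kappa> k (w k l)))
      = (\<Prod>k\<in>UNIV. exp (- (\<Sum>l<K k. (\<theta> k (Suc l) - \<theta> k l) * \<kappa> k (w k l))))"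
      by (simp add: exp_sum flip: sum_negf)
    also have "\<dots> = (\<Prod>k\<in>UNIV. \<integral>\<omega>. laplace_test (Z (Some k)) (I (Some k)) (u (Some k)) \<omega> \<partial>M)"
      using laplace_single[OF ord \<theta>(3)] by (simp add: Some cong: Bochner_Integration.integral_cong)
    also have "g v = (\<integral>\<omega>. laplace_test (Z None) (I None) (u None) \<omega> \<partial>M)"
      by (simp add: None laplace_immigration v)
    also have "prob A = (\<integral>\<omega>. indicator A \<omega> \<partial>M)"
      by simp
    finally show "(\<integral>\<omega>. indicator A \<omega> * (\<Prod>x\<in>UNIV. laplace_test (Z x) (I x) (u x) \<omega>) \<partial>M)
      = (\<integral>\<omega>. indicator A \<omega> \<partial>M) * (\<Prod>x\<in>UNIV. \<integral>\<omega>. laplace_test (Z x) (I x) (u x) \<omega> \<partial>M)"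
      by (simp add: prod_option)
  qed (use A_M in \<open>auto intro!: integrable_real_indicator simp: emeasure_eq_measure\<close>)
  moreover have "(\<integral>\<omega>. indicator A \<omega> * (\<Prod>x\<in>UNIV. indicator (E x) \<omega>) \<partial>M) = prob (A \<inter> (\<Inter>x. E x))"
  proof -
    have [measurable]: "(\<Inter>x. E x) \<in> sets M"
      using E step_events_subset by (intro sets.countable_INT') auto
    have "indicator A \<omega> * (\<Prod>x\<in>UNIV. indicator (E x) \<omega>) = (indicator (A \<inter> (\<Inter>x. E x)) \<omega> :: real)" for \<omega>
      by (auto simp: indicator_def)
    then show ?thesis
      by simp
  qed
  ultimately show ?thesis
    by simp
qed

end

section \<open>The sigma-algebra generated by one step\<close>

lemma sigma_of_eq_sets:
  "sigma_of M T Y = sets (sigma (space M) {Y t -` A \<inter> space M | t A. t \<in> T \<and> A \<in> sets borel})"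
  unfolding sigma_of_def by (rule sets_measure_of[symmetric]) auto

lemma Int_stable_sigma_of: "Int_stable (sigma_of M T Y)"
  unfolding sigma_of_eq_sets by (rule sets.Int_stable)

lemma sigma_of_space_subset:
  assumes "space N = space M" "\<And>t. t \<in> T \<Longrightarrow> Y t \<in> borel_measurable N"
  shows "sigma_of M T Y \<subseteq> sets N"
  using sigma_of_subset[of T Y N] assms by (simp add: sigma_of_def)

lemma space_in_sigma_of: "space M \<in> sigma_of M T Y"
  unfolding sigma_of_def by (rule sigma_sets_top)

context branching_step begin

lemma step_events_Int_stable: "Int_stable (step_events x)"
  by (auto simp: step_events_def Int_stable_sigma_of split: option.split)

lemma space_in_step_events: "space M \<in> step_events x"
  by (auto simp: step_events_def space_in_sigma_of split: option.split)

text \<open>The outer \<open>None\<close> is the past, \<open>Some None\<close> the immigration and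
  \<open>Some (Some k)\<close> the subordinator of type \<open>k\<close>. The index set is finite
  and every family contains \<open>space M\<close>, so only the product over all indices has to be
  checked.\<close>

lemma indep_step_events:
  "indep_sets (\<lambda>x. case x of None \<Rightarrow> sets F | Some y \<Rightarrow> step_events y) UNIV"
proof (subst indep_sets_finite)
  show "(case x of None \<Rightarrow> sets F | Some y \<Rightarrow> step_events y) \<subseteq> sets M" for x
    using step_events_subset subalg_past by (auto simp: subalgebra_def split: option.split)
  show "space M \<in> (case x of None \<Rightarrow> sets F | Some y \<Rightarrow> step_events y)" for x
    using space_in_F space_in_step_events by (auto split: option.split)
  show "\<forall>A\<in>Pi UNIV (\<lambda>x. case x of None \<Rightarrow> sets F | Some y \<Rightarrow> step_events y).
    prob (\<Inter>x. A x) = (\<Prod>x\<in>UNIV. prob (A x))"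
  proof
    fix A assume "A \<in> Pi UNIV (\<lambda>x. case x of None \<Rightarrow> sets F | Some y \<Rightarrow> step_events y)"
    then have *: "A x \<in> (case x of None \<Rightarrow> sets F | Some y \<Rightarrow> step_events y)" for x
      by auto
    have "(\<Inter>x. A x) = A None \<inter> (\<Inter>x. A (Some x))"
      unfolding UNIV_option_conv by auto
    moreover have "(\<Prod>x\<in>UNIV. prob (A x)) = prob (A None) * (\<Prod>x\<in>UNIV. prob (A (Some x)))"
      unfolding UNIV_option_conv[where 'a="'n option"] by (subst prod.insert) (auto simp: prod.reindex)
    ultimately show "prob (\<Inter>x. A x) = (\<Prod>x\<in>UNIV. prob (A x))"
      using step_prob[of "A None" "\<lambda>x. A (Some x)"] *[of None] *[of "Some _"] by simp
  qed
qed auto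

text \<open>What the step adds to the past. \<open>Q\<close> includes \<open>F\<close> and cannot
  take its place in statements about independence of the past.\<close>

definition step_algebra :: "'w measure" where
  "step_algebra = sigma (space M) (\<Union>x. step_events x)"

lemma sets_step_algebra: "sets step_algebra = sigma_sets (space M) (\<Union>x. step_events x)"
  unfolding step_algebra_def using step_events_subset sets.sets_into_space
  by (intro sets_measure_of) blast

lemma space_step_algebra: "space step_algebra = space M"
  unfolding step_algebra_def using step_events_subset sets.sets_into_space
  by (intro space_measure_of) blast

lemma subalg_step_algebra: "subalgebra M step_algebra"
  using sets.sigma_sets_subset[of "\<Union>x. step_events x" M] step_events_subset
  by (auto simp: subalgebra_def sets_step_algebra space_step_algebra)

lemma indep_step_algebra: "indep_set (sets F) (sets step_algebra)"
proof -
  let ?E = "\<lambda>x. case x of None \<Rightarrow> sets F | Some y \<Rightarrow> step_events y"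
  let ?I = "\<lambda>b. if b then {None} else range Some"
  have "indep_sets (\<lambda>j. sigma_sets (space M) (\<Union>i\<in>?I j. ?E i)) UNIV"
  proof (rule indep_sets_collect_sigma)
    have "(\<Union>j. ?I j) = UNIV"
      using notin_range_Some by fastforce
    show "indep_sets ?E (\<Union>j. ?I j)"
      unfolding \<open>(\<Union>j. ?I j) = UNIV\<close> by (rule indep_step_events)
    show "Int_stable (?E i)" for i
      by (auto simp: step_events_Int_stable sets.Int_stable split: option.split)
    show "disjoint_family ?I"
      by (auto simp: disjoint_family_on_def)
  qed
  then show ?thesis
    unfolding indep_set_def
  proof (rule indep_sets_mono_sets)
    fix b :: bool
    show "(case b of True \<Rightarrow> sets F | False \<Rightarrow> sets step_algebra) \<subseteq> sigma_sets (space M) (\<Union>i\<in>?I b. ?E i)"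
      by (cases b) (auto simp: sets_step_algebra)
  qed
qed

lemma R_measurable_step_algebra:
  assumes "0 \<le> s"
  shows "R k s \<in> borel_measurable step_algebra"
proof (rule measurableI)
  fix A :: "(real ^ 'n) set" assume "A \<in> sets borel"
  then have "R k s -` A \<inter> space M \<in> step_events (Some k)"
    unfolding step_events_def sigma_of_def using assms by auto
  then show "R k s -` A \<inter> space step_algebra \<in> sets step_algebra"
    unfolding sets_step_algebra space_step_algebra by blast
qed simp

lemma G_measurable_step_algebra: "G \<in> borel_measurable step_algebra"
proof (rule measurableI)
  fix A :: "(real ^ 'n) set" assume "A \<in> sets borel"
  then have "G -` A \<inter> space M \<in> step_events None"
    unfolding step_events_def sigma_of_def by auto
  then show "G -` A \<inter> space step_algebra \<in> sets step_algebra"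
    unfolding sets_step_algebra space_step_algebra by blast
qed simp

lemma step_events_subset_future: "step_events x \<subseteq> sets Q"
proof (cases x)
  case None
  then show ?thesis
    using sigma_of_space_subset[OF space_Q, of UNIV "\<lambda>_. G"] G_measurable by (simp add: step_events_def)
next
  case (Some k)
  then show ?thesis
    using sigma_of_space_subset[OF space_Q, of "{0..}" "R k"] R_measurable by (simp add: step_events_def)
qed

section \<open>The processes of a step as Levy subordinators\<close>

lemma laplace_increment:
  assumes "0 \<le> s" "s \<le> t" "0 \<le> u"
  shows "(\<integral>\<omega>. exp (- (u \<bullet> (R k t \<omega> - R k s \<omega>))) \<partial>M) = exp (- ((t - s) * \<kappa> k u))"
  using laplace_single[where p="\<lambda>l. if l = 0 then s else t" and q="\<lambda>_. t" and u="\<lambda>_. u" and K=1 and k=k] assms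
  by (simp add: ordered_intervals_def)

lemma indep_increments:
  assumes "0 \<le> t 0" "mono t"
  shows "indep_vars (\<lambda>_. borel) (\<lambda>l \<omega>. R k (t (Suc l)) \<omega> - R k (t l) \<omega>) {..<m}"
proof -
  define D where "D l \<omega> = R k (t (Suc l)) \<omega> - R k (t l) \<omega>" for l \<omega>
  have t: "0 \<le> t l" "t l \<le> t (Suc l)" for l
    using assms monoD[OF assms(2), of 0 l] monoD[OF assms(2), of l "Suc l"] by auto
  have D [measurable]: "D l \<in> borel_measurable M" for l
    unfolding D_def using R_measurable_M t by (intro borel_measurable_diff) auto
  have D0: "0 \<le> D l \<omega>" if "\<omega> \<in> space M" for l \<omega>
    using increasing_path_mono[OF R_path[OF that] t] by (simp add: D_def)
  have ord: "ordered_intervals t (\<lambda>l. t (Suc l))"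
    using assms by (intro ordered_intervals_mono)
  have "indep_sets (\<lambda>l. {D l -` A \<inter> space M | A. A \<in> sets borel}) {..<m}"
  proof (rule indep_setsI)
    show "{D l -` A \<inter> space M | A. A \<in> sets borel} \<subseteq> sets M" for l
      by auto
    fix E J assume J: "J \<noteq> {}" "J \<subseteq> {..<m}" "finite J"
      and E: "\<forall>j\<in>J. E j \<in> {D j -` A \<inter> space M | A. A \<in> sets borel}"
    have "(\<integral>\<omega>. 1 * (\<Prod>j\<in>J. indicator (E j) \<omega>) \<partial>M) = (\<integral>\<omega>. 1 \<partial>M) * (\<Prod>j\<in>J. prob (E j))"
    proof (rule integral_indicators_eq_prod[where T="\<lambda>_. {()}" and Y="\<lambda>j _. D j"])
      show "E j \<in> sigma_of M {()} (\<lambda>_. D j)" if "j \<in> J" for j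
        using E that unfolding sigma_of_def by (intro sigma_sets.Basic) auto
      fix I :: "nat \<Rightarrow> unit set" and u :: "nat \<Rightarrow> unit \<Rightarrow> real ^ 'n"
      assume u: "\<And>j t. 0 \<le> u j t"
      \<comment> \<open>Zero weights outside \<open>J\<close> extend the product to all
        \<open>m\<close> consecutive increments, whose joint transform is known.\<close>
      define v where "v l = (if l \<in> J then \<Sum>t\<in>I l. u l t else 0)" for l
      have v: "0 \<le> v l" for l
        using u by (simp add: v_def sum_nonneg)
      have tst: "laplace_test (\<lambda>_. D j) (I j) (u j) \<omega> = exp (- (v j \<bullet> D j \<omega>))" if "j \<in> J" for j \<omega>
        using that by (simp add: laplace_test_def v_def inner_sum_left)
      have sumJ: "(\<Sum>l<m. f l) = (\<Sum>l\<in>J. f l)" if "\<And>l. l \<notin> J \<Longrightarrow> f l = 0" for f :: "nat \<Rightarrow> real"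
        using J that by (intro sum.mono_neutral_right) auto
      have "(\<Prod>j\<in>J. laplace_test (\<lambda>_. D j) (I j) (u j) \<omega>) = exp (- (\<Sum>l<m. v l \<bullet> D l \<omega>))" for \<omega>
      proof -
        have "(\<Sum>l<m. v l \<bullet> D l \<omega>) = (\<Sum>l\<in>J. v l \<bullet> D l \<omega>)"
          by (rule sumJ) (simp add: v_def)
        then show ?thesis
          using J by (simp add: tst exp_sum flip: sum_negf)
      qed
      then have "(\<integral>\<omega>. 1 * (\<Prod>j\<in>J. laplace_test (\<lambda>_. D j) (I j) (u j) \<omega>) \<partial>M) = exp (- (\<Sum>l<m. (t (Suc l) - t l) * \<kappa> k (v l)))"
        using laplace_single[OF ord v] by (simp add: D_def)
      also have "(\<Sum>l<m. (t (Suc l) - t l) * \<kappa> k (v l)) = (\<Sum>l\<in>J. (t (Suc l) - t l) * \<kappa> k (v l))"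
        by (rule sumJ) (simp add: v_def exponent_zero)
      also have "exp (- \<dots>) = (\<Prod>j\<in>J. exp (- ((t (Suc j) - t j) * \<kappa> k (v j))))"
        using J by (simp add: exp_sum flip: sum_negf)
      also have "\<dots> = (\<Prod>j\<in>J. \<integral>\<omega>. laplace_test (\<lambda>_. D j) (I j) (u j) \<omega> \<partial>M)"
        by (intro prod.cong refl) (simp add: tst D_def laplace_increment[OF t v])
      finally show "(\<integral>\<omega>. 1 * (\<Prod>j\<in>J. laplace_test (\<lambda>_. D j) (I j) (u j) \<omega>) \<partial>M)
          = (\<integral>\<omega>. 1 \<partial>M) * (\<Prod>j\<in>J. \<integral>\<omega>. laplace_test (\<lambda>_. D j) (I j) (u j) \<omega> \<partial>M)"
        by (simp add: prob_space)
    qed (use J D0 in auto)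
    moreover have "(\<integral>\<omega>. 1 * (\<Prod>j\<in>J. indicator (E j) \<omega>) \<partial>M) = prob (\<Inter>j\<in>J. E j)"
    proof -
      have "E j \<in> sets M" if "j \<in> J" for j
        using E that D by auto
      then have "(\<Inter>j\<in>J. E j) \<in> sets M"
        using J by (intro sets.finite_INT) auto
      moreover have "(\<Prod>j\<in>J. indicator (E j) \<omega>) = (indicator (\<Inter>j\<in>J. E j) \<omega> :: real)" for \<omega>
        using J by (auto simp: indicator_def)
      ultimately show ?thesis
        by simp
    qed
    ultimately show "prob (\<Inter>j\<in>J. E j) = (\<Prod>j\<in>J. prob (E j))"
      by (simp add: prob_space)
  qed
  then show ?thesis
    unfolding indep_vars_def2 D_def[symmetric] by (simp add: D)
qed

lemma levy_subordinator_R: "levy_subordinator M (R k)"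
  unfolding levy_subordinator_def levy_process_def
proof (intro conjI allI impI ballI prob_space_axioms)
  show "R k t \<in> borel_measurable M" if "0 \<le> t" for t
    using that by (rule R_measurable_M)
  show "R k 0 \<omega> = 0" if "\<omega> \<in> space M" for \<omega>
    using R_path[OF that] by (simp add: increasing_path_def)
  show "cadlag (\<lambda>t. R k t \<omega>)" if "\<omega> \<in> space M" for \<omega>
    using R_path[OF that] by (rule cadlag_increasing_path)
  show "indep_vars (\<lambda>_. borel) (\<lambda>l \<omega>. R k (t (Suc l)) \<omega> - R k (t l) \<omega>) {..<m}"
    if "0 \<le> t 0 \<and> mono t" for t m
    using that by (intro indep_increments) auto
  show "R k s \<omega> \<le> R k t \<omega>" if "\<omega> \<in> space M" "0 \<le> s \<and> s \<le> t" for \<omega> s t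
    using increasing_path_mono[OF R_path[OF that(1)]] that(2) by auto
  show "distr M borel (\<lambda>\<omega>. R k (s + t) \<omega> - R k s \<omega>) = distr M borel (R k t)" if "0 \<le> s" "0 \<le> t" for s t
  proof (rule distr_eq_of_laplace_eq)
    show "(\<lambda>\<omega>. R k (s + t) \<omega> - R k s \<omega>) \<in> borel_measurable M" "R k t \<in> borel_measurable M"
      using that by (auto intro!: borel_measurable_diff R_measurable_M)
    show "0 \<le> R k (s + t) \<omega> - R k s \<omega>" if "\<omega> \<in> space M" for \<omega>
      using increasing_path_mono[OF R_path[OF that], of s "s + t"] \<open>0 \<le> s\<close> \<open>0 \<le> t\<close> by simp
    show "0 \<le> R k t \<omega>" if "\<omega> \<in> space M" for \<omega>
      using that \<open>0 \<le> t\<close> by (rule R_nonneg)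
    fix u :: "real ^ 'n" assume u: "0 \<le> u"
    have R0: "R k 0 \<omega> = 0" if "\<omega> \<in> space M" for \<omega>
      using R_path[OF that] by (simp add: increasing_path_def)
    show "(\<integral>\<omega>. exp (- (u \<bullet> (R k (s + t) \<omega> - R k s \<omega>))) \<partial>M) = (\<integral>\<omega>. exp (- (u \<bullet> R k t \<omega>)) \<partial>M)"
      using laplace_increment[of s "s + t" u k] laplace_increment[of 0 t u k] that u
      by (simp add: R0 cong: Bochner_Integration.integral_cong)
  qed
qed

lemma has_laplace_exponent_R: "has_laplace_exponent M (R k) (\<kappa> k)"
  unfolding has_laplace_exponent_def
proof (intro allI impI)
  fix u :: "real ^ 'n" and t :: real assume ut: "0 \<le> u" "0 \<le> t"
  have R0: "R k 0 \<omega> = 0" if "\<omega> \<in> space M" for \<omega>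
    using R_path[OF that] by (simp add: increasing_path_def)
  have "lst (distr M borel (R k t)) u = (\<integral>\<omega>. exp (- (u \<bullet> R k t \<omega>)) \<partial>M)"
    unfolding lst_def using R_measurable_M[OF ut(2)] by (intro integral_distr) auto
  then show "lst (distr M borel (R k t)) u = exp (- t * \<kappa> k u)"
    using laplace_increment[of 0 t u k] ut by (simp add: R0 cong: Bochner_Integration.integral_cong)
qed

end

section \<open>Composition of two branching steps\<close>

lemma sum_option: "(\<Sum>x\<in>UNIV. f x) = (\<Sum>k\<in>UNIV. f (Some k)) + f None"
  for f :: "'n::finite option \<Rightarrow> 'b::comm_monoid_add"
  unfolding UNIV_option_conv by (subst sum.insert) (auto simp: sum.reindex add.commute)

text \<open>The number of summands depends on the outcome but takes countably many values, which
  leaves finite sums of the process at random times. Since \<open>N\<close> is arbitrary, the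
  statement also covers a product space on which block lengths and path come from different
  outcomes.\<close>

lemma measurable_lane:
  fixes X :: "real \<Rightarrow> 'a \<Rightarrow> real ^ 'n"
  assumes b [measurable]: "\<And>j. (\<lambda>a. b a j) \<in> borel_measurable N" and b0: "\<And>a j. a \<in> space N \<Longrightarrow> 0 \<le> b a j"
    and X: "\<And>s. 0 \<le> s \<Longrightarrow> X s \<in> borel_measurable N"
    and rc: "\<And>a. a \<in> space N \<Longrightarrow> right_cont (\<lambda>s. X s a)"
    and T [measurable]: "T \<in> borel_measurable N"
  shows "(\<lambda>a. lane (b a) m i (\<lambda>s. X s a) (T a)) \<in> borel_measurable N"
  unfolding lane_def
proof (rule measurable_compose_countable[where g="\<lambda>a. nat \<lceil>T a\<rceil> + 1"
    and f="\<lambda>n a. \<Sum>h<n. X (block_start (b a) m (m * h + i) + lane_clock (b a) m i h (T a)) a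
        - X (block_start (b a) m (m * h + i)) a"])
  have [measurable]: "(\<lambda>a. block_len (b a) m j) \<in> borel_measurable N" for j
    by (simp add: block_len_def)
  have st [measurable]: "(\<lambda>a. block_start (b a) m j) \<in> borel_measurable N" for j
    unfolding block_start_def by measurable
  have [measurable]: "(\<lambda>a. lane_offset (b a) m i h) \<in> borel_measurable N" for h
    unfolding lane_offset_def by measurable
  have ck [measurable]: "(\<lambda>a. lane_clock (b a) m i h (T a)) \<in> borel_measurable N" for h
    unfolding lane_clock_def clamp_at_def by measurable
  have start: "0 \<le> block_start (b a) m j" if "a \<in> space N" for a j
    using b0[OF that] by (rule block_start_nonneg)
  have at: "(\<lambda>a. X (S a) a) \<in> borel_measurable N"
    if "S \<in> borel_measurable N" "\<And>a. a \<in> space N \<Longrightarrow> 0 \<le> S a" for S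
    by (rule measurable_at_random_time[OF X rc that])
  show "(\<lambda>a. \<Sum>h<n. X (block_start (b a) m (m * h + i) + lane_clock (b a) m i h (T a)) a
        - X (block_start (b a) m (m * h + i)) a) \<in> borel_measurable N" for n
    using start lane_clock_nonneg
    by (intro borel_measurable_sum borel_measurable_diff at borel_measurable_add st ck) auto
  show "(\<lambda>a. nat \<lceil>T a\<rceil> + 1) \<in> measurable N (count_space UNIV)"
    by measurable
qed

text \<open>Lane \<open>e (Some i)\<close> of \<open>R k\<close> receives the fluid in coordinate \<open>k\<close> that stems from type \<open>i\<close>, and
  lane \<open>e None\<close> the fluid that stems from the immigration.\<close>

lemma branching_step_compose:
  fixes \<kappa>1 \<kappa>2 :: "'n::finite \<Rightarrow> real ^ 'n \<Rightarrow> real"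
  assumes "branching_step M F Q \<kappa>1 g1 X Y P I" "branching_step M Q Q' \<kappa>2 g2 Y Z R G"
  shows "\<exists>R' G'. branching_step M F Q' (\<lambda>i u. \<kappa>1 i (\<chi> k. \<kappa>2 k u)) (\<lambda>v. g1 (\<chi> k. \<kappa>2 k v) * g2 v) X Z R' G'"
proof -
  interpret A: branching_step M F Q \<kappa>1 g1 X Y P I by fact
  interpret B: branching_step M Q Q' \<kappa>2 g2 Y Z R G by fact
  define m where "m = CARD('n option)"
  have m: "0 < m"
    by (simp add: m_def)
  \<comment> \<open>Lanes are numbered, but contributors are types or the immigration;
    \<open>e\<close> fixes an arbitrary order of the contributors, and \<open>d\<close> inverts
    it.\<close>
  obtain e :: "'n option \<Rightarrow> nat" where e: "bij_betw e UNIV {..<m}"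
    using ex_bij_betw_finite_nat[of "UNIV :: 'n option set"] by (auto simp: m_def atLeast0LessThan)
  define d where "d = inv_into UNIV e"
  have de: "d (e x) = x" for x
    using e by (simp add: d_def bij_betw_def)
  have sum_e: "(\<Sum>j<m. f j) = (\<Sum>x\<in>UNIV. f (e x))" for f :: "nat \<Rightarrow> 'b::comm_monoid_add"
    using sum.reindex_bij_betw[OF e, of f] by simp
  define len where "len \<omega> k x = (case x of None \<Rightarrow> I \<omega> $ k | Some i \<Rightarrow> P i (X \<omega> $ i) \<omega> $ k)" for \<omega> k x
  define b where "b \<omega> k j = len \<omega> k (d j)" for \<omega> k j
  have nth_mono: "x $ k \<le> y $ k" if "x \<le> y" for x y :: "real ^ 'n" and k
    using that by (simp add: less_eq_vec_def)
  have I0: "0 \<le> I \<omega> $ k" if "\<omega> \<in> space M" for \<omega> k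
    using nth_mono[OF A.G_nonneg[OF that], of k] by simp
  have P0: "0 \<le> P i s \<omega> $ k" if "\<omega> \<in> space M" "0 \<le> s" for i s \<omega> k
    using nth_mono[OF A.R_nonneg[OF that], of k] by simp
  have b0: "0 \<le> b \<omega> k j" if "\<omega> \<in> space M" for \<omega> k j
    using I0[OF that] P0[OF that A.X_nth_nonneg[OF that]] by (simp add: b_def len_def split: option.split)
  have bQ: "(\<lambda>\<omega>. b \<omega> k j) \<in> borel_measurable Q" for k j
  proof (cases "d j")
    case None
    then show ?thesis
      using A.G_measurable by (simp add: b_def len_def borel_measurable_vec_nth)
  next
    case (Some i)
    have "X \<in> borel_measurable Q"
      using A.X_measurable A.subalg(2) by (rule measurable_subalgebra[rotated])
    then have "(\<lambda>\<omega>. P i (X \<omega> $ i) \<omega>) \<in> borel_measurable Q"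
      by (intro measurable_at_random_time[where X="P i" and T="\<lambda>\<omega>. X \<omega> $ i"])
         (auto simp: A.space_Q A.R_measurable A.X_nth_nonneg intro: increasing_path_right_cont A.R_path borel_measurable_vec_nth)
    then show ?thesis
      using Some by (simp add: b_def len_def borel_measurable_vec_nth)
  qed
  \<comment> \<open>Two outcomes are kept apart: \<open>\<omega>\<close> determines the block
    lengths and \<open>\<omega>'\<close> the path that is cut. Only the diagonal is of interest, but
    decoupling needs the two separately.\<close>
  let ?lane = "\<lambda>k x \<omega> \<omega>' s. lane (b \<omega> k) m (e x) (\<lambda>s. R k s \<omega>') s"
  \<comment> \<open>The clock of a lane is the offspring process of the first step at an arbitrary
    \<open>s\<close>. It equals the prescribed block length at \<open>s = X \<omega> $ i\<close>;
    for other \<open>s\<close> the lane may stop short of the end of its block or continue into unit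
    blocks.\<close>
  define R' where "R' i s \<omega> = (\<Sum>k\<in>UNIV. ?lane k (Some i) \<omega> \<omega> (P i s \<omega> $ k))" for i s \<omega>
  define G' where "G' \<omega> = (\<Sum>k\<in>UNIV. ?lane k None \<omega> \<omega> (I \<omega> $ k)) + G \<omega>" for \<omega>
  have lane_path: "increasing_path (?lane k x \<omega> \<omega>')" if "\<omega> \<in> space M" "\<omega>' \<in> space M" for k x \<omega> \<omega>'
    using b0[OF that(1)] B.R_path[OF that(2)] by (intro increasing_path_lane) auto
  have lane0: "?lane k x \<omega> \<omega>' 0 = 0" if "\<omega> \<in> space M" "\<omega>' \<in> space M" for k x \<omega> \<omega>'
    using lane_path[OF that, of k x] by (simp add: increasing_path_def)
  define \<kappa>v where "\<kappa>v u = (\<chi> k. \<kappa>2 k u)" for u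
  \<comment> \<open>Needed because the transform of the first step will be evaluated at
    \<open>\<kappa>v\<close>.\<close>
  have \<kappa>v: "0 \<le> \<kappa>v u" if "0 \<le> u" for u
    using B.exponent_nonneg[OF that] by (simp add: \<kappa>v_def less_eq_vec_def)
  have bQ': "(\<lambda>\<omega>. b \<omega> k j) \<in> borel_measurable Q'" for k j
    using B.subalg(2) bQ by (rule measurable_subalgebra)
  have lane_Q': "(\<lambda>\<omega>. ?lane k x \<omega> \<omega> (T \<omega>)) \<in> borel_measurable Q'" if "T \<in> borel_measurable Q'" for k x T
    using bQ' b0 B.R_measurable B.R_path that
    by (intro measurable_lane) (auto simp: B.space_Q intro: increasing_path_right_cont)
  have "branching_step M F Q' (\<lambda>i u. \<kappa>1 i (\<kappa>v u)) (\<lambda>v. g1 (\<kappa>v v) * g2 v) X Z R' G'"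
  proof
    show "subalgebra M Q'" "subalgebra Q' F"
      using B.subalg A.subalg(2) by (auto intro: subalgebra_trans)
    show "X \<in> borel_measurable F"
      by (rule A.X_measurable)
    show "0 \<le> X \<omega>" if "\<omega> \<in> space M" for \<omega>
      using that by (rule A.X_nonneg)
    show "R' k s \<in> borel_measurable Q'" if "0 \<le> s" for k s
      unfolding R'_def using measurable_subalgebra[OF B.subalg(2) A.R_measurable[OF that]]
      by (intro borel_measurable_sum lane_Q' borel_measurable_vec_nth)
    show "G' \<in> borel_measurable Q'"
      unfolding G'_def using measurable_subalgebra[OF B.subalg(2) A.G_measurable]
      by (intro borel_measurable_add borel_measurable_sum lane_Q' borel_measurable_vec_nth B.G_measurable)
    show "increasing_path (\<lambda>s. R' k s \<omega>)" if "\<omega> \<in> space M" for k \<omega>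
      unfolding R'_def
      by (intro increasing_path_sum increasing_path_compose_nth lane_path that A.R_path)
    show "0 \<le> G' \<omega>" if "\<omega> \<in> space M" for \<omega>
      unfolding G'_def using that
      by (intro add_nonneg_nonneg sum_nonneg increasing_path_nonneg[OF lane_path] I0 B.G_nonneg)
    show "Z \<omega> = (\<Sum>k\<in>UNIV. R' k (X \<omega> $ k) \<omega>) + G' \<omega>" if \<omega>: "\<omega> \<in> space M" for \<omega>
    proof -
      have "R k (Y \<omega> $ k) \<omega> = (\<Sum>i\<in>UNIV. ?lane k (Some i) \<omega> \<omega> (P i (X \<omega> $ i) \<omega> $ k)) + ?lane k None \<omega> \<omega> (I \<omega> $ k)" for k
      proof -
        have "(\<Sum>j<m. b \<omega> k j) = Y \<omega> $ k"
          by (simp add: sum_e b_def de sum_option len_def A.Y_eq[OF \<omega>] sum_component)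
        moreover have "R k 0 \<omega> = 0"
          using B.R_path[OF \<omega>] by (simp add: increasing_path_def)
        ultimately have "R k (Y \<omega> $ k) \<omega> = (\<Sum>j<m. lane (b \<omega> k) m j (\<lambda>s. R k s \<omega>) (b \<omega> k j))"
          using sum_lane_initial[of "b \<omega> k" m "\<lambda>s. R k s \<omega>"] b0[OF \<omega>] by simp
        then show ?thesis
          by (simp add: sum_e b_def de sum_option len_def)
      qed
      moreover have "(\<Sum>i\<in>UNIV. R' i (X \<omega> $ i) \<omega>)
          = (\<Sum>k\<in>UNIV. \<Sum>i\<in>UNIV. ?lane k (Some i) \<omega> \<omega> (P i (X \<omega> $ i) \<omega> $ k))"
        unfolding R'_def by (rule sum.swap)
      ultimately show ?thesis
        unfolding B.Y_eq[OF \<omega>] G'_def by (simp add: sum.distrib add.assoc)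
    qed
    fix E v and K :: nat and p q :: "'n \<Rightarrow> nat \<Rightarrow> real" and u :: "'n \<Rightarrow> nat \<Rightarrow> real ^ 'n"
    assume E: "E \<in> sets F" and ord: "\<And>k. ordered_intervals (p k) (q k)"
      and u: "\<And>k l. 0 \<le> u k l" and v: "(0 :: real ^ 'n) \<le> v"
    \<comment> \<open>The extra index leaves room for the one interval of the immigration even when
      \<open>K\<close> is \<open>0\<close>, and makes the number of intervals per lane
      positive.\<close>
    define N where "N = Suc K"
    have N: "0 < N"
      by (simp add: N_def)
    \<comment> \<open>Intervals in lane time. A type lane runs between values of the increasing
      clock; the immigration lane has the interval from \<open>0\<close> to
      \<open>I \<omega> $ k\<close>, followed by degenerate ones.\<close>
    define pp where "pp \<omega> k x l = (case x of None \<Rightarrow> if l = 0 then 0 else I \<omega> $ k | Some i \<Rightarrow> P i (p i l) \<omega> $ k)"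
      for \<omega> k x and l :: nat
    define qq where "qq \<omega> k x l = (case x of None \<Rightarrow> I \<omega> $ k | Some i \<Rightarrow> P i (q i l) \<omega> $ k)"
      for \<omega> k x and l :: nat
    define uu where "uu x l = (case x of None \<Rightarrow> if l = 0 then v else 0 | Some i \<Rightarrow> if l < K then u i l else 0)"
      for x l
    have uu: "0 \<le> uu x l" for x l
      using u v by (simp add: uu_def split: option.split)
    have pq: "0 \<le> p i l" "p i l \<le> q i l" "q i l \<le> p i (Suc l)" for i l
      using ord[of i] ordered_intervals_nonneg[OF ord[of i]] by (auto simp: ordered_intervals_def)
    have ordk: "ordered_intervals (pp \<omega> k x) (qq \<omega> k x)" if \<omega>: "\<omega> \<in> space M" for \<omega> k x
    proof (cases x)
      case None
      then show ?thesis
        using I0[OF \<omega>] by (simp add: ordered_intervals_def pp_def qq_def)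
    next
      case (Some i)
      have "P i (p i l) \<omega> $ k \<le> P i (q i l) \<omega> $ k" "P i (q i l) \<omega> $ k \<le> P i (p i (Suc l)) \<omega> $ k" for l
        using pq[of i l] by (auto intro!: nth_mono increasing_path_mono[OF A.R_path[OF \<omega>]] intro: order_trans)
      then show ?thesis
        using Some P0[OF \<omega> pq(1)] by (simp add: ordered_intervals_def pp_def qq_def)
    qed
    \<comment> \<open>The part of the exponent to be tested that comes from the lanes, with lengths
      and clocks at \<open>\<omega>\<close> and paths at \<open>\<omega>'\<close>.\<close>
    define inc where "inc \<omega> \<omega>' = (\<Sum>k\<in>UNIV. \<Sum>x\<in>UNIV. \<Sum>l<N. uu x l \<bullet> (?lane k x \<omega> \<omega>' (qq \<omega> k x l) - ?lane k x \<omega> \<omega>' (pp \<omega> k x l)))"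
      for \<omega> \<omega>'
    define f where "f z = indicator E (fst z) * exp (- (inc (fst z) (snd z) + v \<bullet> G (snd z)))" for z
    have f_eq: "f (\<omega>, \<omega>) = indicator E \<omega> * exp (- ((\<Sum>k\<in>UNIV. \<Sum>l<K. u k l \<bullet> (R' k (q k l) \<omega> - R' k (p k l) \<omega>)) + v \<bullet> G' \<omega>))"
      if \<omega>: "\<omega> \<in> space M" for \<omega>
    proof -
      have inner: "(\<Sum>x\<in>UNIV. \<Sum>l<N. uu x l \<bullet> (?lane k x \<omega> \<omega> (qq \<omega> k x l) - ?lane k x \<omega> \<omega> (pp \<omega> k x l)))
        = (\<Sum>i\<in>UNIV. \<Sum>l<K. u i l \<bullet> (?lane k (Some i) \<omega> \<omega> (P i (q i l) \<omega> $ k) - ?lane k (Some i) \<omega> \<omega> (P i (p i l) \<omega> $ k)))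
          + v \<bullet> ?lane k None \<omega> \<omega> (I \<omega> $ k)" for k
      proof -
        have 1: "(\<Sum>l<N. uu (Some i) l \<bullet> (?lane k (Some i) \<omega> \<omega> (qq \<omega> k (Some i) l) - ?lane k (Some i) \<omega> \<omega> (pp \<omega> k (Some i) l)))
          = (\<Sum>l<K. u i l \<bullet> (?lane k (Some i) \<omega> \<omega> (P i (q i l) \<omega> $ k) - ?lane k (Some i) \<omega> \<omega> (P i (p i l) \<omega> $ k)))" for i
          by (simp add: N_def uu_def pp_def qq_def)
        have 2: "(\<Sum>l<N. uu None l \<bullet> (?lane k None \<omega> \<omega> (qq \<omega> k None l) - ?lane k None \<omega> \<omega> (pp \<omega> k None l)))
          = v \<bullet> ?lane k None \<omega> \<omega> (I \<omega> $ k)"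
          unfolding N_def sum.lessThan_Suc_shift by (simp add: uu_def pp_def qq_def lane0[OF \<omega> \<omega>])
        show ?thesis
          by (simp only: sum_option 1 2)
      qed
      have "inc \<omega> \<omega> + v \<bullet> G \<omega> = (\<Sum>i\<in>UNIV. \<Sum>l<K. u i l \<bullet> (R' i (q i l) \<omega> - R' i (p i l) \<omega>)) + v \<bullet> G' \<omega>"
      proof -
        have "(\<Sum>i\<in>UNIV. \<Sum>l<K. u i l \<bullet> (R' i (q i l) \<omega> - R' i (p i l) \<omega>))
          = (\<Sum>i\<in>UNIV. \<Sum>l<K. \<Sum>k\<in>UNIV. u i l \<bullet> (?lane k (Some i) \<omega> \<omega> (P i (q i l) \<omega> $ k) - ?lane k (Some i) \<omega> \<omega> (P i (p i l) \<omega> $ k)))"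
          unfolding R'_def by (simp add: inner_sum_right flip: sum_subtractf)
        also have "\<dots> = (\<Sum>i\<in>UNIV. \<Sum>k\<in>UNIV. \<Sum>l<K. u i l \<bullet> (?lane k (Some i) \<omega> \<omega> (P i (q i l) \<omega> $ k) - ?lane k (Some i) \<omega> \<omega> (P i (p i l) \<omega> $ k)))"
          by (intro sum.cong sum.swap refl)
        also have "\<dots> = (\<Sum>k\<in>UNIV. \<Sum>i\<in>UNIV. \<Sum>l<K. u i l \<bullet> (?lane k (Some i) \<omega> \<omega> (P i (q i l) \<omega> $ k) - ?lane k (Some i) \<omega> \<omega> (P i (p i l) \<omega> $ k)))"
          by (rule sum.swap)
        finally show ?thesis
          unfolding inc_def inner G'_def by (simp add: sum.distrib inner_add_right inner_sum_right)
      qed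
      then show ?thesis
        by (simp add: f_def)
    qed
    \<comment> \<open>The exponent obtained by integrating out the paths of the second step. The
      block lengths no longer occur in it: it involves lane times only, and is therefore linear in
      the increments of the first step.\<close>
    define ex where "ex \<omega> = (\<Sum>k\<in>UNIV. \<Sum>x\<in>UNIV. \<Sum>l<N. (qq \<omega> k x l - pp \<omega> k x l) * \<kappa>2 k (uu x l))" for \<omega>
    have ex_eq: "ex \<omega> = (\<Sum>i\<in>UNIV. \<Sum>l<K. \<kappa>v (u i l) \<bullet> (P i (q i l) \<omega> - P i (p i l) \<omega>)) + \<kappa>v v \<bullet> I \<omega>" for \<omega>
    proof -
      have inner: "(\<Sum>x\<in>UNIV. \<Sum>l<N. (qq \<omega> k x l - pp \<omega> k x l) * \<kappa>2 k (uu x l))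
        = (\<Sum>i\<in>UNIV. \<Sum>l<K. (P i (q i l) \<omega> $ k - P i (p i l) \<omega> $ k) * \<kappa>2 k (u i l)) + I \<omega> $ k * \<kappa>2 k v" for k
      proof -
        have 1: "(\<Sum>l<N. (qq \<omega> k (Some i) l - pp \<omega> k (Some i) l) * \<kappa>2 k (uu (Some i) l))
          = (\<Sum>l<K. (P i (q i l) \<omega> $ k - P i (p i l) \<omega> $ k) * \<kappa>2 k (u i l))" for i
          by (simp add: N_def uu_def pp_def qq_def B.exponent_zero)
        have 2: "(\<Sum>l<N. (qq \<omega> k None l - pp \<omega> k None l) * \<kappa>2 k (uu None l)) = I \<omega> $ k * \<kappa>2 k v"
          unfolding N_def sum.lessThan_Suc_shift by (simp add: uu_def pp_def qq_def)
        show ?thesis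
          by (simp only: sum_option 1 2)
      qed
      have "(\<Sum>i\<in>UNIV. \<Sum>l<K. \<kappa>v (u i l) \<bullet> (P i (q i l) \<omega> - P i (p i l) \<omega>))
        = (\<Sum>i\<in>UNIV. \<Sum>l<K. \<Sum>k\<in>UNIV. (P i (q i l) \<omega> $ k - P i (p i l) \<omega> $ k) * \<kappa>2 k (u i l))"
        by (simp add: inner_vec_def \<kappa>v_def mult.commute)
      also have "\<dots> = (\<Sum>i\<in>UNIV. \<Sum>k\<in>UNIV. \<Sum>l<K. (P i (q i l) \<omega> $ k - P i (p i l) \<omega> $ k) * \<kappa>2 k (u i l))"
        by (intro sum.cong sum.swap refl)
      also have "\<dots> = (\<Sum>k\<in>UNIV. \<Sum>i\<in>UNIV. \<Sum>l<K. (P i (q i l) \<omega> $ k - P i (p i l) \<omega> $ k) * \<kappa>2 k (u i l))"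
        by (rule sum.swap)
      finally show ?thesis
        unfolding ex_def inner by (simp add: sum.distrib inner_vec_def \<kappa>v_def mult.commute)
    qed
    \<comment> \<open>The event, the block lengths and the clocks are measurable with respect to
      \<open>Q\<close>, which is the past of the second step; its paths and immigration belong to
      the independent \<open>B.step_algebra\<close>.\<close>
    have "(\<integral>\<omega>. f (\<omega>, \<omega>) \<partial>M) = (\<integral>\<omega>. (\<integral>\<omega>'. f (\<omega>, \<omega>') \<partial>M) \<partial>M)"
    proof (rule A.integral_decouple[OF A.subalg(1) B.subalg_step_algebra B.indep_step_algebra])
      let ?N = "Q \<Otimes>\<^sub>M B.step_algebra"
      have sp: "fst z \<in> space M" "snd z \<in> space M" if "z \<in> space ?N" for z
        using that by (auto simp: space_pair_measure A.space_Q B.space_step_algebra)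
      have fst: "(\<lambda>z. h (fst z)) \<in> borel_measurable ?N" if "h \<in> borel_measurable Q" for h :: "_ \<Rightarrow> 'c::topological_space"
        using that by measurable
      have snd: "(\<lambda>z. h (snd z)) \<in> borel_measurable ?N" if "h \<in> borel_measurable B.step_algebra" for h :: "_ \<Rightarrow> 'c::topological_space"
        using that by measurable
      have lane_N: "(\<lambda>z. ?lane k x (fst z) (snd z) (T (fst z))) \<in> borel_measurable ?N"
        if "T \<in> borel_measurable Q" for k x T
        by (rule measurable_lane[where X="\<lambda>s z. R k s (snd z)" and b="\<lambda>z. b (fst z) k" and T="\<lambda>z. T (fst z)"])
           (auto intro!: fst snd bQ b0 B.R_measurable_step_algebra that sp B.R_path increasing_path_right_cont)
      have ppQ: "(\<lambda>\<omega>. pp \<omega> k x l) \<in> borel_measurable Q" "(\<lambda>\<omega>. qq \<omega> k x l) \<in> borel_measurable Q" for k x l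
        using A.G_measurable A.R_measurable[OF pq(1)] A.R_measurable[OF order_trans[OF pq(1,2)]]
        by (cases x; cases "l = 0"; simp add: pp_def qq_def borel_measurable_vec_nth)+
      have "E \<in> sets Q"
        using E A.subalg(2) by (auto simp: subalgebra_def)
      then have "(\<lambda>\<omega>. indicator E \<omega> :: real) \<in> borel_measurable Q"
        by simp
      then have "(\<lambda>z. indicator E (fst z) :: real) \<in> borel_measurable ?N"
        by (rule fst)
      moreover have "(\<lambda>z. inc (fst z) (snd z)) \<in> borel_measurable ?N"
        unfolding inc_def
        by (intro borel_measurable_sum borel_measurable_inner borel_measurable_const borel_measurable_diff lane_N ppQ)
      moreover have "(\<lambda>z. G (snd z)) \<in> borel_measurable ?N"
        by (rule snd[OF B.G_measurable_step_algebra])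
      ultimately show "f \<in> borel_measurable ?N"
        unfolding f_def by measurable
      show "\<bar>f (\<omega>, \<omega>')\<bar> \<le> 1" if "\<omega> \<in> space M" "\<omega>' \<in> space M" for \<omega> \<omega>'
      proof -
        have "0 \<le> inc \<omega> \<omega>'"
          unfolding inc_def using ordk[OF that(1)] ordered_intervals_nonneg[OF ordk[OF that(1)]]
          by (intro sum_nonneg inner_nonneg_vec uu)
             (auto simp: ordered_intervals_def intro!: increasing_path_mono[OF lane_path[OF that]])
        moreover have "0 \<le> v \<bullet> G \<omega>'"
          using v B.G_nonneg[OF that(2)] by (rule inner_nonneg_vec)
        ultimately show ?thesis
          by (auto simp: f_def indicator_def)
      qed
    qed
    \<comment> \<open>For a fixed \<open>\<omega>\<close> the blocks are deterministic, so the lanes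
      of each \<open>R k\<close> reduce to increments over one system of ordered intervals, and the
      identity of the second step applies.\<close>
    also have "\<dots> = (\<integral>\<omega>. indicator E \<omega> * exp (- ex \<omega>) * g2 v \<partial>M)"
    proof (rule Bochner_Integration.integral_cong[OF refl])
      fix \<omega> assume \<omega>: "\<omega> \<in> space M"
      define rep where "rep k L PP QQ w \<longleftrightarrow> ordered_intervals PP QQ \<and> (\<forall>j. 0 \<le> w j) \<and>
        (\<forall>r. (\<Sum>j<m. \<Sum>l<N. uu (d j) l \<bullet> (lane (b \<omega> k) m j r (qq \<omega> k (d j) l) - lane (b \<omega> k) m j r (pp \<omega> k (d j) l)))
           = (\<Sum>j<L. w j \<bullet> (r (QQ j) - r (PP j)))) \<and>
        (\<forall>\<kappa>. (\<Sum>j<m. \<Sum>l<N. (qq \<omega> k (d j) l - pp \<omega> k (d j) l) * \<kappa> (uu (d j) l)) = (\<Sum>j<L. (QQ j - PP j) * \<kappa> (w j)))"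
        for k and L :: nat and PP QQ :: "nat \<Rightarrow> real" and w :: "nat \<Rightarrow> real ^ 'n"
      have "\<exists>L PP QQ w. rep k L PP QQ w" for k
        unfolding rep_def by (rule lanes_increments[OF b0[OF \<omega>] m N ordk[OF \<omega>] uu])
      then obtain L PP QQ w where rep: "\<And>k. rep k (L k) (PP k) (QQ k) (w k)"
        by metis
      have inc_eq: "inc \<omega> \<omega>' = (\<Sum>k\<in>UNIV. \<Sum>j<L k. w k j \<bullet> (R k (QQ k j) \<omega>' - R k (PP k j) \<omega>'))" for \<omega>'
        unfolding inc_def using rep unfolding rep_def sum_e de by (intro sum.cong refl) blast
      have ex': "ex \<omega> = (\<Sum>k\<in>UNIV. \<Sum>j<L k. (QQ k j - PP k j) * \<kappa>2 k (w k j))"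
        unfolding ex_def using rep unfolding rep_def sum_e de by (intro sum.cong refl) blast
      have "(\<integral>\<omega>'. f (\<omega>, \<omega>') \<partial>M) = indicator E \<omega> * (\<integral>\<omega>'. indicator (space M) \<omega>' * exp (- ((\<Sum>k\<in>UNIV. \<Sum>j<L k. w k j \<bullet> (R k (QQ k j) \<omega>' - R k (PP k j) \<omega>')) + v \<bullet> G \<omega>')) \<partial>M)"
        by (simp add: f_def inc_eq cong: Bochner_Integration.integral_cong)
      also have "\<dots> = indicator E \<omega> * exp (- ex \<omega>) * g2 v"
        using rep by (subst B.laplace_var[OF B.space_in_F]) (auto simp: rep_def v ex' A.prob_space)
      finally show "(\<integral>\<omega>'. f (\<omega>, \<omega>') \<partial>M) = indicator E \<omega> * exp (- ex \<omega>) * g2 v" .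
    qed
    \<comment> \<open>Grouped by type, the exponent is a test of the first step with weights
      \<open>\<kappa>v (u i l)\<close> and \<open>\<kappa>v v\<close>. Substituting exponents into
      exponents is thus the effect of composition.\<close>
    also have "\<dots> = (\<integral>\<omega>. indicator E \<omega> * exp (- ((\<Sum>i\<in>UNIV. \<Sum>l<K. \<kappa>v (u i l) \<bullet> (P i (q i l) \<omega> - P i (p i l) \<omega>)) + \<kappa>v v \<bullet> I \<omega>)) \<partial>M) * g2 v"
      by (simp add: ex_eq)
    also have "\<dots> = A.prob E * (exp (- (\<Sum>k\<in>UNIV. \<Sum>l<K. (q k l - p k l) * \<kappa>1 k (\<kappa>v (u k l)))) * (g1 (\<kappa>v v) * g2 v))"
      using E ord \<kappa>v u v by (subst A.laplace) (auto simp: mult.assoc)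
    finally show "(\<integral>\<omega>. indicator E \<omega> * exp (- ((\<Sum>k\<in>UNIV. \<Sum>l<K. u k l \<bullet> (R' k (q k l) \<omega> - R' k (p k l) \<omega>)) + v \<bullet> G' \<omega>)) \<partial>M)
      = A.prob E * (exp (- (\<Sum>k\<in>UNIV. \<Sum>l<K. (q k l - p k l) * \<kappa>1 k (\<kappa>v (u k l)))) * (g1 (\<kappa>v v) * g2 v))"
      by (simp add: f_eq cong: Bochner_Integration.integral_cong)
  qed
  then show ?thesis
    unfolding \<kappa>v_def by blast
qed

text \<open>The future of each step is the past of the next, so independence across generations
  follows by peeling off the latest step. The immigrations share a transform and hence a
  law.\<close>

lemma mtjbp_of_branching_steps:
  fixes B :: "nat \<Rightarrow> 'w \<Rightarrow> real ^ 'n"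
  assumes step: "\<And>n. branching_step M (Fl n) (Fl (Suc n)) \<kappa> g (B n) (B (Suc n)) (R n) (G n)"
  shows "\<exists>\<nu>. mtjbp M B \<kappa> \<nu> \<and> (\<forall>u\<ge>0. lst \<nu> u = g u)"
proof (intro exI conjI allI impI)
  interpret prob_space M
    using step unfolding branching_step_def by blast
  interpret S: branching_step M "Fl n" "Fl (Suc n)" \<kappa> g "B n" "B (Suc n)" "R n" "G n" for n
    by (rule step)
  \<comment> \<open>The ingredients of an MTJBP are numbered from \<open>1\<close>, the steps from
    \<open>0\<close>.\<close>
  define R' where "R' n = R (n - 1)" for n :: nat
  define G' where "G' n = G (n - 1)" for n :: nat
  define \<nu> where "\<nu> = distr M borel (G 0)"
  have ev: "mtjbp_events M R' G' (Suc n, k) = S.step_events n k" for n k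
    by (auto simp: mtjbp_events_def S.step_events_def R'_def G'_def split: option.split)
  have Fl_mono: "m \<le> n \<Longrightarrow> subalgebra (Fl n) (Fl m)" for m n
  proof (induction rule: dec_induct)
    case (step n)
    show ?case
      by (rule subalgebra_trans[OF S.subalg(2) step.IH])
  qed (simp add: subalgebra_def)
  have B_past: "sigma_of M {..n} B \<subseteq> sets (Fl n)" for n
  proof (rule sigma_of_space_subset[OF S.space_F])
    fix m assume "m \<in> {..n}"
    then show "B m \<in> borel_measurable (Fl n)"
      using Fl_mono[of m n] S.X_measurable by (auto intro: measurable_subalgebra)
  qed
  show "lst \<nu> u = g u" if "0 \<le> u" for u
  proof -
    have "lst \<nu> u = (\<integral>\<omega>. exp (- (u \<bullet> G 0 \<omega>)) \<partial>M)"
      unfolding lst_def \<nu>_def using S.G_measurable_M[of 0] by (intro integral_distr) auto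
    then show ?thesis
      by (simp add: S.laplace_immigration that)
  qed
  \<comment> \<open>Membership in \<open>Fl n\<close> is proved along with the product formula, so
    that the event of the first \<open>n\<close> steps can play the past event for the next one. The
    intersection with \<open>space M\<close> handles \<open>n = 0\<close>, where the empty
    intersection is \<open>UNIV\<close>.\<close>
  have past_events: "(\<Inter>m<n. \<Inter>k. A m k) \<inter> space M \<in> sets (Fl n) \<and>
      prob ((\<Inter>m<n. \<Inter>k. A m k) \<inter> space M) = (\<Prod>m<n. \<Prod>k\<in>UNIV. prob (A m k))"
    if A: "\<And>m k. A m k \<in> S.step_events m k" for A n
  proof (induction n)
    case 0
    then show ?case
      using S.space_in_F[of 0] by (simp add: prob_space)
  next
    case (Suc n)
    let ?C = "(\<Inter>m<n. \<Inter>k. A m k) \<inter> space M"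
    have eq: "(\<Inter>m<Suc n. \<Inter>k. A m k) \<inter> space M = ?C \<inter> (\<Inter>k. A n k)"
      by (auto simp: lessThan_Suc)
    have "A n k \<in> sets (Fl (Suc n))" for k
      using A S.step_events_subset_future by blast
    then have "(\<Inter>k. A n k) \<in> sets (Fl (Suc n))"
      by (intro sets.finite_INT) auto
    moreover have "?C \<in> sets (Fl (Suc n))"
      using Suc S.subalg(2)[of n] by (auto simp: subalgebra_def)
    moreover have "prob (?C \<inter> (\<Inter>k. A n k)) = prob ?C * (\<Prod>k\<in>UNIV. prob (A n k))"
      using Suc A by (intro S.step_prob[where n=n and A="?C" and E="A n"]) auto
    ultimately show ?case
      unfolding eq using Suc by (simp add: mult.commute)
  qed
  have ind: "indep_sets (mtjbp_events M R' G') ({1..} \<times> UNIV)"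
  proof (rule indep_setsI)
    show "mtjbp_events M R' G' z \<subseteq> sets M" if "z \<in> {1..} \<times> UNIV" for z
      using that S.step_events_subset by (cases z, cases "fst z") (auto simp: ev)
    fix A J assume J: "J \<noteq> {}" "J \<subseteq> {1..} \<times> UNIV" "finite J" and A: "\<forall>z\<in>J. A z \<in> mtjbp_events M R' G' z"
    \<comment> \<open>An arbitrary finite set of inputs is filled up with \<open>space M\<close> to
      a full rectangle of generations and inputs.\<close>
    define A' where "A' m k = (if (Suc m, k) \<in> J then A (Suc m, k) else space M)" for m k
    obtain N where N: "\<And>z. z \<in> J \<Longrightarrow> fst z \<le> N"
      using finite_nat_set_iff_bounded_le[of "fst ` J"] J(3) by auto
    have A': "A' m k \<in> S.step_events m k" for m k
      using A S.space_in_step_events by (auto simp: A'_def ev[symmetric] simp del: ev)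
    define f where "f z = (fst z - 1, snd z)" for z :: "nat \<times> 'n option"
    have inj: "inj_on f J"
    proof (rule inj_onI)
      fix x y assume xy: "x \<in> J" "y \<in> J" "f x = f y"
      then have "1 \<le> fst x" "1 \<le> fst y"
        using subsetD[OF J(2)] by (simp_all add: mem_Times_iff)
      then show "x = y"
        using xy(3) by (simp add: f_def prod_eq_iff) arith
    qed
    have fJ: "f ` J \<subseteq> {..<N} \<times> UNIV"
      using J(2) N by (force simp: f_def)
    have Af: "A' (fst (f z)) (snd (f z)) = A z" if "z \<in> J" for z
      using that J(2) by (cases z) (auto simp: A'_def f_def)
    have Asp: "A z \<subseteq> space M" if "z \<in> J" for z
    proof -
      have "A' (fst (f z)) (snd (f z)) \<subseteq> space M"
        using A' S.step_events_subset sets.sets_into_space by blast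
      then show ?thesis
        using Af[OF that] by simp
    qed
    have out: "A' (fst y) (snd y) = space M" if "y \<notin> f ` J" for y
    proof -
      have "f (Suc (fst y), snd y) = y"
        by (simp add: f_def)
      then show ?thesis
        using that by (metis A'_def image_eqI)
    qed
    have "(\<Inter>z\<in>J. A z) = (\<Inter>m<N. \<Inter>k. A' m k) \<inter> space M"
    proof (intro equalityI subsetI)
      fix x assume x: "x \<in> (\<Inter>z\<in>J. A z)"
      have xs: "x \<in> space M"
        using x J(1) Asp by blast
      have "x \<in> A' m k" for m k
        using x xs by (auto simp: A'_def)
      with xs show "x \<in> (\<Inter>m<N. \<Inter>k. A' m k) \<inter> space M"
        by auto
    next
      fix x assume x: "x \<in> (\<Inter>m<N. \<Inter>k. A' m k) \<inter> space M"
      have "x \<in> A z" if "z \<in> J" for z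
      proof -
        have "fst (f z) < N"
          using fJ that by (auto simp: image_subset_iff mem_Times_iff)
        then have "x \<in> A' (fst (f z)) (snd (f z))"
          using x by auto
        then show ?thesis
          using Af[OF that] by simp
      qed
      then show "x \<in> (\<Inter>z\<in>J. A z)"
        by auto
    qed
    moreover have "(\<Prod>m<N. \<Prod>k\<in>UNIV. prob (A' m k)) = (\<Prod>z\<in>J. prob (A z))"
    proof -
      have "(\<Prod>m<N. \<Prod>k\<in>UNIV. prob (A' m k)) = (\<Prod>y\<in>{..<N} \<times> UNIV. prob (A' (fst y) (snd y)))"
        by (simp add: prod.cartesian_product case_prod_beta)
      also have "\<dots> = (\<Prod>y\<in>f ` J. prob (A' (fst y) (snd y)))"
        using fJ out by (intro prod.mono_neutral_right) (auto simp: prob_space)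
      also have "\<dots> = (\<Prod>z\<in>J. prob (A z))"
        using Af by (simp add: prod.reindex[OF inj])
      finally show ?thesis .
    qed
    ultimately show "prob (\<Inter>z\<in>J. A z) = (\<Prod>z\<in>J. prob (A z))"
      using past_events[of A' N, OF A'] by simp
  qed
  show "mtjbp M B \<kappa> \<nu>"
    unfolding mtjbp_def
  proof (intro conjI prob_space_axioms allI ballI exI[of _ R'] exI[of _ G'] impI ind)
    show "B n \<in> borel_measurable M" for n
      using S.subalg_past S.X_measurable by (rule measurable_subalgebra)
    show "0 \<le> B n \<omega>" if "\<omega> \<in> space M" for n \<omega>
      using that by (rule S.X_nonneg)
    show "levy_subordinator M (R' n i)" "has_laplace_exponent M (R' n i) (\<kappa> i)" for n i
      unfolding R'_def by (rule S.levy_subordinator_R S.has_laplace_exponent_R)+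
    show "G' n \<in> borel_measurable M" "\<omega> \<in> space M \<Longrightarrow> 0 \<le> G' n \<omega>" for n \<omega>
      unfolding G'_def by (rule S.G_measurable_M, rule S.G_nonneg)
    show "distr M borel (G' n) = \<nu>" for n
      unfolding G'_def \<nu>_def
      by (rule distr_eq_of_laplace_eq) (auto simp: S.G_measurable_M S.G_nonneg S.laplace_immigration)
    show "indep_set (sigma_of M {..n} B) (sigma_sets (space M) (\<Union>k. mtjbp_events M R' G' (Suc n, k)))" for n
      using S.indep_step_algebra[of n] B_past[of n] unfolding indep_sets2_eq ev S.sets_step_algebra by blast
    show "B (Suc n) \<omega> = (\<Sum>i\<in>UNIV. R' (Suc n) i (B n \<omega> $ i) \<omega>) + G' (Suc n) \<omega>" if "\<omega> \<in> space M" for n \<omega>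
      using S.Y_eq[OF that, of n] by (simp add: R'_def G'_def)
  qed
qed

section \<open>Levy subordinators\<close>

lemma increasing_path_levy_subordinator:
  "levy_subordinator M X \<Longrightarrow> \<omega> \<in> space M \<Longrightarrow> increasing_path (\<lambda>t. X t \<omega>)"
  by (auto simp: levy_subordinator_def levy_process_def increasing_path_def intro: right_cont_cadlag)

lemma levy_subordinator_measurable:
  "levy_subordinator M X \<Longrightarrow> 0 \<le> t \<Longrightarrow> X t \<in> borel_measurable M"
  by (simp add: levy_subordinator_def levy_process_def)

lemma increasing_path_scaleR_axis: "increasing_path (\<lambda>s. s *\<^sub>R axis k 1)"
  unfolding increasing_path_def right_cont_def
  by (auto simp: less_eq_vec_def axis_def intro!: continuous_intros)

context prob_space begin

lemma levy_subordinator_laplace_increment: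
  assumes X: "levy_subordinator M X" and \<kappa>: "has_laplace_exponent M X \<kappa>"
    and st: "0 \<le> s" "s \<le> t" and u: "0 \<le> u"
  shows "(\<integral>\<omega>. exp (- (u \<bullet> (X t \<omega> - X s \<omega>))) \<partial>M) = exp (- ((t - s) * \<kappa> u))"
proof -
  have [measurable]: "X t \<in> borel_measurable M" "X s \<in> borel_measurable M"
    using X st by (auto intro!: levy_subordinator_measurable)
  have "distr M borel (\<lambda>\<omega>. X (s + (t - s)) \<omega> - X s \<omega>) = distr M borel (X (t - s))"
    using X st unfolding levy_subordinator_def levy_process_def by (metis diff_ge_0_iff_ge)
  moreover have "(\<integral>\<omega>. exp (- (u \<bullet> (X t \<omega> - X s \<omega>))) \<partial>M) = lst (distr M borel (\<lambda>\<omega>. X t \<omega> - X s \<omega>)) u"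
    unfolding lst_def by (rule integral_distr[symmetric]) auto
  moreover have "lst (distr M borel (X (t - s))) u = exp (- ((t - s) * \<kappa> u))"
    using \<kappa> u st unfolding has_laplace_exponent_def mult_minus_left by simp
  ultimately show ?thesis
    by simp
qed

text \<open>Independence of increments is given along a monotone sequence of times. The interval
  endpoints are interleaved, left ends at even and right ends at odd positions; the gaps appear as
  odd increments and get weight \<open>0\<close>.\<close>

lemma levy_subordinator_laplace_intervals:
  assumes X: "levy_subordinator M X" and \<kappa>: "has_laplace_exponent M X \<kappa>"
    and pq: "ordered_intervals p q" and u: "\<And>l. 0 \<le> u l"
  shows "(\<integral>\<omega>. exp (- (\<Sum>l<K. u l \<bullet> (X (q l) \<omega> - X (p l) \<omega>))) \<partial>M) = exp (- (\<Sum>l<K. (q l - p l) * \<kappa> (u l)))"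
proof -
  define \<theta> where "\<theta> j = (if even j then p (j div 2) else q (j div 2))" for j
  define w where "w j = (if even j then u (j div 2) else 0)" for j
  define D where "D j \<omega> = X (\<theta> (Suc j)) \<omega> - X (\<theta> j) \<omega>" for j \<omega>
  have "\<theta> j \<le> \<theta> (Suc j)" for j
    using pq by (auto simp: \<theta>_def ordered_intervals_def elim!: evenE oddE)
  then have mono: "mono \<theta>"
    by (rule mono_iff_le_Suc[THEN iffD2, rule_format])
  have \<theta>0: "0 \<le> \<theta> j" for j
    using ordered_intervals_nonneg[OF pq] by (simp add: \<theta>_def)
  have le: "\<theta> j \<le> \<theta> (Suc j)" for j
    using mono by (simp add: mono_def)
  have [measurable]: "D j \<in> borel_measurable M" for j
    unfolding D_def by (intro borel_measurable_diff levy_subordinator_measurable[OF X] \<theta>0)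
  have D0: "0 \<le> D j \<omega>" if "\<omega> \<in> space M" for j \<omega>
    using increasing_path_mono[OF increasing_path_levy_subordinator[OF X that] \<theta>0 le] by (simp add: D_def)
  have w: "0 \<le> w j" for j
    by (simp add: w_def u)
  have "indep_vars (\<lambda>_. borel) D {..<2 * K}"
    using X \<theta>0[of 0] mono unfolding levy_subordinator_def levy_process_def D_def by blast
  then have ind: "indep_vars (\<lambda>_. borel) (\<lambda>j \<omega>. exp (- (w j \<bullet> D j \<omega>))) {..<2 * K}"
    by (rule indep_vars_compose2[where Y="\<lambda>j x. exp (- (w j \<bullet> x))"]) measurable
  have two: "(\<Prod>j<2 * K. f j) = (\<Prod>l<K. f (2 * l) * f (Suc (2 * l)))" for f :: "nat \<Rightarrow> real"
    by (induction K) (auto simp: mult.assoc)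
  have even: "w (2 * l) = u l" "w (Suc (2 * l)) = 0" "D (2 * l) \<omega> = X (q l) \<omega> - X (p l) \<omega>" for l \<omega>
    by (auto simp: w_def D_def \<theta>_def)
  have "(\<integral>\<omega>. exp (- (\<Sum>l<K. u l \<bullet> (X (q l) \<omega> - X (p l) \<omega>))) \<partial>M)
      = (\<integral>\<omega>. (\<Prod>j<2 * K. exp (- (w j \<bullet> D j \<omega>))) \<partial>M)"
    unfolding two by (simp add: even exp_sum flip: sum_negf)
  also have "\<dots> = (\<Prod>j<2 * K. \<integral>\<omega>. exp (- (w j \<bullet> D j \<omega>)) \<partial>M)"
  proof (rule indep_vars_lebesgue_integral[OF _ ind])
    show "integrable M (\<lambda>\<omega>. exp (- (w j \<bullet> D j \<omega>)))" for j
      using D0 w by (intro integrable_const_bound[of _ 1]) (auto simp: inner_nonneg_vec)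
  qed simp
  also have "\<dots> = (\<Prod>l<K. exp (- ((q l - p l) * \<kappa> (u l))))"
  proof -
    have "0 \<le> p l" "p l \<le> q l" for l
      using pq ordered_intervals_nonneg[OF pq] by (auto simp: ordered_intervals_def)
    then show ?thesis
      unfolding two by (simp add: even prob_space levy_subordinator_laplace_increment[OF X \<kappa>] u)
  qed
  also have "\<dots> = exp (- (\<Sum>l<K. (q l - p l) * \<kappa> (u l)))"
    by (simp add: exp_sum flip: sum_negf)
  finally show ?thesis .
qed

lemma integral_mult_indep:
  fixes f g :: "'a \<Rightarrow> real"
  assumes F: "subalgebra M F" and Q: "subalgebra M Q" and ind: "indep_set (sets F) (sets Q)"
    and f: "f \<in> borel_measurable F" "\<And>\<omega>. \<omega> \<in> space M \<Longrightarrow> \<bar>f \<omega>\<bar> \<le> 1"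
    and g: "g \<in> borel_measurable Q" "\<And>\<omega>. \<omega> \<in> space M \<Longrightarrow> \<bar>g \<omega>\<bar> \<le> 1"
  shows "(\<integral>\<omega>. f \<omega> * g \<omega> \<partial>M) = (\<integral>\<omega>. f \<omega> \<partial>M) * (\<integral>\<omega>. g \<omega> \<partial>M)"
proof -
  have "(\<integral>\<omega>. (\<lambda>z. f (fst z) * g (snd z)) (\<omega>, \<omega>) \<partial>M)
      = (\<integral>x. (\<integral>y. (\<lambda>z. f (fst z) * g (snd z)) (x, y) \<partial>M) \<partial>M)"
    using f g by (intro integral_decouple[OF F Q ind, of _ 1]) (auto simp: abs_mult intro!: mult_le_one)
  then show ?thesis
    by simp
qed

end

section \<open>The polling system\<close>

context levy_polling_system begin

section \<open>Sigma-algebras of the sources of randomness\<close>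

definition source_events :: "'n source \<Rightarrow> 'w set set" where
  "source_events x = (case x of
      Initial \<Rightarrow> sigma_of_var M (V 0)
    | Visit n i \<Rightarrow> sigma_of M {0..} (\<lambda>t \<omega>. (A n i t \<omega>, H n i t \<omega>))
    | Duration n i \<Rightarrow> sigma_of_var M (S n i)
    | Input n i \<Rightarrow> sigma_of M {0..} (W n i))"

text \<open>With a set of sources as parameter, independence reduces to disjointness and inclusion
  of sigma-algebras to inclusion of index sets.\<close>

definition source_algebra :: "'n source set \<Rightarrow> 'w measure" where
  "source_algebra J = sigma (space M) (\<Union>x\<in>J. source_events x)"

lemma indep_source_events: "indep_sets source_events UNIV"
  using independence unfolding source_events_def .

lemma source_events_subset: "source_events x \<subseteq> sets M"
  using indep_source_events by (simp add: indep_sets_def)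

lemma source_events_Int_stable: "Int_stable (source_events x)"
  by (auto simp: source_events_def Int_stable_sigma_of split: source.split)

lemma sets_source_algebra: "sets (source_algebra J) = sigma_sets (space M) (\<Union>x\<in>J. source_events x)"
  unfolding source_algebra_def using source_events_subset sets.sets_into_space
  by (intro sets_measure_of) blast

lemma space_source_algebra: "space (source_algebra J) = space M"
  unfolding source_algebra_def using source_events_subset sets.sets_into_space
  by (intro space_measure_of) blast

lemma subalg_source_algebra: "subalgebra M (source_algebra J)"
  using sets.sigma_sets_subset[of "\<Union>x\<in>J. source_events x" M] source_events_subset
  by (auto simp: subalgebra_def sets_source_algebra space_source_algebra)

lemma source_algebra_mono: "J \<subseteq> K \<Longrightarrow> subalgebra (source_algebra K) (source_algebra J)"
  unfolding subalgebra_def space_source_algebra sets_source_algebra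
  by (auto intro!: sigma_sets_mono' )

lemma indep_source_algebra:
  assumes "J \<inter> K = {}"
  shows "indep_set (sets (source_algebra J)) (sets (source_algebra K))"
proof -
  have "indep_sets (\<lambda>b. sigma_sets (space M) (\<Union>x\<in>(if b then J else K). source_events x)) UNIV"
  proof (rule indep_sets_collect_sigma)
    show "indep_sets source_events (\<Union>b. if b then J else K)"
      using indep_source_events by (rule indep_sets_mono_index[rotated]) simp
    show "disjoint_family (\<lambda>b. if b then J else K)"
      using assms by (auto simp: disjoint_family_on_def)
  qed (rule source_events_Int_stable)
  then show ?thesis
    unfolding indep_set_def
    by (rule indep_sets_mono_sets) (auto simp: sets_source_algebra split: bool.split)
qed

lemma measurable_source_algebra:
  fixes f :: "'w \<Rightarrow> 'z::topological_space"
  assumes "x \<in> J" "\<And>B. B \<in> sets borel \<Longrightarrow> f -` B \<inter> space M \<in> source_events x"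
  shows "f \<in> borel_measurable (source_algebra J)"
proof (rule measurableI)
  fix B :: "'z set" assume "B \<in> sets borel"
  then show "f -` B \<inter> space (source_algebra J) \<in> sets (source_algebra J)"
    using assms unfolding sets_source_algebra space_source_algebra by blast
qed simp

lemma initial_measurable_source: "Initial \<in> J \<Longrightarrow> V 0 \<in> borel_measurable (source_algebra J)"
  by (erule measurable_source_algebra) (auto simp: source_events_def sigma_of_def)

lemma duration_measurable_source: "Duration n i \<in> J \<Longrightarrow> S n i \<in> borel_measurable (source_algebra J)"
  by (erule measurable_source_algebra) (auto simp: source_events_def sigma_of_def)

lemma input_measurable_source:
  "Input n i \<in> J \<Longrightarrow> 0 \<le> t \<Longrightarrow> W n i t \<in> borel_measurable (source_algebra J)"
  by (erule measurable_source_algebra) (auto simp: source_events_def sigma_of_def)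

lemma replacement_measurable_source:
  assumes "Visit n i \<in> J" "0 \<le> t"
  shows "H n i t \<in> borel_measurable (source_algebra J)"
proof (rule measurable_source_algebra[OF assms(1)])
  fix B :: "(real, 'n) vec set" assume "B \<in> sets borel"
  then have "snd -` B \<inter> space borel \<in> sets (borel :: ((real, 'n) vec \<times> (real, 'n) vec) measure)"
    by (rule measurable_sets[rotated]) (intro borel_measurable_continuous_onI continuous_on_snd continuous_on_id)
  moreover have "H n i t -` B \<inter> space M = (\<lambda>\<omega>. (A n i t \<omega>, H n i t \<omega>)) -` (snd -` B) \<inter> space M"
    by auto
  ultimately show "H n i t -` B \<inter> space M \<in> source_events (Visit n i)"
    unfolding source_events_def sigma_of_def source.case
    using assms(2) by (intro sigma_sets.Basic) auto
qed

section \<open>Sources used before a visit, in the lexicographic order of cycle and queue\<close>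

definition past :: "nat \<Rightarrow> 'n \<Rightarrow> 'n source set" where
  "past n i = {x. case x of
      Initial \<Rightarrow> True
    | Visit m j \<Rightarrow> m < n \<or> m = n \<and> j < i
    | Duration m j \<Rightarrow> m < n \<or> m = n \<and> j < i
    | Input m j \<Rightarrow> m < n \<or> m = n \<and> j < i}"

definition next_past :: "nat \<Rightarrow> 'n \<Rightarrow> 'n source set" where
  "next_past n i = past n i \<union> {Visit n i, Duration n i, Input n i}"

lemma next_past_Max:
  assumes "i = Max UNIV"
  shows "next_past n i = past (Suc n) (Min UNIV)"
proof -
  have "j \<le> i" "\<not> j < Min UNIV" for j
    using assms Max_ge[of UNIV j] Min_le[of UNIV j] by (auto simp: not_less simp del: Max_ge)
  then have *: "m < Suc n \<or> m = Suc n \<and> j < Min UNIV \<longleftrightarrow> (m < n \<or> m = n \<and> j < i) \<or> m = n \<and> j = i" for m j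
    by (metis less_Suc_eq order.order_iff_strict)
  show ?thesis
  proof (rule set_eqI)
    show "x \<in> next_past n i \<longleftrightarrow> x \<in> past (Suc n) (Min UNIV)" for x
      unfolding next_past_def past_def by (cases x) (auto simp: * simp del: Min_gr_iff)
  qed
qed

lemma less_Min_greater:
  fixes i j :: 'n
  assumes "i \<noteq> Max UNIV"
  shows "j < Min {i<..} \<longleftrightarrow> j \<le> i"
proof -
  have "i < Max UNIV"
    using assms by (simp add: order.not_eq_order_implies_strict)
  then have "{i<..} \<noteq> {}"
    by auto
  then have "j < Min {i<..} \<longleftrightarrow> (\<forall>k\<in>{i<..}. j < k)"
    by (intro Min_gr_iff) auto
  also have "\<dots> \<longleftrightarrow> j \<le> i"
    by (metis greaterThan_iff le_less_trans less_irrefl not_le)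
  finally show ?thesis .
qed

lemma next_past_less:
  assumes "i \<noteq> Max UNIV"
  shows "next_past n i = past n (Min {i<..})"
  by (auto simp: next_past_def past_def less_Min_greater[OF assms] order.order_iff_strict split: source.splits)

text \<open>Fluid in a queue that is not being visited is carried over unchanged: it follows the
  deterministic subordinator \<open>s *\<^sub>R axis k 1\<close>, whose exponent is
  \<open>u $ k\<close>. The immigration is the input during the switch-over period.\<close>

lemma branching_step_visit:
  assumes Xm: "(\<lambda>\<omega>. V (\<tau> n i \<omega>) \<omega>) \<in> borel_measurable (source_algebra (past n i))"
    and X0: "\<And>\<omega>. \<omega> \<in> space M \<Longrightarrow> 0 \<le> V (\<tau> n i \<omega>) \<omega>"
  shows "branching_step M (source_algebra (past n i)) (source_algebra (next_past n i))
    (\<lambda>k u. if k = i then \<eta> i u else u $ k) (\<lambda>v. lst (switch_law i) (\<phi> v))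
    (\<lambda>\<omega>. V (\<tau> n i \<omega>) \<omega>) (\<lambda>\<omega>. V (next_arrival \<tau> n i \<omega>) \<omega>)
    (\<lambda>k s \<omega>. if k = i then H n i s \<omega> else s *\<^sub>R axis k 1) (\<lambda>\<omega>. W n i (S n i \<omega>) \<omega>)"
proof
  let ?R = "\<lambda>k s \<omega>. if k = i then H n i s \<omega> else s *\<^sub>R axis k 1"
  let ?G = "\<lambda>\<omega>. W n i (S n i \<omega>) \<omega>"
  have S0: "0 \<le> S n i \<omega>" if "\<omega> \<in> space M" for \<omega>
    using switch_positive[OF that] by (rule less_imp_le)
  have Hpath: "increasing_path (\<lambda>t. H n i t \<omega>)" and Wpath: "increasing_path (\<lambda>t. W n i t \<omega>)" if "\<omega> \<in> space M" for \<omega>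
    by (rule increasing_path_levy_subordinator[OF replacement_subordinator that],
        rule increasing_path_levy_subordinator[OF input_subordinator that])
  have Gm: "?G \<in> borel_measurable (source_algebra J)" if "Duration n i \<in> J" "Input n i \<in> J" for J
    by (rule measurable_at_random_time[where X="W n i" and T="S n i"])
       (use that S0 Wpath in \<open>auto simp: space_source_algebra intro: input_measurable_source duration_measurable_source increasing_path_right_cont\<close>)
  have G0: "0 \<le> ?G \<omega>" if "\<omega> \<in> space M" for \<omega>
    using Wpath[OF that] S0[OF that] by (rule increasing_path_nonneg)
  show "0 \<le> ?G \<omega>" if "\<omega> \<in> space M" for \<omega>
    using that by (rule G0)
  show "subalgebra M (source_algebra (next_past n i))"
    by (rule subalg_source_algebra)
  show "subalgebra (source_algebra (next_past n i)) (source_algebra (past n i))"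
    by (rule source_algebra_mono) (auto simp: next_past_def)
  show "?R k s \<in> borel_measurable (source_algebra (next_past n i))" if "0 \<le> s" for k s
    using that replacement_measurable_source[of n i "next_past n i" s] by (cases "k = i") (simp_all add: next_past_def)
  show "?G \<in> borel_measurable (source_algebra (next_past n i))"
    by (rule Gm) (auto simp: next_past_def)
  show "increasing_path (\<lambda>s. ?R k s \<omega>)" if "\<omega> \<in> space M" for k \<omega>
    using Hpath[OF that] increasing_path_scaleR_axis by (cases "k = i") simp_all
  show "V (next_arrival \<tau> n i \<omega>) \<omega> = (\<Sum>k\<in>UNIV. ?R k (V (\<tau> n i \<omega>) \<omega> $ k) \<omega>) + ?G \<omega>" if \<omega>: "\<omega> \<in> space M" for \<omega>
  proof -
    let ?x = "V (\<tau> n i \<omega>) \<omega>"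
    have "?x = (\<Sum>k\<in>UNIV. (?x $ k) *\<^sub>R axis k 1)"
      by (subst basis_expansion[symmetric]) (simp add: scalar_mult_eq_scaleR)
    also have "\<dots> = (?x $ i) *\<^sub>R axis i 1 + (\<Sum>k\<in>UNIV - {i}. (?x $ k) *\<^sub>R axis k 1)"
      by (rule sum.remove) auto
    finally have x: "?x - (?x $ i) *\<^sub>R axis i 1 = (\<Sum>k\<in>UNIV - {i}. (?x $ k) *\<^sub>R axis k 1)"
      by (simp add: algebra_simps)
    have "(\<Sum>k\<in>UNIV. ?R k (?x $ k) \<omega>) = H n i (?x $ i) \<omega> + (\<Sum>k\<in>UNIV - {i}. ?R k (?x $ k) \<omega>)"
      by (subst sum.remove[of _ i]) auto
    also have "(\<Sum>k\<in>UNIV - {i}. ?R k (?x $ k) \<omega>) = (\<Sum>k\<in>UNIV - {i}. (?x $ k) *\<^sub>R axis k 1)"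
      by (intro sum.cong) auto
    finally have "(\<Sum>k\<in>UNIV. ?R k (?x $ k) \<omega>) = V (\<sigma> n i \<omega>) \<omega>"
      using branching_property[OF \<omega>, of n i] x by simp
    then show ?thesis
      using workload_switch[OF \<omega> S0[OF \<omega>], of n i] switch_length[OF \<omega>, of n i] by simp
  qed
  fix E v and K :: nat and p q :: "'n \<Rightarrow> nat \<Rightarrow> real" and u :: "'n \<Rightarrow> nat \<Rightarrow> (real, 'n) vec"
  assume E: "E \<in> sets (source_algebra (past n i))" and pq: "\<And>k. ordered_intervals (p k) (q k)"
    and u: "\<And>k l. 0 \<le> u k l" and v: "0 \<le> (v :: (real, 'n) vec)"
  \<comment> \<open>The deterministic contribution of the other queues; its exponential is a
    constant factor on both sides.\<close>
  define c where "c = (\<Sum>k\<in>UNIV - {i}. \<Sum>l<K. (q k l - p k l) * u k l $ k)"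
  define h where "h \<omega> = (\<Sum>l<K. u i l \<bullet> (H n i (q i l) \<omega> - H n i (p i l) \<omega>))" for \<omega>
  have pq': "0 \<le> p i l" "p i l \<le> q i l" "0 \<le> q i l" for l
    using pq[of i] ordered_intervals_nonneg[OF pq[of i]] by (auto simp: ordered_intervals_def)
  have hm: "h \<in> borel_measurable (source_algebra J)" if "Visit n i \<in> J" for J
    unfolding h_def using that pq'
    by (intro borel_measurable_sum borel_measurable_inner borel_measurable_diff borel_measurable_const
        replacement_measurable_source)
  have h0: "0 \<le> h \<omega>" if "\<omega> \<in> space M" for \<omega>
    unfolding h_def using u pq' increasing_path_mono[OF Hpath[OF that]]
    by (intro sum_nonneg inner_nonneg_vec) auto
  have split: "(\<Sum>k\<in>UNIV. f k) = f i + (\<Sum>k\<in>UNIV - {i}. f k)" for f :: "'n \<Rightarrow> real"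
    by (rule sum.remove) auto
  have lhs: "(\<Sum>k\<in>UNIV. \<Sum>l<K. u k l \<bullet> (?R k (q k l) \<omega> - ?R k (p k l) \<omega>)) = h \<omega> + c" for \<omega>
  proof -
    have "(\<Sum>k\<in>UNIV - {i}. \<Sum>l<K. u k l \<bullet> (?R k (q k l) \<omega> - ?R k (p k l) \<omega>)) = c"
      unfolding c_def
      by (intro sum.cong refl) (auto simp: inner_axis mult.commute simp flip: scaleR_left_diff_distrib)
    then show ?thesis
      by (simp add: split h_def)
  qed
  have rhs: "(\<Sum>k\<in>UNIV. \<Sum>l<K. (q k l - p k l) * (if k = i then \<eta> i (u k l) else u k l $ k))
      = (\<Sum>l<K. (q i l - p i l) * \<eta> i (u i l)) + c"
  proof -
    have "(\<Sum>k\<in>UNIV - {i}. \<Sum>l<K. (q k l - p k l) * (if k = i then \<eta> i (u k l) else u k l $ k)) = c"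
      unfolding c_def by (intro sum.cong refl) auto
    then show ?thesis
      by (simp add: split)
  qed
  \<comment> \<open>Three separations, used in turn: the past from the new sources, the replacement
    from the switch-over, and within the latter the duration from the input.\<close>
  have ind1: "indep_set (sets (source_algebra (past n i))) (sets (source_algebra {Visit n i, Duration n i, Input n i}))"
    by (rule indep_source_algebra) (auto simp: past_def)
  have ind2: "indep_set (sets (source_algebra {Visit n i})) (sets (source_algebra {Duration n i, Input n i}))"
    by (rule indep_source_algebra) auto
  have ind3: "indep_set (sets (source_algebra {Duration n i})) (sets (source_algebra {Input n i}))"
    by (rule indep_source_algebra) auto
  have vG: "0 \<le> v \<bullet> ?G \<omega>" if "\<omega> \<in> space M" for \<omega>
    using v G0[OF that] by (rule inner_nonneg_vec)
  have EM: "E \<in> sets M"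
    using E subalg_source_algebra by (auto simp: subalgebra_def)
  have "(\<integral>\<omega>. indicator E \<omega> * exp (- ((\<Sum>k\<in>UNIV. \<Sum>l<K. u k l \<bullet> (?R k (q k l) \<omega> - ?R k (p k l) \<omega>)) + v \<bullet> ?G \<omega>)) \<partial>M)
      = (\<integral>\<omega>. indicator E \<omega> * (exp (- h \<omega>) * exp (- (v \<bullet> ?G \<omega>))) * exp (- c) \<partial>M)"
    unfolding lhs by (simp add: mult_exp_exp algebra_simps)
  also have "\<dots> = (\<integral>\<omega>. indicator E \<omega> * (exp (- h \<omega>) * exp (- (v \<bullet> ?G \<omega>))) \<partial>M) * exp (- c)"
    by simp
  also have "(\<integral>\<omega>. indicator E \<omega> * (exp (- h \<omega>) * exp (- (v \<bullet> ?G \<omega>))) \<partial>M)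
      = (\<integral>\<omega>. indicator E \<omega> \<partial>M) * (\<integral>\<omega>. exp (- h \<omega>) * exp (- (v \<bullet> ?G \<omega>)) \<partial>M)"
    using E h0 vG hm[of "{Visit n i, Duration n i, Input n i}"] Gm[of "{Visit n i, Duration n i, Input n i}"]
    by (intro integral_mult_indep[OF subalg_source_algebra subalg_source_algebra ind1])
       (auto intro!: mult_le_one simp: indicator_def[of E])
  also have "(\<integral>\<omega>. exp (- h \<omega>) * exp (- (v \<bullet> ?G \<omega>)) \<partial>M)
      = (\<integral>\<omega>. exp (- h \<omega>) \<partial>M) * (\<integral>\<omega>. exp (- (v \<bullet> ?G \<omega>)) \<partial>M)"
    using h0 vG hm[of "{Visit n i}"] Gm[of "{Duration n i, Input n i}"]
    by (intro integral_mult_indep[OF subalg_source_algebra subalg_source_algebra ind2]) auto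
  also have "(\<integral>\<omega>. exp (- h \<omega>) \<partial>M) = exp (- (\<Sum>l<K. (q i l - p i l) * \<eta> i (u i l)))"
    unfolding h_def by (rule levy_subordinator_laplace_intervals[OF replacement_subordinator replacement_exponent pq u])
  \<comment> \<open>With the duration frozen at \<open>s\<close>, the input has transform
    \<open>exp (- s * \<phi> v)\<close>; integrating over the duration evaluates the transform of
    its law at \<open>\<phi> v\<close>.\<close>
  also have "(\<integral>\<omega>. exp (- (v \<bullet> ?G \<omega>)) \<partial>M) = lst (switch_law i) (\<phi> v)"
  proof -
    let ?N = "source_algebra {Duration n i} \<Otimes>\<^sub>M source_algebra {Input n i}"
    have "(\<integral>\<omega>. (\<lambda>z. exp (- (v \<bullet> W n i (S n i (fst z)) (snd z)))) (\<omega>, \<omega>) \<partial>M)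
      = (\<integral>\<omega>. (\<integral>\<omega>'. (\<lambda>z. exp (- (v \<bullet> W n i (S n i (fst z)) (snd z)))) (\<omega>, \<omega>') \<partial>M) \<partial>M)"
    proof (rule integral_decouple[OF subalg_source_algebra subalg_source_algebra ind3])
      have Wm: "(\<lambda>z. W n i s (snd z)) \<in> borel_measurable ?N" if "0 \<le> s" for s
        using input_measurable_source[of n i "{Input n i}", OF _ that] by measurable
      have Sm: "(\<lambda>z. S n i (fst z)) \<in> borel_measurable ?N"
        using duration_measurable_source[of n i "{Duration n i}"] by measurable
      have "(\<lambda>z. W n i (S n i (fst z)) (snd z)) \<in> borel_measurable ?N"
        by (rule measurable_at_random_time[where X="\<lambda>s z. W n i s (snd z)" and T="\<lambda>z. S n i (fst z)"])
           (auto simp: Wm Sm space_pair_measure space_source_algebra S0 intro: increasing_path_right_cont[OF Wpath])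
      then show "(\<lambda>z. exp (- (v \<bullet> W n i (S n i (fst z)) (snd z)))) \<in> borel_measurable ?N"
        by measurable
      show "\<bar>exp (- (v \<bullet> W n i (S n i (fst (x, y))) (snd (x, y))))\<bar> \<le> 1" if "x \<in> space M" "y \<in> space M" for x y
        using increasing_path_nonneg[OF Wpath[OF that(2)] S0[OF that(1)]] v by (simp add: inner_nonneg_vec)
    qed
    also have "\<dots> = (\<integral>\<omega>. exp (- (\<phi> v \<bullet> S n i \<omega>)) \<partial>M)"
    proof (rule Bochner_Integration.integral_cong[OF refl])
      fix \<omega> assume \<omega>: "\<omega> \<in> space M"
      have "W n i 0 \<omega>' = 0" if "\<omega>' \<in> space M" for \<omega>'
        using Wpath[OF that] by (simp add: increasing_path_def)
      then show "(\<integral>\<omega>'. (\<lambda>z. exp (- (v \<bullet> W n i (S n i (fst z)) (snd z)))) (\<omega>, \<omega>') \<partial>M) = exp (- (\<phi> v \<bullet> S n i \<omega>))"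
        using levy_subordinator_laplace_increment[OF input_subordinator input_exponent order_refl S0[OF \<omega>] v, of n i]
        by (simp add: mult.commute cong: Bochner_Integration.integral_cong)
    qed
    also have "\<dots> = lst (switch_law i) (\<phi> v)"
      unfolding lst_def switch_distr[of n i, symmetric] using switch_measurable[of n i]
      by (intro integral_distr[symmetric]) auto
    finally show ?thesis
      by simp
  qed
  also have "(\<integral>\<omega>. indicator E \<omega> \<partial>M) = prob E"
    using EM by simp
  finally show "(\<integral>\<omega>. indicator E \<omega> * exp (- ((\<Sum>k\<in>UNIV. \<Sum>l<K. u k l \<bullet> (?R k (q k l) \<omega> - ?R k (p k l) \<omega>)) + v \<bullet> ?G \<omega>)) \<partial>M)
      = prob E * (exp (- (\<Sum>k\<in>UNIV. \<Sum>l<K. (q k l - p k l) * (if k = i then \<eta> i (u k l) else u k l $ k))) * lst (switch_law i) (\<phi> v))"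
    unfolding rhs by (simp add: mult_exp_exp algebra_simps)
qed (use Xm X0 in auto)

text \<open>The transform variable as seen just before queue \<open>i + 1\<close> is reached: fluid
  in queues up to \<open>i\<close> waits for the end of the cycle and keeps \<open>u $ k\<close>,
  whereas fluid in a later queue is still to be served and carries its exponent for the remaining
  cycle.\<close>

definition after_queue :: "'n \<Rightarrow> (real, 'n) vec \<Rightarrow> (real, 'n) vec" where
  "after_queue i u = (\<chi> k. if k \<le> i then u $ k else branching_mechanism \<eta> k u)"

lemma branching_mechanism_after_queue: "branching_mechanism \<eta> i u = \<eta> i (after_queue i u)"
  unfolding after_queue_def by (rule branching_mechanism.simps)

text \<open>The rest of the cycle, seen from the arrival at queue \<open>i\<close>, is the visit to
  \<open>i\<close> followed by the rest seen from its successor. Queues before \<open>i\<close> are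
  not visited again in this cycle, which is why their exponents are coordinates. The induction runs
  on the number of later queues.\<close>

lemma branching_step_from_queue:
  assumes "(\<lambda>\<omega>. V (\<tau> n i \<omega>) \<omega>) \<in> borel_measurable (source_algebra (past n i))"
    and "\<And>\<omega>. \<omega> \<in> space M \<Longrightarrow> 0 \<le> V (\<tau> n i \<omega>) \<omega>"
  shows "\<exists>R G. branching_step M (source_algebra (past n i)) (source_algebra (past (Suc n) (Min UNIV)))
    (\<lambda>k u. if k < i then u $ k else branching_mechanism \<eta> k u)
    (\<lambda>v. \<Prod>j\<in>{i..}. lst (switch_law j) (\<phi> (after_queue j v)))
    (\<lambda>\<omega>. V (\<tau> n i \<omega>) \<omega>) (\<lambda>\<omega>. V (\<tau> (Suc n) (Min UNIV) \<omega>) \<omega>) R G"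
  using assms
proof (induction "card {i<..}" arbitrary: i rule: less_induct)
  case less
  note visit = branching_step_visit[OF less.prems]
  show ?case
  proof (cases "i = Max UNIV")
    case True
    have le: "k \<le> i" for k
      using True by simp
    have after: "after_queue i u = u" for u
      using le by (simp add: after_queue_def vec_eq_iff)
    have "{i..} = {i}"
      using le by (auto intro: antisym)
    then have "(\<lambda>v. \<Prod>j\<in>{i..}. lst (switch_law j) (\<phi> (after_queue j v))) = (\<lambda>v. lst (switch_law i) (\<phi> v))"
      by (simp add: after)
    moreover have "(\<lambda>k u. if k < i then u $ k else branching_mechanism \<eta> k u) = (\<lambda>k u. if k = i then \<eta> i u else u $ k)"
      using le by (auto simp: fun_eq_iff branching_mechanism_after_queue after less_le)
    moreover have "next_arrival \<tau> n i = \<tau> (Suc n) (Min UNIV)"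
      using True by (simp add: next_arrival_def)
    ultimately show ?thesis
      using visit True by (auto simp: next_past_Max)
  next
    case False
    define i' where "i' = Min {i<..}"
    have less: "j < i' \<longleftrightarrow> j \<le> i" for j
      unfolding i'_def using False by (rule less_Min_greater)
    have na: "next_arrival \<tau> n i = \<tau> n i'"
      using False by (simp add: next_arrival_def i'_def)
    note visit' = visit[unfolded na next_past_less[OF False] i'_def[symmetric]]
    \<comment> \<open>Besides its role in the composition, the visit supplies the measurability and
      non-negativity of the workload on arrival at \<open>i'\<close>, the premises of the induction
      hypothesis.\<close>
    interpret A: branching_step M "source_algebra (past n i)" "source_algebra (past n i')"
      "\<lambda>k u. if k = i then \<eta> i u else u $ k" "\<lambda>v. lst (switch_law i) (\<phi> v)"
      "\<lambda>\<omega>. V (\<tau> n i \<omega>) \<omega>" "\<lambda>\<omega>. V (\<tau> n i' \<omega>) \<omega>"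
      "\<lambda>k s \<omega>. if k = i then H n i s \<omega> else s *\<^sub>R axis k 1" "\<lambda>\<omega>. W n i (S n i \<omega>) \<omega>"
      by (rule visit')
    have "i < i'"
      using less[of i'] by simp
    then have "{i'<..} \<subset> {i<..}"
      by auto
    then have "card {i'<..} < card {i<..}"
      by (intro psubset_card_mono) auto
    from less.hyps[OF this A.Y_measurable A.Y_nonneg] obtain R G where
      "branching_step M (source_algebra (past n i')) (source_algebra (past (Suc n) (Min UNIV)))
        (\<lambda>k u. if k < i' then u $ k else branching_mechanism \<eta> k u)
        (\<lambda>v. \<Prod>j\<in>{i'..}. lst (switch_law j) (\<phi> (after_queue j v)))
        (\<lambda>\<omega>. V (\<tau> n i' \<omega>) \<omega>) (\<lambda>\<omega>. V (\<tau> (Suc n) (Min UNIV) \<omega>) \<omega>) R G"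
      by auto
    note comp = branching_step_compose[OF visit' this]
    \<comment> \<open>As \<open>i'\<close> is the successor of \<open>i\<close>, strictly before
      \<open>i'\<close> means up to \<open>i\<close>; the exponents of the rest of the cycle
      therefore form \<open>after_queue i u\<close>.\<close>
    have eq_arg: "(\<chi> k. if k < i' then u $ k else branching_mechanism \<eta> k u) = after_queue i u" for u
      by (simp add: after_queue_def less)
    \<comment> \<open>The recursion for the branching mechanism appears here: at type
      \<open>i\<close> the composition evaluates \<open>\<eta> i\<close> at the exponents of the
      rest of the cycle, while every other type passes through the visit unchanged.\<close>
    have eq_exponent: "(\<lambda>k u. if k = i then \<eta> i (after_queue i u) else after_queue i u $ k)
        = (\<lambda>k u. if k < i then u $ k else branching_mechanism \<eta> k u)"
    proof (intro ext)
      show "(if k = i then \<eta> i (after_queue i u) else after_queue i u $ k)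
          = (if k < i then u $ k else branching_mechanism \<eta> k u)" for k u
      proof (cases "k = i")
        case False
        then show ?thesis
          by (simp add: after_queue_def le_less)
      qed (simp add: branching_mechanism_after_queue)
    qed
    have eq_immigration: "lst (switch_law i) (\<phi> (after_queue i v)) * (\<Prod>j\<in>{i'..}. lst (switch_law j) (\<phi> (after_queue j v)))
        = (\<Prod>j\<in>{i..}. lst (switch_law j) (\<phi> (after_queue j v)))" for v
    proof -
      have ge: "i' \<le> j \<longleftrightarrow> i < j" for j
        by (metis less not_le)
      have "{i..} = insert i {i'..}"
        by (intro set_eqI) (simp add: ge, metis le_less)
      moreover have "i \<notin> {i'..}"
        by (simp add: ge)
      ultimately show ?thesis
        by simp
    qed
    show ?thesis
      using comp unfolding eq_arg eq_exponent eq_immigration .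
  qed
qed

lemma mtjbp_workload:
  "\<exists>\<nu>. mtjbp M (\<lambda>n \<omega>. V (\<tau> n (Min UNIV) \<omega>) \<omega>) (branching_mechanism \<eta>) \<nu> \<and>
    (\<forall>u\<ge>0. lst \<nu> u = (\<Prod>i\<in>UNIV. lst (switch_law i) (\<phi> (after_queue i u))))"
proof -
  let ?B = "\<lambda>n \<omega>. V (\<tau> n (Min UNIV) \<omega>) \<omega>"
  let ?step = "\<lambda>n. branching_step M (source_algebra (past n (Min UNIV))) (source_algebra (past (Suc n) (Min UNIV)))
    (branching_mechanism \<eta>) (\<lambda>u. \<Prod>i\<in>UNIV. lst (switch_law i) (\<phi> (after_queue i u))) (?B n) (?B (Suc n))"
  have Min: "\<not> k < Min UNIV" "{Min UNIV..} = (UNIV :: 'n set)" for k :: 'n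
    using Min_le[of "UNIV :: 'n set"] by (auto simp: not_less simp del: Min_le)
  have step: "\<exists>R G. ?step n R G"
    if "?B n \<in> borel_measurable (source_algebra (past n (Min UNIV)))" "\<And>\<omega>. \<omega> \<in> space M \<Longrightarrow> 0 \<le> ?B n \<omega>" for n
    using branching_step_from_queue[OF that] by (simp add: Min)
  \<comment> \<open>Adaptedness to the sources of earlier cycles is known only at time
    \<open>0\<close>; each cycle hands it on to the next through the measurability of the outcome of
    a step.\<close>
  have "?B n \<in> borel_measurable (source_algebra (past n (Min UNIV))) \<and> (\<forall>\<omega>\<in>space M. 0 \<le> ?B n \<omega>)" for n
  proof (induction n)
    case 0
    have "V 0 \<in> borel_measurable (source_algebra (past 0 (Min UNIV)))"
      by (rule initial_measurable_source) (simp add: past_def)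
    then have "?B 0 \<in> borel_measurable (source_algebra (past 0 (Min UNIV)))"
      by (rule measurable_cong[THEN iffD1, rotated]) (simp add: space_source_algebra start)
    then show ?case
      using workload_nonneg[of _ 0] by (simp add: start)
  next
    case (Suc n)
    then obtain R G where "?step n R G"
      using step[of n] by blast
    then interpret branching_step M "source_algebra (past n (Min UNIV))" "source_algebra (past (Suc n) (Min UNIV))"
      "branching_mechanism \<eta>" "\<lambda>u. \<Prod>i\<in>UNIV. lst (switch_law i) (\<phi> (after_queue i u))" "?B n" "?B (Suc n)" R G .
    show ?case
      using Y_measurable Y_nonneg by blast
  qed
  then have inv: "?B n \<in> borel_measurable (source_algebra (past n (Min UNIV)))"
    "\<And>\<omega>. \<omega> \<in> space M \<Longrightarrow> 0 \<le> ?B n \<omega>" for n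
    by blast+
  define st where "st n R G \<longleftrightarrow> ?step n R G" for n R G
  have "\<exists>R G. st n R G" for n
    unfolding st_def by (rule step[OF inv])
  then obtain R G where st: "\<And>n. st n (R n) (G n)"
    by metis
  show ?thesis
    by (rule mtjbp_of_branching_steps[where Fl="\<lambda>n. source_algebra (past n (Min UNIV))" and B="?B" and R=R and G=G])
       (rule st[unfolded st_def])
qed

end

theorem theorem2:
  fixes M :: "'w measure"
    and \<phi> :: "(real, 'n::{finite,linorder}) vec \<Rightarrow> real"
    and \<eta> :: "'n \<Rightarrow> (real, 'n) vec \<Rightarrow> real"
    and switch_law :: "'n \<Rightarrow> real measure"
    and W A H :: "nat \<Rightarrow> 'n \<Rightarrow> real \<Rightarrow> 'w \<Rightarrow> (real, 'n) vec"
    and S \<tau> \<sigma> :: "nat \<Rightarrow> 'n \<Rightarrow> 'w \<Rightarrow> real"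
    and V :: "real \<Rightarrow> 'w \<Rightarrow> (real, 'n) vec"
    and t :: "nat \<Rightarrow> 'w \<Rightarrow> real"
    and B :: "nat \<Rightarrow> 'w \<Rightarrow> (real, 'n) vec"
    and \<kappa> :: "'n \<Rightarrow> (real, 'n) vec \<Rightarrow> real"
  assumes "levy_polling_system M \<phi> \<eta> switch_law W A H S \<tau> \<sigma> V"
  defines "t \<equiv> \<lambda>n. \<tau> n (Min UNIV)"
    and "B \<equiv> \<lambda>n \<omega>. V (t n \<omega>) \<omega>"
    and "\<kappa> \<equiv> branching_mechanism \<eta>"
  shows "(\<forall>i u. \<kappa> i u = \<eta> i (\<chi> j. if j \<le> i then u $ j else \<kappa> j u)) \<and>
    (\<exists>\<nu>. mtjbp M B \<kappa> \<nu> \<and>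
      (\<forall>u\<ge>0. lst \<nu> u =
        (\<Prod>i\<in>UNIV. lst (switch_law i) (\<phi> (\<chi> j. if j \<le> i then u $ j else \<kappa> j u)))))"
proof -
  interpret levy_polling_system M \<phi> \<eta> switch_law W A H S \<tau> \<sigma> V
    by fact
  show ?thesis
    unfolding t_def B_def \<kappa>_def
  proof (intro conjI allI)
    show "branching_mechanism \<eta> i u = \<eta> i (\<chi> j. if j \<le> i then u $ j else branching_mechanism \<eta> j u)" for i u
      by (rule branching_mechanism.simps)
  qed (rule mtjbp_workload[unfolded after_queue_def])
qed

end
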